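(* Let $\varphi$ be a non-elliptic automorphism of $\mathbb{D}$. (a) Let $B$ be a thin Blaschke product and let $\mathcal{H}$ be the closure in $H^2$ of the linear span of $L_\varphi(B)$. Then either $\mathcal{H}=H^2$, or $\mathcal{H}=(zbH^2)^\perp$, where $b$ is a Blaschke product with simple (or no) zeros that satisfies $b\circ\varphi=\gamma\, b$ for some $\gamma\in\partial\mathbb{D}$. (b) Conversely, if $\mathcal{H}$ is $H^2$, or $\mathcal{H}=(zbH^2)^\perp$ for some Blaschke product $b$ with simple (or no) zeros that satisfies $b\circ\varphi=\gamma\, b$ for some $\gamma\in\partial\mathbb{D}$, then there is a thin Blaschke product $B$ such that the closure in $H^2$ of the linear span of $L_\varphi(B)$ equals $\mathcal{H}$.
   Context: $\mathbb{D}$ is the open unit disc in $\mathbb{C}$ and $H^2$ is the classical Hardy space on $\mathbb{D}$; $H^\infty$ is the space of bounded analytic functions on $\mathbb{D}$. An automorphism $\varphi$ of $\mathbb{D}$ is non-elliptic if it is hyperbolic (it fixes exactly two points, both on $\partial\mathbb{D}$) or parabolic (it fixes exactly one point, located on $\partial\mathbb{D}$); in particular it is not the identity. For $n\ge 0$, $\varphi^{(n)}$ is the $n$-th iterate of $\varphi$. The pseudo-hyperbolic distance is $\rho(z,w)=\left|\frac{w-z}{1-\overline{w}z}\right|$. A thin Blaschke product is an infinite Blaschke product with distinct zeros $\{z_n\}_{n\ge1}$ such that $\prod_{n\ne k}\rho(z_n,z_k)\to 1$ as $k\to\infty$. For $f\in H^\infty$, $L_\varphi(f)$ is the set of all $g\in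 H^\infty$ such that $f\circ\varphi^{(n_k)}\to g$ uniformly on compact subsets of $\mathbb{D}$ for some strictly increasing sequence $\{n_k\}$ of non-negative integers. $zbH^2=\{zb(z)h(z): h\in H^2\}$, and $N^\perp$ denotes the orthogonal complement in $H^2$ of a closed subspace $N$. A Blaschke product with no zeros is a unimodular constant. *)

theory Defs
  imports "HOL-Complex_Analysis.Complex_Analysis"
begin

text \<open>
  A function on the open unit disc is represented by a function on the whole complex plane that is
  \<open>0\<close> off the disc, so that equality of functions on the disc is equality in HOL and linear
  combinations are pointwise. This applies to the elements of \<open>H\<^sup>2\<close> and \<open>H\<^sup>\<infinity>\<close> and to Blaschke
  products. The values of an automorphism off the disc are irrelevant and left unconstrained.
\<close>

abbreviation unit_disc :: "complex set" where
  "unit_disc \<equiv> ball 0 1"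

abbreviation unit_circle :: "complex set" where
  "unit_circle \<equiv> sphere 0 1"

definition hol_disc :: "(complex \<Rightarrow> complex) set" where
  "hol_disc = {f. f holomorphic_on unit_disc \<and> (\<forall>z. z \<notin> unit_disc \<longrightarrow> f z = 0)}"

definition taylor_coeff :: "(complex \<Rightarrow> complex) \<Rightarrow> nat \<Rightarrow> complex" where
  "taylor_coeff f n = (deriv ^^ n) f 0 / fact n"

definition H2 :: "(complex \<Rightarrow> complex) set" where
  "H2 = {f \<in> hol_disc. summable (\<lambda>n. (cmod (taylor_coeff f n))\<^sup>2)}"

definition H2_inner :: "(complex \<Rightarrow> complex) \<Rightarrow> (complex \<Rightarrow> complex) \<Rightarrow> complex" where
  "H2_inner f g = (\<Sum>n. taylor_coeff f n * cnj (taylor_coeff g n))"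

definition H2_norm :: "(complex \<Rightarrow> complex) \<Rightarrow> real" where
  "H2_norm f = sqrt (\<Sum>n. (cmod (taylor_coeff f n))\<^sup>2)"

definition H2_closure :: "(complex \<Rightarrow> complex) set \<Rightarrow> (complex \<Rightarrow> complex) set" where
  "H2_closure S = {f \<in> H2. \<forall>e>0. \<exists>g\<in>S. H2_norm (\<lambda>z. f z - g z) < e}"

definition H2_orth :: "(complex \<Rightarrow> complex) set \<Rightarrow> (complex \<Rightarrow> complex) set" where
  "H2_orth N = {f \<in> H2. \<forall>g\<in>N. H2_inner f g = 0}"

definition Hinf :: "(complex \<Rightarrow> complex) set" where
  "Hinf = {f \<in> hol_disc. bounded (f ` unit_disc)}"

definition complex_span :: "(complex \<Rightarrow> complex) set \<Rightarrow> (complex \<Rightarrow> complex) set" where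
  "complex_span S = {\<lambda>z. \<Sum>f\<in>F. c f * f z | F c. finite F \<and> F \<subseteq> S}"

definition zbH2 :: "(complex \<Rightarrow> complex) \<Rightarrow> (complex \<Rightarrow> complex) set" where
  "zbH2 b = {\<lambda>z. z * b z * h z | h. h \<in> H2}"

definition disc_automorphism :: "(complex \<Rightarrow> complex) \<Rightarrow> bool" where
  "disc_automorphism \<phi> \<longleftrightarrow> \<phi> holomorphic_on unit_disc \<and> bij_betw \<phi> unit_disc unit_disc"

text \<open>
  An automorphism of the disc extends continuously to the closed disc; its value at a point of the
  circle is the limit from inside the disc.
\<close>

definition fixed_points :: "(complex \<Rightarrow> complex) \<Rightarrow> complex set" where
  "fixed_points \<phi> = {z \<in> unit_disc. \<phi> z = z} \<union>
     {z \<in> unit_circle. (\<phi> \<longlongrightarrow> z) (at z within unit_disc)}"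

definition hyperbolic :: "(complex \<Rightarrow> complex) \<Rightarrow> bool" where
  "hyperbolic \<phi> \<longleftrightarrow> card (fixed_points \<phi>) = 2 \<and> fixed_points \<phi> \<subseteq> unit_circle"

definition parabolic :: "(complex \<Rightarrow> complex) \<Rightarrow> bool" where
  "parabolic \<phi> \<longleftrightarrow> card (fixed_points \<phi>) = 1 \<and> fixed_points \<phi> \<subseteq> unit_circle"

definition non_elliptic_automorphism :: "(complex \<Rightarrow> complex) \<Rightarrow> bool" where
  "non_elliptic_automorphism \<phi> \<longleftrightarrow> disc_automorphism \<phi> \<and> (hyperbolic \<phi> \<or> parabolic \<phi>)"

definition pseudo_hyperbolic :: "complex \<Rightarrow> complex \<Rightarrow> real" where
  "pseudo_hyperbolic z w = cmod ((w - z) / (1 - cnj w * z))"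

definition blaschke_factor :: "complex \<Rightarrow> complex \<Rightarrow> complex" where
  "blaschke_factor a z =
     (if a = 0 then z else of_real (cmod a) / a * ((a - z) / (1 - cnj a * z)))"

text \<open>
  The zeros, repeated according to multiplicity, are \<open>a n\<close> for \<open>n \<in> I\<close>; the set \<open>I\<close> may be
  infinite, finite or empty, and the remaining factors of the product are \<open>1\<close>.
\<close>

definition blaschke_with_zeros ::
    "nat set \<Rightarrow> (nat \<Rightarrow> complex) \<Rightarrow> (complex \<Rightarrow> complex) \<Rightarrow> bool" where
  "blaschke_with_zeros I a b \<longleftrightarrow>
     a ` I \<subseteq> unit_disc \<and> (\<lambda>n. 1 - cmod (a n)) summable_on I \<and>
     (\<exists>c\<in>unit_circle. b = (\<lambda>z. if z \<in> unit_disc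
        then c * (\<Prod>n. if n \<in> I then blaschke_factor (a n) z else 1) else 0))"

definition simple_blaschke_product :: "(complex \<Rightarrow> complex) \<Rightarrow> bool" where
  "simple_blaschke_product b \<longleftrightarrow> (\<exists>I a. blaschke_with_zeros I a b \<and> inj_on a I)"

definition thin_blaschke_product :: "(complex \<Rightarrow> complex) \<Rightarrow> bool" where
  "thin_blaschke_product B \<longleftrightarrow> (\<exists>a. blaschke_with_zeros UNIV a B \<and> inj a \<and>
     (\<lambda>k. \<Prod>n. if n = k then 1 else pseudo_hyperbolic (a n) (a k)) \<longlonglongrightarrow> 1)"

definition L_set :: "(complex \<Rightarrow> complex) \<Rightarrow> (complex \<Rightarrow> complex) \<Rightarrow> (complex \<Rightarrow> complex) set" where
  "L_set \<phi> f = {g \<in> Hinf. \<exists>n :: nat \<Rightarrow> nat. strict_mono n \<and>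
     (\<forall>K. compact K \<and> K \<subseteq> unit_disc \<longrightarrow>
        uniform_limit K (\<lambda>k. f \<circ> (\<phi> ^^ n k)) g sequentially)}"

end

theory Submission
  imports Defs
begin

text \<open>
  Write \<open>m\<^sub>\<alpha>(z) = (\<alpha> - z) / (1 - cnj \<alpha> z)\<close> and \<open>\<rho>(z, \<alpha>) = |m\<^sub>\<alpha>(z)|\<close>. Everything rests on two facts.

  The first is about thin products. If \<open>B\<close> is thin and \<open>\<psi>\<^sub>k\<close> are automorphisms with
  \<open>|\<psi>\<^sub>k(0)| \<rightarrow> 1\<close>, then every limit of \<open>B \<circ> \<psi>\<^sub>k\<close> is a unimodular constant or a unimodular multiple
  of some \<open>m\<^sub>\<alpha>\<close> (\<open>thin_limit_classification\<close>). Indeed, if the limit is not unimodular at \<open>0\<close>, then \<open>B\<close>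
  is small at \<open>\<psi>\<^sub>k(0)\<close>, so by Hoffman's lemma \<open>\<psi>\<^sub>k(0)\<close> is close to a zero of large index; the
  product of the remaining factors is nearly unimodular at this zero, hence, by the Schwarz lemma,
  nearly constant around it, and only the factor of this zero survives in the limit.

  The second is about the orbits of a non-elliptic automorphism \<open>\<phi>\<close>: they converge to a point of
  the circle (\<open>orbit_of_0_tends_to_circle\<close>, \<open>orbit_norm_tends_to_1\<close>). So the first fact applies to
  the iterates of \<open>\<phi>\<close>.

  Let \<open>A\<close> be the set of the points \<open>\<alpha>\<close> at which some function in \<open>L\<^sub>\<phi>(B)\<close> vanishes. It is
  invariant under \<open>\<phi>\<close> and its inverse. The constants lie in the closed span of \<open>L\<^sub>\<phi>(B)\<close>: if no limit
  is constant, then \<open>A\<close> contains an orbit, and \<open>m\<^sub>\<alpha>\<close> approaches a constant as \<open>\<alpha>\<close> approaches the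
  circle. Since \<open>m\<^sub>\<alpha>\<close> is an affine function of the reproducing kernel at \<open>\<alpha>\<close>, the orthogonal
  complement of \<open>L\<^sub>\<phi>(B)\<close> consists of the functions \<open>z h\<close> with \<open>h\<close> vanishing on \<open>A\<close>
  (\<open>H2_orth_L_set\<close>). Either only \<open>h = 0\<close> vanishes on \<open>A\<close>, and the closed span is \<open>H\<^sup>2\<close>; or \<open>A\<close>
  satisfies the Blaschke condition, the functions vanishing on \<open>A\<close> are the multiples of the Blaschke
  product \<open>b\<close> with simple zeros at \<open>A\<close>, and the closed span is \<open>(z b H\<^sup>2)\<^sup>\<bottom>\<close>; invariance of \<open>A\<close> gives
  \<open>b \<circ> \<phi> = \<gamma> b\<close>.

  For the converse it is enough to find a thin product with a prescribed set \<open>A\<close>. Take zeros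
  \<open>\<phi>\<^sup>(\<^sup>m\<^sup>)(\<beta>)\<close>, where \<open>\<beta>\<close> runs through \<open>A\<close> and takes each value infinitely often, and where \<open>m\<close>
  increases so fast that the zeros are thin; the empty set \<open>A\<close> needs zeros that avoid the orbits.

  Hardy space theory is developed from Taylor coefficients only, without boundary values: that a
  Blaschke factor acts isometrically is replaced by a telescoping identity
  (\<open>telescoping_blaschke_factor\<close>).
\<close>

section \<open>Square-summable sequences as a Hilbert space\<close>

text \<open>The sequences are made into a type so that they form a complete real inner product space, the inner
  product being the real part of the complex one. Orthogonality for the complex inner product
  is recovered later for sets that are closed under multiplication by \<open>\<i>\<close>.\<close>

typedef ell2 = "{a :: nat \<Rightarrow> complex. summable (\<lambda>n. (cmod (a n))\<^sup>2)}"
  morphisms nth_ell2 Ell2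
  by (rule exI[of _ "\<lambda>_. 0"]) simp

setup_lifting type_definition_ell2

lemma summable_nth_ell2: "summable (\<lambda>n. (cmod (nth_ell2 x n))\<^sup>2)"
  using nth_ell2[of x] by simp

lemma ell2_eqI: "(\<And>n. nth_ell2 x n = nth_ell2 y n) \<Longrightarrow> x = y"
  by (metis ext nth_ell2_inject)

lemma summable_sq_add:
  assumes "summable (\<lambda>n. (cmod (a n))\<^sup>2)" "summable (\<lambda>n. (cmod (b n))\<^sup>2)"
  shows "summable (\<lambda>n. (cmod (a n + b n))\<^sup>2)"
proof (rule summable_comparison_test'[where N = 0])
  show "summable (\<lambda>n. 2 * (cmod (a n))\<^sup>2 + 2 * (cmod (b n))\<^sup>2)"
    by (intro summable_add summable_mult assms)
  fix n
  have "(cmod (a n + b n))\<^sup>2 \<le> (cmod (a n) + cmod (b n))\<^sup>2"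
    by (intro power_mono norm_triangle_ineq) auto
  also have "\<dots> \<le> 2 * (cmod (a n))\<^sup>2 + 2 * (cmod (b n))\<^sup>2"
    using sum_squares_bound[of "cmod (a n)" "cmod (b n)"] by (simp add: power2_sum)
  finally show "norm ((cmod (a n + b n))\<^sup>2) \<le> 2 * (cmod (a n))\<^sup>2 + 2 * (cmod (b n))\<^sup>2" by simp
qed

lemma summable_sq_cmult:
  assumes "summable (\<lambda>n. (cmod (a n))\<^sup>2)"
  shows "summable (\<lambda>n. (cmod (c * a n))\<^sup>2)"
  using summable_mult[OF assms, of "(cmod c)\<^sup>2"] by (simp add: norm_mult power_mult_distrib)

lemma abs_summable_mult_sq:
  assumes "summable (\<lambda>n. (cmod (a n))\<^sup>2)" "summable (\<lambda>n. (cmod (b n))\<^sup>2)"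
  shows "summable (\<lambda>n. cmod (a n * b n))"
proof (rule summable_comparison_test'[where N = 0])
  show "summable (\<lambda>n. (cmod (a n))\<^sup>2 + (cmod (b n))\<^sup>2)"
    by (intro summable_add assms)
  fix n
  have "0 \<le> cmod (a n) * cmod (b n)" by simp
  then have "cmod (a n) * cmod (b n) \<le> (cmod (a n))\<^sup>2 + (cmod (b n))\<^sup>2"
    using sum_squares_bound[of "cmod (a n)" "cmod (b n)"] by linarith
  then show "norm (cmod (a n * b n)) \<le> (cmod (a n))\<^sup>2 + (cmod (b n))\<^sup>2"
    by (simp add: norm_mult)
qed

lemma summable_ell2_prod: "summable (\<lambda>n. nth_ell2 x n * cnj (nth_ell2 y n))"
  by (rule summable_norm_cancel, rule abs_summable_mult_sq) (simp_all add: summable_nth_ell2)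

instantiation ell2 :: real_inner
begin

lift_definition zero_ell2 :: ell2 is "\<lambda>_. 0" by simp
lift_definition plus_ell2 :: "ell2 \<Rightarrow> ell2 \<Rightarrow> ell2" is "\<lambda>a b n. a n + b n"
  by (rule summable_sq_add)
lift_definition uminus_ell2 :: "ell2 \<Rightarrow> ell2" is "\<lambda>a n. - a n" by simp
lift_definition minus_ell2 :: "ell2 \<Rightarrow> ell2 \<Rightarrow> ell2" is "\<lambda>a b n. a n - b n"
  using summable_sq_add[where b = "\<lambda>n. - b n" for b :: "nat \<Rightarrow> complex"] by simp
lift_definition scaleR_ell2 :: "real \<Rightarrow> ell2 \<Rightarrow> ell2" is "\<lambda>r a n. of_real r * a n"
  by (rule summable_sq_cmult)
definition inner_ell2 :: "ell2 \<Rightarrow> ell2 \<Rightarrow> real"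
  where "inner_ell2 x y = Re (\<Sum>n. nth_ell2 x n * cnj (nth_ell2 y n))"
definition norm_ell2 :: "ell2 \<Rightarrow> real" where "norm_ell2 x = sqrt (inner x x)"
definition dist_ell2 :: "ell2 \<Rightarrow> ell2 \<Rightarrow> real" where "dist_ell2 x y = norm (x - y)"
definition sgn_ell2 :: "ell2 \<Rightarrow> ell2" where "sgn_ell2 x = scaleR (inverse (norm x)) x"
definition uniformity_ell2 :: "(ell2 \<times> ell2) filter"
  where "uniformity_ell2 = (INF e\<in>{0<..}. principal {(x, y). dist x y < e})"
definition open_ell2 :: "ell2 set \<Rightarrow> bool"
  where "open_ell2 U \<longleftrightarrow> (\<forall>x\<in>U. \<forall>\<^sub>F (x', y) in uniformity. x' = x \<longrightarrow> y \<in> U)"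

lemma inner_ell2_self: "inner x x = (\<Sum>n. (cmod (nth_ell2 x n))\<^sup>2)"
proof -
  have "(\<lambda>n. nth_ell2 x n * cnj (nth_ell2 x n)) = (\<lambda>n. of_real ((cmod (nth_ell2 x n))\<^sup>2))"
    by (rule ext) (metis complex_norm_square)
  then show ?thesis
    using suminf_of_real[OF summable_nth_ell2[of x], where ?'a = complex, symmetric]
    by (simp only: inner_ell2_def Re_complex_of_real)
qed

instance
proof
  fix x y z :: ell2 and r s :: real
  show "x + y + z = x + (y + z)" by transfer (auto simp: algebra_simps)
  show "x + y = y + x" by transfer (auto simp: algebra_simps)
  show "0 + x = x" by transfer auto
  show "- x + x = 0" by transfer auto
  show "x - y = x + - y" by transfer auto
  show "r *\<^sub>R (x + y) = r *\<^sub>R x + r *\<^sub>R y" by transfer (auto simp: algebra_simps)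
  show "(r + s) *\<^sub>R x = r *\<^sub>R x + s *\<^sub>R x" by transfer (auto simp: algebra_simps)
  show "r *\<^sub>R s *\<^sub>R x = (r * s) *\<^sub>R x" by transfer (auto simp: algebra_simps)
  show "1 *\<^sub>R x = x" by transfer auto
  show "dist x y = norm (x - y)" by (rule dist_ell2_def)
  show "sgn x = scaleR (inverse (norm x)) x" by (rule sgn_ell2_def)
  show "(uniformity :: (ell2 \<times> ell2) filter) = (INF e\<in>{0<..}. principal {(x, y). dist x y < e})"
    by (rule uniformity_ell2_def)
  show "norm x = sqrt (inner x x)" by (rule norm_ell2_def)
  show "inner x y = inner y x"
  proof -
    have "(\<Sum>n. nth_ell2 y n * cnj (nth_ell2 x n)) = (\<Sum>n. cnj (nth_ell2 x n * cnj (nth_ell2 y n)))"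
      by (simp add: mult.commute)
    also have "\<dots> = cnj (\<Sum>n. nth_ell2 x n * cnj (nth_ell2 y n))"
      using sums_cnj[THEN iffD2, OF summable_sums[OF summable_ell2_prod[of x y]]]
      by (simp add: sums_iff)
    finally show ?thesis by (simp add: inner_ell2_def)
  qed
  show "inner (x + y) z = inner x z + inner y z"
    by (simp add: inner_ell2_def plus_ell2.rep_eq distrib_right suminf_add[symmetric]
        summable_ell2_prod)
  show "inner (r *\<^sub>R x) y = r * inner x y"
    by (simp add: inner_ell2_def scaleR_ell2.rep_eq mult.assoc suminf_mult summable_ell2_prod)
  show "0 \<le> inner x x"
    unfolding inner_ell2_self by (intro suminf_nonneg summable_nth_ell2 zero_le_power2)
  show "inner x x = 0 \<longleftrightarrow> x = 0"
    unfolding inner_ell2_self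
    by (subst suminf_eq_zero_iff) (auto simp: summable_nth_ell2 zero_ell2.rep_eq intro: ell2_eqI)
qed (rule open_ell2_def)

end

lemma norm_ell2_sq: "(norm x)\<^sup>2 = (\<Sum>n. (cmod (nth_ell2 x n))\<^sup>2)"
  by (simp add: power2_norm_eq_inner[of x] inner_ell2_self)

lemma sum_le_norm_ell2_sq: "(\<Sum>n<N. (cmod (nth_ell2 x n))\<^sup>2) \<le> (norm x)\<^sup>2"
  unfolding norm_ell2_sq by (intro sum_le_suminf summable_nth_ell2) auto

lemma norm_nth_ell2_le: "cmod (nth_ell2 x n) \<le> norm x"
proof -
  have "(cmod (nth_ell2 x n))\<^sup>2 \<le> (\<Sum>k<Suc n. (cmod (nth_ell2 x k))\<^sup>2)"
    by (rule member_le_sum) auto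
  also have "\<dots> \<le> (norm x)\<^sup>2" by (rule sum_le_norm_ell2_sq)
  finally show ?thesis by (simp add: power2_le_iff_abs_le)
qed

instance ell2 :: complete_space
proof
  fix X :: "nat \<Rightarrow> ell2"
  assume X: "Cauchy X"
  have "Cauchy (\<lambda>k. nth_ell2 (X k) n)" for n
  proof (rule metric_CauchyI)
    fix e :: real assume "e > 0"
    then obtain M where M: "\<And>m k. m \<ge> M \<Longrightarrow> k \<ge> M \<Longrightarrow> dist (X m) (X k) < e"
      using X unfolding Cauchy_def by meson
    have "dist (nth_ell2 (X m) n) (nth_ell2 (X k) n) < e" if "m \<ge> M" "k \<ge> M" for m k
      using norm_nth_ell2_le[of "X m - X k" n] M[OF that] by (simp add: dist_norm minus_ell2.rep_eq)
    then show "\<exists>M. \<forall>m\<ge>M. \<forall>k\<ge>M. dist (nth_ell2 (X m) n) (nth_ell2 (X k) n) < e" by blast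
  qed
  then have "\<forall>n. \<exists>l. (\<lambda>k. nth_ell2 (X k) n) \<longlonglongrightarrow> l"
    using Cauchy_convergent convergent_def by blast
  then obtain L where L: "\<And>n. (\<lambda>k. nth_ell2 (X k) n) \<longlonglongrightarrow> L n" by metis
  have close: "\<exists>M. \<forall>k\<ge>M. \<forall>N. (\<Sum>n<N. (cmod (L n - nth_ell2 (X k) n))\<^sup>2) \<le> e\<^sup>2" if "e > 0" for e
  proof -
    obtain M where M: "\<And>m k. m \<ge> M \<Longrightarrow> k \<ge> M \<Longrightarrow> dist (X m) (X k) < e"
      using X \<open>e > 0\<close> unfolding Cauchy_def by meson
    have "(\<Sum>n<N. (cmod (L n - nth_ell2 (X k) n))\<^sup>2) \<le> e\<^sup>2" if "k \<ge> M" for k N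
    proof (rule tendsto_upperbound)
      show "(\<lambda>m. \<Sum>n<N. (cmod (nth_ell2 (X m) n - nth_ell2 (X k) n))\<^sup>2)
        \<longlonglongrightarrow> (\<Sum>n<N. (cmod (L n - nth_ell2 (X k) n))\<^sup>2)"
        by (intro tendsto_intros L)
      have "(\<Sum>n<N. (cmod (nth_ell2 (X m) n - nth_ell2 (X k) n))\<^sup>2) \<le> e\<^sup>2" if "m \<ge> M" for m
      proof -
        have "(\<Sum>n<N. (cmod (nth_ell2 (X m) n - nth_ell2 (X k) n))\<^sup>2) \<le> (norm (X m - X k))\<^sup>2"
          using sum_le_norm_ell2_sq[of "X m - X k" N] by (simp add: minus_ell2.rep_eq)
        also have "\<dots> \<le> e\<^sup>2"
          using M[OF that \<open>k \<ge> M\<close>] by (intro power_mono) (auto simp: dist_norm)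
        finally show ?thesis .
      qed
      then show "\<forall>\<^sub>F m in sequentially. (\<Sum>n<N. (cmod (nth_ell2 (X m) n - nth_ell2 (X k) n))\<^sup>2) \<le> e\<^sup>2"
        unfolding eventually_sequentially by blast
    qed simp
    then show ?thesis by blast
  qed
  have "summable (\<lambda>n. (cmod (L n))\<^sup>2)"
  proof -
    obtain k where k: "\<And>N. (\<Sum>n<N. (cmod (L n - nth_ell2 (X k) n))\<^sup>2) \<le> 1\<^sup>2"
      using close[of 1] by auto
    have "summable (\<lambda>n. (cmod (L n - nth_ell2 (X k) n))\<^sup>2)"
      by (rule bounded_imp_summable[where B = "1\<^sup>2"]) (use k[of "Suc _"] in \<open>auto simp: lessThan_Suc_atMost\<close>)
    from summable_sq_add[OF this summable_nth_ell2[of "X k"]] show ?thesis by simp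
  qed
  then have nthL: "nth_ell2 (Ell2 L) = L" by (simp add: Ell2_inverse)
  have "X \<longlonglongrightarrow> Ell2 L"
  proof (rule metric_LIMSEQ_I)
    fix e :: real assume "e > 0"
    then obtain M where M: "\<And>k N. k \<ge> M \<Longrightarrow> (\<Sum>n<N. (cmod (L n - nth_ell2 (X k) n))\<^sup>2) \<le> (e/2)\<^sup>2"
      using close[of "e/2"] by auto
    have "dist (X k) (Ell2 L) < e" if "k \<ge> M" for k
    proof -
      have "(norm (Ell2 L - X k))\<^sup>2 \<le> (e/2)\<^sup>2"
        unfolding norm_ell2_sq
        by (rule suminf_le_const[OF summable_nth_ell2]) (use M[OF that] in \<open>simp add: minus_ell2.rep_eq nthL\<close>)
      then have "norm (Ell2 L - X k) \<le> e/2" using \<open>e > 0\<close> by (simp add: power2_le_iff_abs_le)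
      then show ?thesis using \<open>e > 0\<close> by (simp add: dist_norm norm_minus_commute)
    qed
    then show "\<exists>M. \<forall>k\<ge>M. dist (X k) (Ell2 L) < e" by blast
  qed
  then show "convergent X" by (auto simp: convergent_def)
qed

text \<open>The vector is the difference between \<open>x\<close> and its nearest point in the closure of \<open>S\<close>. A minimizing
  sequence for the distance is a Cauchy sequence by the parallelogram law, and the nearest point
  exists by completeness.\<close>

lemma separation_by_orthogonal_vector:
  fixes S :: "'a::{real_inner,complete_space} set"
  assumes S: "subspace S" and x: "x \<notin> closure S"
  obtains y where "\<And>s. s \<in> S \<Longrightarrow> inner y s = 0" "inner x y \<noteq> 0"
proof -
  define d where "d = infdist x S"
  have ne: "S \<noteq> {}" using S subspace_0 by blast
  have dle: "d \<le> norm (x - s)" if "s \<in> S" for s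
    using infdist_le[OF that, of x] by (simp add: d_def dist_norm)
  have d0: "d \<ge> 0" by (simp add: d_def infdist_nonneg)
  have "\<exists>w\<in>S. norm (x - w) < d + 1 / real (Suc n)" for n
  proof (rule ccontr)
    assume "\<not> ?thesis"
    then have "d + 1 / real (Suc n) \<le> dist x s" if "s \<in> S" for s
      using that by (force simp: dist_norm)
    then have "d + 1 / real (Suc n) \<le> (INF s\<in>S. dist x s)"
      by (rule cINF_greatest[OF ne])
    then have "d + 1 / real (Suc n) \<le> d"
      using ne by (simp add: d_def infdist_def)
    then show False by (simp add: field_simps)
  qed
  then obtain w where wS: "\<And>n. w n \<in> S" and w: "\<And>n. norm (x - w n) < d + 1 / real (Suc n)" by metis
  have "(\<lambda>n. d + 1 / real (Suc n)) \<longlonglongrightarrow> d + 0"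
    by (intro tendsto_intros lim_1_over_n[THEN LIMSEQ_Suc])
  then have lim1: "(\<lambda>n. d + 1 / real (Suc n)) \<longlonglongrightarrow> d" by simp
  have normlim: "(\<lambda>n. norm (x - w n)) \<longlonglongrightarrow> d"
    by (rule tendsto_sandwich[OF _ _ tendsto_const lim1])
      (use dle[OF wS] w less_imp_le in \<open>auto intro!: always_eventually\<close>)
  have par: "(norm (w m - w n))\<^sup>2 \<le> 2 * (norm (x - w m))\<^sup>2 + 2 * (norm (x - w n))\<^sup>2 - 4 * d\<^sup>2" for m n
  proof -
    have "(1/2) *\<^sub>R (w m + w n) \<in> S" using S wS by (intro subspace_scale subspace_add)
    from dle[OF this] have "d\<^sup>2 \<le> (norm (x - (1/2) *\<^sub>R (w m + w n)))\<^sup>2" using d0 by (rule power_mono)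
    moreover have "(norm (w m - w n))\<^sup>2 + 4 * (norm (x - (1/2) *\<^sub>R (w m + w n)))\<^sup>2 =
        2 * (norm (x - w m))\<^sup>2 + 2 * (norm (x - w n))\<^sup>2"
      by (simp add: power2_norm_eq_inner algebra_simps inner_commute)
    ultimately show ?thesis by linarith
  qed
  have "Cauchy w"
  proof (rule metric_CauchyI)
    fix e :: real assume "e > 0"
    have "(\<lambda>n. 2 * (norm (x - w n))\<^sup>2) \<longlonglongrightarrow> 2 * d\<^sup>2" by (intro tendsto_intros normlim)
    then have "\<forall>\<^sub>F n in sequentially. 2 * (norm (x - w n))\<^sup>2 < 2 * d\<^sup>2 + e\<^sup>2 / 2"
      by (rule order_tendstoD) (use \<open>e > 0\<close> in simp)
    then obtain M where M: "\<And>n. n \<ge> M \<Longrightarrow> 2 * (norm (x - w n))\<^sup>2 < 2 * d\<^sup>2 + e\<^sup>2 / 2"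
      unfolding eventually_sequentially by blast
    have "dist (w m) (w n) < e" if "m \<ge> M" "n \<ge> M" for m n
    proof -
      have "(norm (w m - w n))\<^sup>2 < e\<^sup>2" using par[of m n] M[OF that(1)] M[OF that(2)] by linarith
      then show ?thesis using \<open>e > 0\<close> by (simp add: dist_norm power_less_imp_less_base)
    qed
    then show "\<exists>M. \<forall>m\<ge>M. \<forall>n\<ge>M. dist (w m) (w n) < e" by blast
  qed
  then obtain p where p: "w \<longlonglongrightarrow> p" using Cauchy_convergent convergent_def by blast
  have pS: "p \<in> closure S" using p wS closure_sequential by blast
  have "(\<lambda>n. norm (x - w n)) \<longlonglongrightarrow> norm (x - p)" by (intro tendsto_intros p)
  then have dp: "norm (x - p) = d" using normlim LIMSEQ_unique by blast
  have dle': "d \<le> norm (x - s)" if s: "s \<in> closure S" for s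
  proof -
    obtain u where u: "\<And>n. u n \<in> S" "u \<longlonglongrightarrow> s" using s closure_sequential by blast
    have "(\<lambda>n. norm (x - u n)) \<longlonglongrightarrow> norm (x - s)" by (intro tendsto_intros u)
    then show ?thesis by (rule LIMSEQ_le_const) (use dle[OF u(1)] in blast)
  qed
  have orth: "inner (x - p) s = 0" if "s \<in> S" for s
  proof (cases "s = 0")
    case False
    \<comment> \<open>The multiple of \<open>s\<close> nearest to \<open>x - p\<close>; moving \<open>p\<close> along it cannot bring it closer to \<open>x\<close>.\<close>
    define t where "t = inner (x - p) s / (norm s)\<^sup>2"
    have "p + t *\<^sub>R s \<in> closure S"
    proof (rule closure_sequential[THEN iffD2], intro exI conjI allI)
      show "w n + t *\<^sub>R s \<in> S" for n using S wS that by (intro subspace_add subspace_scale)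
      show "(\<lambda>n. w n + t *\<^sub>R s) \<longlonglongrightarrow> p + t *\<^sub>R s" by (intro tendsto_intros p)
    qed
    from dle'[OF this] have "d\<^sup>2 \<le> (norm ((x - p) - t *\<^sub>R s))\<^sup>2"
      using d0 by (intro power_mono) (auto simp: algebra_simps)
    also have "\<dots> = d\<^sup>2 - 2 * t * inner (x - p) s + t\<^sup>2 * (norm s)\<^sup>2"
      unfolding dp[symmetric] power2_norm_eq_inner
      by (simp add: inner_diff_left inner_diff_right inner_commute power2_eq_square algebra_simps)
    also have "t\<^sup>2 * (norm s)\<^sup>2 = t * inner (x - p) s"
      using False by (simp add: t_def power2_eq_square)
    finally have "t * inner (x - p) s \<le> 0" by simp
    then have "(inner (x - p) s)\<^sup>2 \<le> 0" using False
      by (simp add: t_def power2_eq_square divide_le_0_iff mult_le_0_iff)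
    then show ?thesis by simp
  qed simp
  have "(\<lambda>n. inner (x - p) (w n)) \<longlonglongrightarrow> inner (x - p) p" by (intro tendsto_intros p)
  then have "inner (x - p) p = 0" using orth[OF wS] LIMSEQ_unique[OF _ tendsto_const] by fastforce
  then have "inner x (x - p) = inner (x - p) (x - p)" by (simp add: inner_commute algebra_simps)
  moreover have "x - p \<noteq> 0" using pS x by auto
  ultimately show thesis using that[of "x - p"] orth by simp
qed

section \<open>The Hardy space and orthogonal complements\<close>

lemma sums_taylor_coeff:
  assumes "f holomorphic_on unit_disc" "z \<in> unit_disc"
  shows "(\<lambda>n. taylor_coeff f n * z ^ n) sums f z"
  using holomorphic_power_series[OF assms(1)[unfolded] assms(2)] by (simp add: taylor_coeff_def)

lemma taylor_coeff_unique:
  assumes "\<And>z. z \<in> unit_disc \<Longrightarrow> (\<lambda>n. a n * z ^ n) sums f z"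
  shows "taylor_coeff f n = a n"
proof -
  have "eventually (\<lambda>z::complex. z \<in> unit_disc) (nhds 0)"
    by (intro eventually_nhds_in_open) auto
  then have "f has_fps_expansion Abs_fps a"
    by (intro has_fps_expansionI, elim eventually_mono) (use assms in simp)
  from fps_nth_fps_expansion[OF this, of n] show ?thesis by (simp add: taylor_coeff_def)
qed

lemma taylor_coeff_cong:
  assumes "\<And>z. z \<in> unit_disc \<Longrightarrow> f z = g z"
  shows "taylor_coeff f n = taylor_coeff g n"
proof -
  have "eventually (\<lambda>z::complex. z \<in> unit_disc) (nhds 0)"
    by (intro eventually_nhds_in_open) auto
  then have "eventually (\<lambda>z. f z = g z) (nhds 0)" by eventually_elim (rule assms)
  then show ?thesis by (simp add: taylor_coeff_def higher_deriv_cong_ev)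
qed

lemma taylor_coeff_0: "taylor_coeff f 0 = f 0"
  by (simp add: taylor_coeff_def)

lemma taylor_coeff_diff:
  assumes "f holomorphic_on unit_disc" "g holomorphic_on unit_disc"
  shows "taylor_coeff (\<lambda>z. f z - g z) n = taylor_coeff f n - taylor_coeff g n"
  by (rule taylor_coeff_unique) (auto simp: left_diff_distrib intro!: sums_diff sums_taylor_coeff assms)

lemma taylor_coeff_add:
  assumes "f holomorphic_on unit_disc" "g holomorphic_on unit_disc"
  shows "taylor_coeff (\<lambda>z. f z + g z) n = taylor_coeff f n + taylor_coeff g n"
  by (rule taylor_coeff_unique) (auto simp: distrib_right intro!: sums_add sums_taylor_coeff assms)

lemma taylor_coeff_cmult:
  assumes "f holomorphic_on unit_disc"
  shows "taylor_coeff (\<lambda>z. c * f z) n = c * taylor_coeff f n"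
  by (rule taylor_coeff_unique) (auto simp: mult.assoc intro!: sums_mult sums_taylor_coeff assms)

lemma taylor_coeff_mult_z:
  assumes "f holomorphic_on unit_disc"
  shows "taylor_coeff (\<lambda>z. z * f z) (Suc n) = taylor_coeff f n"
proof -
  define a where "a = (\<lambda>k. case k of 0 \<Rightarrow> 0 | Suc j \<Rightarrow> taylor_coeff f j)"
  have "(\<lambda>k. a k * z ^ k) sums (z * f z)" if "z \<in> unit_disc" for z
  proof -
    have "(\<lambda>k. a (Suc k) * z ^ Suc k) sums (z * f z)"
      using sums_mult[OF sums_taylor_coeff[OF assms that], of z] by (simp add: a_def mult_ac)
    from sums_Suc[OF this] show ?thesis by (simp add: a_def)
  qed
  from taylor_coeff_unique[OF this, of "Suc n"] show ?thesis by (simp add: a_def)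
qed

lemma H2_holomorphic: "f \<in> H2 \<Longrightarrow> f holomorphic_on unit_disc"
  by (simp add: H2_def hol_disc_def)

lemma H2_zero_off: "f \<in> H2 \<Longrightarrow> z \<notin> unit_disc \<Longrightarrow> f z = 0"
  by (simp add: H2_def hol_disc_def)

lemma H2_eqI:
  assumes "f \<in> H2" "g \<in> H2" "\<And>z. z \<in> unit_disc \<Longrightarrow> f z = g z"
  shows "f = g"
  using assms H2_zero_off by (intro ext) metis

lemma summable_taylor_coeff_H2: "f \<in> H2 \<Longrightarrow> summable (\<lambda>n. (cmod (taylor_coeff f n))\<^sup>2)"
  by (simp add: H2_def)

lemma H2I_bounded_sums:
  assumes "f holomorphic_on unit_disc" "\<And>z. z \<notin> unit_disc \<Longrightarrow> f z = 0"
    and "\<And>N. (\<Sum>n<N. (cmod (taylor_coeff f n))\<^sup>2) \<le> M"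
  shows "f \<in> H2" "(H2_norm f)\<^sup>2 \<le> M"
proof -
  have s: "summable (\<lambda>n. (cmod (taylor_coeff f n))\<^sup>2)"
    by (rule bounded_imp_summable[where B = M])
      (use assms(3)[of "Suc _"] in \<open>auto simp: lessThan_Suc_atMost\<close>)
  then show "f \<in> H2" using assms by (simp add: H2_def hol_disc_def)
  show "(H2_norm f)\<^sup>2 \<le> M"
    using suminf_le_const[OF s assms(3)] suminf_nonneg[OF s] by (simp add: H2_norm_def)
qed

lemma sum_le_H2_norm_sq:
  assumes "f \<in> H2"
  shows "(\<Sum>n<N. (cmod (taylor_coeff f n))\<^sup>2) \<le> (H2_norm f)\<^sup>2"
  using sum_le_suminf[OF summable_taylor_coeff_H2[OF assms], of "{..<N}"]
    suminf_nonneg[OF summable_taylor_coeff_H2[OF assms]]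
  by (simp add: H2_norm_def)

lemma H2_norm_nonneg: "f \<in> H2 \<Longrightarrow> 0 \<le> H2_norm f"
  using suminf_nonneg[OF summable_taylor_coeff_H2, of f] by (simp add: H2_norm_def)

lemma H2_zero: "(\<lambda>_. 0) \<in> H2"
proof -
  have "taylor_coeff (\<lambda>_. 0) n = 0" for n
    using taylor_coeff_unique[of "\<lambda>_. 0" "\<lambda>_. 0"] by simp
  then show ?thesis by (simp add: H2_def hol_disc_def)
qed

lemma H2_add:
  assumes "f \<in> H2" "g \<in> H2"
  shows "(\<lambda>z. f z + g z) \<in> H2"
  using assms summable_sq_add[of "taylor_coeff f" "taylor_coeff g"]
  by (auto simp: H2_def hol_disc_def taylor_coeff_add intro!: holomorphic_intros)

lemma H2_cmult:
  assumes "f \<in> H2"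
  shows "(\<lambda>z. c * f z) \<in> H2"
  using assms summable_sq_cmult[of "taylor_coeff f" c]
  by (auto simp: H2_def hol_disc_def taylor_coeff_cmult intro!: holomorphic_intros)

lemma H2_diff:
  assumes "f \<in> H2" "g \<in> H2"
  shows "(\<lambda>z. f z - g z) \<in> H2"
  using H2_add[OF assms(1) H2_cmult[OF assms(2), of "-1"]] by simp

lemma H2_mult_z:
  assumes "f \<in> H2"
  shows "(\<lambda>z. z * f z) \<in> H2"
proof (rule H2I_bounded_sums(1))
  show "(\<lambda>z. z * f z) holomorphic_on unit_disc"
    by (intro holomorphic_intros H2_holomorphic assms)
  fix N
  have "(\<Sum>n<N. (cmod (taylor_coeff (\<lambda>z. z * f z) n))\<^sup>2)
      \<le> (\<Sum>n<Suc N. (cmod (taylor_coeff (\<lambda>z. z * f z) n))\<^sup>2)"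
    by (intro sum_mono2) auto
  also have "\<dots> = (\<Sum>n<N. (cmod (taylor_coeff f n))\<^sup>2)"
    by (simp only: sum.lessThan_Suc_shift)
      (simp add: taylor_coeff_0 taylor_coeff_mult_z[OF H2_holomorphic[OF assms]])
  also have "\<dots> \<le> (H2_norm f)\<^sup>2" by (rule sum_le_H2_norm_sq[OF assms])
  finally show "(\<Sum>n<N. (cmod (taylor_coeff (\<lambda>z. z * f z) n))\<^sup>2) \<le> (H2_norm f)\<^sup>2" .
qed (use H2_zero_off[OF assms] in auto)

lemma summable_H2_inner:
  assumes "f \<in> H2" "g \<in> H2"
  shows "summable (\<lambda>n. taylor_coeff f n * cnj (taylor_coeff g n))"
  by (rule summable_norm_cancel, rule abs_summable_mult_sq)
    (use assms in \<open>simp_all add: summable_taylor_coeff_H2\<close>)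

lemma H2_inner_add_right:
  assumes "f \<in> H2" "g \<in> H2" "h \<in> H2"
  shows "H2_inner f (\<lambda>z. g z + h z) = H2_inner f g + H2_inner f h"
  using assms by (simp add: H2_inner_def taylor_coeff_add H2_holomorphic distrib_left
      suminf_add[symmetric] summable_H2_inner)

lemma H2_inner_cmult_right:
  assumes "f \<in> H2" "g \<in> H2"
  shows "H2_inner f (\<lambda>z. c * g z) = cnj c * H2_inner f g"
proof -
  have "(\<lambda>n. taylor_coeff f n * cnj (taylor_coeff (\<lambda>z. c * g z) n)) =
      (\<lambda>n. cnj c * (taylor_coeff f n * cnj (taylor_coeff g n)))"
    using assms by (simp add: taylor_coeff_cmult H2_holomorphic mult_ac)
  then show ?thesis using suminf_mult[OF summable_H2_inner[OF assms]] by (simp add: H2_inner_def)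
qed

lemma H2_inner_commute:
  assumes "f \<in> H2" "g \<in> H2"
  shows "H2_inner g f = cnj (H2_inner f g)"
proof -
  have "(\<lambda>n. taylor_coeff g n * cnj (taylor_coeff f n)) =
      (\<lambda>n. cnj (taylor_coeff f n * cnj (taylor_coeff g n)))" by (simp add: mult.commute)
  then show ?thesis
    using sums_cnj[THEN iffD2, OF summable_sums[OF summable_H2_inner[OF assms]]]
    by (simp add: H2_inner_def sums_iff)
qed

definition H2_seq :: "(complex \<Rightarrow> complex) \<Rightarrow> ell2" where
  "H2_seq f = Ell2 (taylor_coeff f)"

lemma nth_H2_seq: "f \<in> H2 \<Longrightarrow> nth_ell2 (H2_seq f) = taylor_coeff f"
  by (simp add: H2_seq_def Ell2_inverse summable_taylor_coeff_H2)

lemma inner_H2_seq: "f \<in> H2 \<Longrightarrow> g \<in> H2 \<Longrightarrow> inner (H2_seq f) (H2_seq g) = Re (H2_inner f g)"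
  by (simp add: inner_ell2_def nth_H2_seq H2_inner_def)

lemma norm_H2_seq: "f \<in> H2 \<Longrightarrow> norm (H2_seq f) = H2_norm f"
  by (simp add: norm_eq_sqrt_inner[of "H2_seq f"] inner_ell2_self nth_H2_seq H2_norm_def)

lemma H2_seq_diff: "f \<in> H2 \<Longrightarrow> g \<in> H2 \<Longrightarrow> H2_seq (\<lambda>z. f z - g z) = H2_seq f - H2_seq g"
  by (intro ell2_eqI) (simp add: nth_H2_seq H2_diff minus_ell2.rep_eq taylor_coeff_diff H2_holomorphic)

lemma power_series_of_ell2:
  assumes z: "z \<in> unit_disc"
  shows "summable (\<lambda>n. nth_ell2 x n * z ^ n)"
proof (rule summable_comparison_test'[where N = 0])
  show "summable (\<lambda>n. norm x * cmod z ^ n)" using z by (intro summable_mult summable_geometric) simp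
  show "norm (nth_ell2 x n * z ^ n) \<le> norm x * cmod z ^ n" for n
    by (simp add: norm_mult norm_power mult_right_mono norm_nth_ell2_le)
qed

text \<open>Completeness of the Hardy space enters here: an abstract square-summable sequence, such as the
  separating vector, is again the coefficient sequence of a function on the disc.\<close>

lemma H2_seq_surj:
  obtains f where "f \<in> H2" "H2_seq f = x"
proof -
  define f where "f = (\<lambda>z. if z \<in> unit_disc then \<Sum>n. nth_ell2 x n * z ^ n else 0)"
  have sums: "(\<lambda>n. nth_ell2 x n * z ^ n) sums f z" if "z \<in> unit_disc" for z
    using summable_sums[OF power_series_of_ell2[OF that, of x]] that by (simp add: f_def)
  have tc: "taylor_coeff f = nth_ell2 x"
    by (rule ext, rule taylor_coeff_unique) (rule sums)
  have "f holomorphic_on unit_disc"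
    by (rule power_series_holomorphic[of 0 1 "nth_ell2 x"]) (use sums in simp)
  then have "f \<in> H2" by (simp add: H2_def hol_disc_def tc summable_nth_ell2) (simp add: f_def)
  moreover have "H2_seq f = x" by (simp add: H2_seq_def tc nth_ell2_inverse)
  ultimately show thesis by (rule that)
qed

text \<open>A function outside the closure is separated from the subspace by a vector orthogonal to it, first
  for the real inner product and then, since the subspace is closed under multiplication by \<open>\<i>\<close>, for
  the complex one.\<close>

lemma H2_closure_eq_double_orth:
  assumes S: "S \<subseteq> H2" "(\<lambda>_. 0) \<in> S"
    and add: "\<And>f g. f \<in> S \<Longrightarrow> g \<in> S \<Longrightarrow> (\<lambda>z. f z + g z) \<in> S"
    and scale: "\<And>c f. f \<in> S \<Longrightarrow> (\<lambda>z. c * f z) \<in> S"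
  shows "H2_closure S = H2_orth (H2_orth S)"
proof -
  define W where "W = H2_seq ` S"
  have subW: "subspace W"
    unfolding subspace_def
  proof (intro conjI ballI allI)
    have "H2_seq (\<lambda>_. 0) = 0"
    proof -
      have "taylor_coeff (\<lambda>_. 0) n = 0" for n using taylor_coeff_unique[of "\<lambda>_. 0" "\<lambda>_. 0"] by simp
      then show ?thesis by (intro ell2_eqI) (simp add: nth_H2_seq H2_zero zero_ell2.rep_eq)
    qed
    then show "0 \<in> W" using S by (force simp: W_def)
    show "x + y \<in> W" if xy: "x \<in> W" "y \<in> W" for x y
    proof -
      obtain f g where fg: "f \<in> S" "g \<in> S" "x = H2_seq f" "y = H2_seq g" using xy by (auto simp: W_def)
      have "x + y = H2_seq (\<lambda>z. f z + g z)"
        using fg S by (intro ell2_eqI)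
          (auto simp: nth_H2_seq H2_add plus_ell2.rep_eq taylor_coeff_add H2_holomorphic subset_eq)
      then show ?thesis using add[OF fg(1,2)] by (simp add: W_def)
    qed
    show "c *\<^sub>R x \<in> W" if x: "x \<in> W" for c x
    proof -
      obtain f where f: "f \<in> S" "x = H2_seq f" using x by (auto simp: W_def)
      have "c *\<^sub>R x = H2_seq (\<lambda>z. of_real c * f z)"
        using f S by (intro ell2_eqI)
          (auto simp: nth_H2_seq H2_cmult scaleR_ell2.rep_eq taylor_coeff_cmult H2_holomorphic subset_eq)
      then show ?thesis using scale[OF f(1)] by (simp add: W_def)
    qed
  qed
  have cl: "f \<in> H2_closure S \<longleftrightarrow> f \<in> H2 \<and> H2_seq f \<in> closure W" for f
  proof -
    have "H2_norm (\<lambda>z. f z - g z) = dist (H2_seq g) (H2_seq f)" if "f \<in> H2" "g \<in> S" for g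
      using that S by (auto simp: dist_norm norm_minus_commute norm_H2_seq[symmetric] H2_diff H2_seq_diff subset_eq)
    then show ?thesis by (auto simp: H2_closure_def closure_approachable W_def)
  qed
  have "H2_seq f \<in> closure W \<longleftrightarrow> (\<forall>h\<in>H2_orth S. H2_inner f h = 0)" if f: "f \<in> H2" for f
  proof
    assume fW: "H2_seq f \<in> closure W"
    show "\<forall>h\<in>H2_orth S. H2_inner f h = 0"
    proof
      fix h assume "h \<in> H2_orth S"
      then have h: "h \<in> H2" "\<And>g. g \<in> S \<Longrightarrow> H2_inner h g = 0" by (auto simp: H2_orth_def)
      have re: "Re (H2_inner f (\<lambda>z. c * h z)) = 0" for c
      proof -
        have ch: "(\<lambda>z. c * h z) \<in> H2" by (rule H2_cmult[OF h(1)])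
        have "W \<subseteq> {x. inner (H2_seq (\<lambda>z. c * h z)) x = 0}"
        proof
          fix x assume "x \<in> W"
          then obtain g where g: "g \<in> S" "x = H2_seq g" by (auto simp: W_def)
          then have gH: "g \<in> H2" using S by auto
          have "H2_inner g (\<lambda>z. c * h z) = 0"
            using h(2)[OF g(1)] H2_inner_commute[OF h(1) gH] by (simp add: H2_inner_cmult_right gH h(1))
          then show "x \<in> {x. inner (H2_seq (\<lambda>z. c * h z)) x = 0}"
            using inner_H2_seq[OF gH ch] g by (simp add: inner_commute)
        qed
        moreover have "closed {x. inner (H2_seq (\<lambda>z. c * h z)) x = 0}"
          by (intro closed_Collect_eq continuous_intros)
        ultimately have "closure W \<subseteq> {x. inner (H2_seq (\<lambda>z. c * h z)) x = 0}"
          by (rule closure_minimal)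
        then show ?thesis using fW inner_H2_seq[OF f ch] by (auto simp: inner_commute)
      qed
      show "H2_inner f h = 0"
        using re[of 1] re[of \<i>] by (simp add: H2_inner_cmult_right f h(1) complex_eq_iff)
    qed
  next
    assume orth: "\<forall>h\<in>H2_orth S. H2_inner f h = 0"
    show "H2_seq f \<in> closure W"
    proof (rule ccontr)
      assume "H2_seq f \<notin> closure W"
      then obtain y where y: "\<And>s. s \<in> W \<Longrightarrow> inner y s = 0" "inner (H2_seq f) y \<noteq> 0"
        using separation_by_orthogonal_vector[OF subW] by metis
      obtain h where h: "h \<in> H2" "H2_seq h = y" by (rule H2_seq_surj)
      have "H2_inner h g = 0" if g: "g \<in> S" for g
      proof -
        have gH: "g \<in> H2" using S g by auto
        have "Re (H2_inner h g) = 0"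
          using y(1)[of "H2_seq g"] g inner_H2_seq[OF h(1) gH] h(2) by (simp add: W_def)
        moreover have "Re (H2_inner h (\<lambda>z. \<i> * g z)) = 0"
          using y(1)[of "H2_seq (\<lambda>z. \<i> * g z)"] scale[OF g] inner_H2_seq[OF h(1) H2_cmult[OF gH]] h(2)
          by (simp add: W_def)
        ultimately show ?thesis by (simp add: H2_inner_cmult_right h(1) gH complex_eq_iff)
      qed
      then have "h \<in> H2_orth S" using h by (simp add: H2_orth_def)
      then have "H2_inner f h = 0" using orth by simp
      then show False using y(2) inner_H2_seq[OF f h(1)] h(2) by simp
    qed
  qed
  then show ?thesis by (auto simp: cl H2_orth_def)
qed

lemma H2_orth_complex_span:
  assumes "L \<subseteq> H2"
  shows "H2_orth (complex_span L) = H2_orth L" "complex_span L \<subseteq> H2"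
    "H2_closure (complex_span L) = H2_orth (H2_orth L)"
proof -
  have sum: "(\<lambda>z. \<Sum>f\<in>F. c f * f z) \<in> H2 \<and>
      (\<forall>h\<in>H2_orth L. H2_inner h (\<lambda>z. \<Sum>f\<in>F. c f * f z) = 0)" if "finite F" "F \<subseteq> L" for F c
    using that
  proof (induction F rule: finite_induct)
    case empty
    have "taylor_coeff (\<lambda>_. 0) n = 0" for n using taylor_coeff_unique[of "\<lambda>_. 0" "\<lambda>_. 0"] by simp
    then show ?case by (simp add: H2_zero H2_inner_def)
  next
    case (insert g F)
    then have g: "g \<in> H2" "g \<in> L" using assms by auto
    have IH: "(\<lambda>z. \<Sum>f\<in>F. c f * f z) \<in> H2"
      "\<And>h. h \<in> H2_orth L \<Longrightarrow> H2_inner h (\<lambda>z. \<Sum>f\<in>F. c f * f z) = 0"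
      using insert by auto
    have "H2_inner h (\<lambda>z. c g * g z + (\<Sum>f\<in>F. c f * f z)) = 0" if h: "h \<in> H2_orth L" for h
    proof -
      have "h \<in> H2" "H2_inner h g = 0" using h g by (auto simp: H2_orth_def)
      then show ?thesis using IH h g by (simp add: H2_inner_add_right H2_inner_cmult_right H2_cmult)
    qed
    then show ?case using insert.hyps H2_add[OF H2_cmult[OF g(1), of "c g"] IH(1)] by simp
  qed
  then show sub: "complex_span L \<subseteq> H2" by (auto simp: complex_span_def)
  have L: "L \<subseteq> complex_span L"
  proof
    fix f assume "f \<in> L"
    then show "f \<in> complex_span L"
      unfolding complex_span_def by (intro CollectI exI[of _ "{f}"] exI[of _ "\<lambda>_. 1"]) auto
  qed
  show eq: "H2_orth (complex_span L) = H2_orth L"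
  proof
    show "H2_orth (complex_span L) \<subseteq> H2_orth L" using L by (auto simp: H2_orth_def)
    have "H2_inner h g = 0" if h: "h \<in> H2_orth L" and g: "g \<in> complex_span L" for h g
    proof -
      obtain F c where "finite F" "F \<subseteq> L" "g = (\<lambda>z. \<Sum>f\<in>F. c f * f z)"
        using g by (auto simp: complex_span_def)
      then show ?thesis using sum[of F c] h by blast
    qed
    then show "H2_orth L \<subseteq> H2_orth (complex_span L)" by (auto simp: H2_orth_def)
  qed
  have "H2_closure (complex_span L) = H2_orth (H2_orth (complex_span L))"
  proof (rule H2_closure_eq_double_orth)
    show "complex_span L \<subseteq> H2" by (rule sub)
    show "(\<lambda>_. 0) \<in> complex_span L"
      unfolding complex_span_def by (intro CollectI exI[of _ "{}"]) auto
    show "(\<lambda>z. f z + g z) \<in> complex_span L" if fg: "f \<in> complex_span L" "g \<in> complex_span L" for f g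
    proof -
      obtain F c where F: "finite F" "F \<subseteq> L" "f = (\<lambda>z. \<Sum>f\<in>F. c f * f z)"
        using fg(1) by (auto simp: complex_span_def)
      obtain G d where G: "finite G" "G \<subseteq> L" "g = (\<lambda>z. \<Sum>f\<in>G. d f * f z)"
        using fg(2) by (auto simp: complex_span_def)
      define e where "e u = (if u \<in> F then c u else 0) + (if u \<in> G then d u else 0)" for u
      have "(\<Sum>u\<in>F \<union> G. e u * u z) = f z + g z" for z
      proof -
        have "(\<Sum>u\<in>F \<union> G. e u * u z) =
            (\<Sum>u\<in>F \<union> G. if u \<in> F then c u * u z else 0) + (\<Sum>u\<in>F \<union> G. if u \<in> G then d u * u z else 0)"
          unfolding sum.distrib[symmetric] by (rule sum.cong) (auto simp: e_def algebra_simps)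
        also have "(\<Sum>u\<in>F \<union> G. if u \<in> F then c u * u z else 0) = f z"
          unfolding F(3) using F(1) G(1) by (intro sum.mono_neutral_cong_right) auto
        also have "(\<Sum>u\<in>F \<union> G. if u \<in> G then d u * u z else 0) = g z"
          unfolding G(3) using F(1) G(1) by (intro sum.mono_neutral_cong_right) auto
        finally show ?thesis .
      qed
      then show ?thesis
        unfolding complex_span_def using F(1,2) G(1,2)
        by (intro CollectI exI[of _ "F \<union> G"] exI[of _ e]) auto
    qed
    show "(\<lambda>z. c * f z) \<in> complex_span L" if f: "f \<in> complex_span L" for c f
    proof -
      obtain F d where F: "finite F" "F \<subseteq> L" "f = (\<lambda>z. \<Sum>f\<in>F. d f * f z)"
        using f by (auto simp: complex_span_def)
      then show ?thesis
        unfolding complex_span_def using F(1,2)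
        by (intro CollectI exI[of _ F] exI[of _ "\<lambda>f. c * d f"]) (simp add: sum_distrib_left mult.assoc)
    qed
  qed
  then show "H2_closure (complex_span L) = H2_orth (H2_orth L)" using eq by simp
qed

section \<open>The involutions exchanging a point with the origin\<close>

definition moebius :: "complex \<Rightarrow> complex \<Rightarrow> complex" where
  "moebius a z = (a - z) / (1 - cnj a * z)"

lemma moebius_denom_nonzero:
  assumes "cmod a < 1" "cmod z \<le> 1"
  shows "1 - cnj a * z \<noteq> 0"
proof
  assume "1 - cnj a * z = 0"
  then have "cmod (cnj a * z) = 1" by (metis eq_iff_diff_eq_0 norm_one)
  moreover have "cmod a * cmod z \<le> cmod a" using assms by (simp add: mult_left_le)
  ultimately show False using assms by (simp add: norm_mult)
qed

lemma moebius_norm_identity: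
  assumes "cmod a < 1" "cmod z \<le> 1"
  shows "1 - (cmod (moebius a z))\<^sup>2 =
    (1 - (cmod a)\<^sup>2) * (1 - (cmod z)\<^sup>2) / (cmod (1 - cnj a * z))\<^sup>2"
proof -
  have "(cmod (1 - cnj a * z))\<^sup>2 - (cmod (a - z))\<^sup>2 = (1 - (cmod a)\<^sup>2) * (1 - (cmod z)\<^sup>2)"
    by (simp only: cmod_power2) (simp add: power2_eq_square algebra_simps)
  then show ?thesis
    using moebius_denom_nonzero[OF assms]
    by (simp add: moebius_def norm_divide power_divide field_simps)
qed

lemma pseudo_hyperbolic_moebius: "pseudo_hyperbolic z w = cmod (moebius w z)"
  by (simp add: pseudo_hyperbolic_def moebius_def)

lemma pseudo_hyperbolic_commute: "pseudo_hyperbolic z w = pseudo_hyperbolic w z"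
proof -
  have "cmod (1 - cnj w * z) = cmod (cnj (1 - cnj w * z))" by (simp only: complex_mod_cnj)
  also have "\<dots> = cmod (1 - cnj z * w)" by (simp add: mult.commute)
  finally show ?thesis by (simp add: pseudo_hyperbolic_def norm_divide norm_minus_commute)
qed

lemma cmod_moebius_less_1:
  assumes "cmod a < 1" "cmod z < 1"
  shows "cmod (moebius a z) < 1"
proof -
  have "0 < (1 - (cmod a)\<^sup>2) * (1 - (cmod z)\<^sup>2) / (cmod (1 - cnj a * z))\<^sup>2"
    using moebius_denom_nonzero[of a z] assms
    by (intro divide_pos_pos mult_pos_pos) (auto simp: abs_square_less_1)
  then have "(cmod (moebius a z))\<^sup>2 < 1" using moebius_norm_identity[of a z] assms by simp
  then show ?thesis by (simp add: abs_square_less_1)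
qed

lemma cmod_moebius_eq_1:
  assumes "cmod a < 1" "cmod z = 1"
  shows "cmod (moebius a z) = 1"
  using moebius_norm_identity[of a z] assms by (simp add: power2_eq_1_iff)
    (smt (verit) norm_ge_zero)

lemma pseudo_hyperbolic_less_1: "cmod z < 1 \<Longrightarrow> cmod w < 1 \<Longrightarrow> pseudo_hyperbolic z w < 1"
  by (simp add: pseudo_hyperbolic_moebius cmod_moebius_less_1)

lemma pseudo_hyperbolic_nonneg [simp]: "0 \<le> pseudo_hyperbolic z w"
  by (simp add: pseudo_hyperbolic_def)

lemma pseudo_hyperbolic_0 [simp]: "pseudo_hyperbolic z 0 = cmod z"
  by (simp add: pseudo_hyperbolic_def)

lemma moebius_eq_0_iff:
  assumes "cmod a < 1" "cmod z < 1"
  shows "moebius a z = 0 \<longleftrightarrow> z = a"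
  using moebius_denom_nonzero[of a z] assms by (auto simp: moebius_def)

lemma pseudo_hyperbolic_eq_0_iff:
  "cmod z < 1 \<Longrightarrow> cmod w < 1 \<Longrightarrow> pseudo_hyperbolic z w = 0 \<longleftrightarrow> z = w"
  by (simp add: pseudo_hyperbolic_moebius moebius_eq_0_iff)

lemma one_minus_pseudo_hyperbolic_sq:
  assumes "cmod z < 1" "cmod w < 1"
  shows "1 - (pseudo_hyperbolic z w)\<^sup>2 =
    (1 - (cmod z)\<^sup>2) * (1 - (cmod w)\<^sup>2) / (cmod (1 - cnj w * z))\<^sup>2"
  using moebius_norm_identity[of w z] assms by (simp add: pseudo_hyperbolic_moebius mult.commute)

lemma moebius_involution:
  assumes "cmod a < 1" "cmod z < 1"
  shows "moebius a (moebius a z) = z"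
proof -
  have d: "1 - cnj a * z \<noteq> 0" by (rule moebius_denom_nonzero) (use assms in auto)
  have e: "1 - a * cnj a \<noteq> 0"
    using moebius_denom_nonzero[of a a] assms by (simp add: mult.commute)
  have "a - moebius a z = z * (1 - a * cnj a) / (1 - cnj a * z)"
    using d by (simp add: moebius_def field_simps)
  moreover have "1 - cnj a * moebius a z = (1 - a * cnj a) / (1 - cnj a * z)"
    using d by (simp add: moebius_def field_simps)
  ultimately show ?thesis using d e by (subst moebius_def) simp
qed

lemma holomorphic_on_moebius [holomorphic_intros]:
  assumes "cmod a < 1"
  shows "moebius a holomorphic_on unit_disc"
  unfolding moebius_def
  by (intro holomorphic_intros) (use moebius_denom_nonzero assms in auto)

lemma continuous_on_moebius:
  assumes "cmod a < 1"
  shows "continuous_on (cball 0 1) (moebius a)"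
  unfolding moebius_def
  by (intro continuous_intros) (use moebius_denom_nonzero assms in auto)

lemma blaschke_factor_moebius:
  "blaschke_factor a z = (if a = 0 then -1 else of_real (cmod a) / a) * moebius a z"
  by (simp add: blaschke_factor_def moebius_def)

lemma cmod_blaschke_factor: "cmod (blaschke_factor a z) = pseudo_hyperbolic z a"
  by (simp add: blaschke_factor_moebius pseudo_hyperbolic_moebius norm_mult norm_divide)

lemma holomorphic_on_blaschke_factor:
  assumes "cmod a < 1"
  shows "blaschke_factor a holomorphic_on unit_disc"
  unfolding blaschke_factor_moebius by (intro holomorphic_intros assms)

text \<open>This estimate turns the Blaschke condition into locally uniform convergence of the product; it comes
  from the identity \<open>a (1 - cnj a z) (b\<^sub>a(z) - 1) = - (1 - |a|) (a + |a| z)\<close> for \<open>a \<noteq> 0\<close>, where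
  \<open>b\<^sub>a\<close> is the Blaschke factor.\<close>

lemma cmod_one_minus_blaschke_factor_le:
  assumes "cmod a < 1" "cmod z < 1"
  shows "cmod (blaschke_factor a z - 1) \<le> 2 / (1 - cmod z) * (1 - cmod a)"
proof (cases "a = 0")
  case True
  have "cmod (z - 1) \<le> 2" using norm_triangle_ineq4[of z 1] assms by simp
  also have "\<dots> \<le> 2 / (1 - cmod z)" using assms by (simp add: field_simps)
  finally show ?thesis using True by (simp add: blaschke_factor_def)
next
  case False
  have d: "1 - cnj a * z \<noteq> 0" by (rule moebius_denom_nonzero) (use assms in auto)
  have sq: "a * cnj a = of_real (cmod a) * of_real (cmod a)"
    by (metis complex_norm_square of_real_mult power2_eq_square)
  have "(blaschke_factor a z - 1) * (a * (1 - cnj a * z)) =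
      of_real (cmod a) * (a - z) - a + a * cnj a * z"
    using False d by (simp add: blaschke_factor_def field_simps)
  also have "\<dots> = - (1 - of_real (cmod a)) * (a + of_real (cmod a) * z)"
    unfolding sq by (simp add: algebra_simps)
  finally have "cmod ((blaschke_factor a z - 1) * (a * (1 - cnj a * z)))
      = cmod (1 - complex_of_real (cmod a)) * cmod (a + of_real (cmod a) * z)"
    by (simp only: norm_mult norm_minus_cancel)
  also have "cmod (1 - complex_of_real (cmod a)) = 1 - cmod a"
    using assms by (metis abs_of_nonneg diff_ge_0_iff_ge less_imp_le norm_of_real of_real_1 of_real_diff)
  also have "cmod (a + of_real (cmod a) * z) \<le> 2 * cmod a"
  proof -
    have "cmod (a + of_real (cmod a) * z) \<le> cmod a + cmod a * cmod z"
      by (rule norm_triangle_le) (simp add: norm_mult)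
    also have "\<dots> \<le> cmod a + cmod a * 1" using assms by (intro add_left_mono mult_left_mono) auto
    finally show ?thesis by simp
  qed
  finally have main: "cmod (blaschke_factor a z - 1) * (cmod a * cmod (1 - cnj a * z))
      \<le> (1 - cmod a) * (2 * cmod a)"
    using assms by (simp add: norm_mult mult_left_mono)
  have "1 - cmod z \<le> cmod (1 - cnj a * z)"
  proof -
    have "cmod (cnj a * z) \<le> cmod z" using assms by (simp add: norm_mult mult_left_le_one_le)
    then show ?thesis using norm_triangle_ineq2[of 1 "cnj a * z"] by simp
  qed
  then have "cmod (blaschke_factor a z - 1) * (cmod a * (1 - cmod z))
      \<le> (1 - cmod a) * (2 * cmod a)"
    by (intro order_trans[OF _ main] mult_left_mono) auto
  then have "cmod a * (cmod (blaschke_factor a z - 1) * (1 - cmod z)) \<le> cmod a * ((1 - cmod a) * 2)"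
    by (simp add: mult_ac)
  then have "cmod (blaschke_factor a z - 1) * (1 - cmod z) \<le> (1 - cmod a) * 2"
    using False by (simp add: mult_le_cancel_left)
  then show ?thesis using assms by (simp add: field_simps)
qed

section \<open>Multiplying and dividing by a Blaschke factor in the Hardy space\<close>

text \<open>If \<open>f = (a - z) u\<close> and \<open>h = (1 - cnj a z) u\<close>, then
  \<open>|h\<^sub>n|\<^sup>2 - |f\<^sub>n|\<^sup>2 = (1 - |a|\<^sup>2) (|u\<^sub>n|\<^sup>2 - |u\<^sub>n\<^sub>-\<^sub>1|\<^sup>2)\<close>, and the sum telescopes. This replaces the
  fact that a Blaschke factor is unimodular on the circle, and avoids boundary values.\<close>

lemma telescoping_blaschke_factor:
  assumes u: "u holomorphic_on unit_disc"
    and f: "\<And>z. z \<in> unit_disc \<Longrightarrow> f z = (a - z) * u z"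
    and h: "\<And>z. z \<in> unit_disc \<Longrightarrow> h z = (1 - cnj a * z) * u z"
  shows "(\<Sum>n<Suc N. (cmod (taylor_coeff h n))\<^sup>2) =
    (\<Sum>n<Suc N. (cmod (taylor_coeff f n))\<^sup>2) + (1 - (cmod a)\<^sup>2) * (cmod (taylor_coeff u N))\<^sup>2"
    and "taylor_coeff f (Suc N) = a * taylor_coeff u (Suc N) - taylor_coeff u N"
proof -
  let ?u = "taylor_coeff u"
  have zu: "(\<lambda>z. z * u z) holomorphic_on unit_disc" by (intro holomorphic_intros u)
  have fc: "taylor_coeff f n = a * ?u n - taylor_coeff (\<lambda>z. z * u z) n" for n
  proof -
    have "taylor_coeff f n = taylor_coeff (\<lambda>z. a * u z - z * u z) n"
      by (rule taylor_coeff_cong) (simp add: f algebra_simps)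
    also have "\<dots> = taylor_coeff (\<lambda>z. a * u z) n - taylor_coeff (\<lambda>z. z * u z) n"
      by (intro taylor_coeff_diff holomorphic_intros u zu)
    finally show ?thesis by (simp add: taylor_coeff_cmult u)
  qed
  have hc: "taylor_coeff h n = ?u n - cnj a * taylor_coeff (\<lambda>z. z * u z) n" for n
  proof -
    have "taylor_coeff h n = taylor_coeff (\<lambda>z. u z - cnj a * (z * u z)) n"
      by (rule taylor_coeff_cong) (simp add: h algebra_simps)
    also have "\<dots> = ?u n - taylor_coeff (\<lambda>z. cnj a * (z * u z)) n"
      by (intro taylor_coeff_diff holomorphic_intros u zu)
    finally show ?thesis by (simp add: taylor_coeff_cmult zu)
  qed
  show fS: "taylor_coeff f (Suc N) = a * ?u (Suc N) - ?u N" for N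
    by (simp add: fc taylor_coeff_mult_z u)
  have hS: "taylor_coeff h (Suc N) = ?u (Suc N) - cnj a * ?u N" for N
    by (simp add: hc taylor_coeff_mult_z u)
  have step: "(cmod (x - cnj a * y))\<^sup>2 + (1 - (cmod a)\<^sup>2) * (cmod y)\<^sup>2 =
      (cmod (a * x - y))\<^sup>2 + (1 - (cmod a)\<^sup>2) * (cmod x)\<^sup>2" for x y
    by (simp only: cmod_power2) (simp add: power2_eq_square algebra_simps)
  show "(\<Sum>n<Suc N. (cmod (taylor_coeff h n))\<^sup>2) =
    (\<Sum>n<Suc N. (cmod (taylor_coeff f n))\<^sup>2) + (1 - (cmod a)\<^sup>2) * (cmod (?u N))\<^sup>2"
  proof (induction N)
    case 0
    then show ?case by (simp add: taylor_coeff_0 f h norm_mult algebra_simps power_mult_distrib)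
  next
    case (Suc N)
    then show ?case using step[of "?u (Suc N)" "?u N"]
      by (simp only: sum.lessThan_Suc[of _ "Suc N"] fS hS)
  qed
qed

lemma H2_mult_blaschke_factor:
  assumes a: "cmod a < 1" and h: "h \<in> H2"
  shows "(\<lambda>z. blaschke_factor a z * h z) \<in> H2"
    "H2_norm (\<lambda>z. blaschke_factor a z * h z) \<le> H2_norm h"
proof -
  define c where "c = (if a = 0 then -1 else of_real (cmod a) / a)"
  have c: "cmod c = 1" by (simp add: c_def norm_divide)
  define u where "u = (\<lambda>z. h z / (1 - cnj a * z))"
  have u: "u holomorphic_on unit_disc"
    unfolding u_def using moebius_denom_nonzero[OF a]
    by (intro holomorphic_intros H2_holomorphic[OF h]) auto
  define f where "f = (\<lambda>z. blaschke_factor a z * h z)"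
  have fhol: "f holomorphic_on unit_disc"
    unfolding f_def by (intro holomorphic_intros H2_holomorphic h holomorphic_on_blaschke_factor a)
  define f' where "f' = (\<lambda>z. (a - z) * u z)"
  have f'hol: "f' holomorphic_on unit_disc" unfolding f'_def by (intro holomorphic_intros u)
  have coeff: "cmod (taylor_coeff f n) = cmod (taylor_coeff f' n)" for n
  proof -
    have "taylor_coeff f n = taylor_coeff (\<lambda>z. c * f' z) n"
      by (rule taylor_coeff_cong) (simp add: f_def f'_def u_def c_def blaschke_factor_moebius moebius_def)
    then show ?thesis by (simp add: taylor_coeff_cmult[OF f'hol] norm_mult c)
  qed
  have le: "(\<Sum>n<N. (cmod (taylor_coeff f n))\<^sup>2) \<le> (H2_norm h)\<^sup>2" for N
  proof -
    have "(\<Sum>n<N. (cmod (taylor_coeff f n))\<^sup>2) \<le> (\<Sum>n<Suc N. (cmod (taylor_coeff f n))\<^sup>2)"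
      by (intro sum_mono2) auto
    also have "\<dots> = (\<Sum>n<Suc N. (cmod (taylor_coeff f' n))\<^sup>2)"
      by (simp only: coeff)
    also have "\<dots> \<le> (\<Sum>n<Suc N. (cmod (taylor_coeff h n))\<^sup>2)"
    proof -
      have "(\<Sum>n<Suc N. (cmod (taylor_coeff h n))\<^sup>2) = (\<Sum>n<Suc N. (cmod (taylor_coeff f' n))\<^sup>2)
          + (1 - (cmod a)\<^sup>2) * (cmod (taylor_coeff u N))\<^sup>2"
        by (rule telescoping_blaschke_factor(1)[OF u])
          (use moebius_denom_nonzero[OF a] in \<open>auto simp: f'_def u_def\<close>)
      moreover have "0 \<le> (1 - (cmod a)\<^sup>2) * (cmod (taylor_coeff u N))\<^sup>2"
        using a by (intro mult_nonneg_nonneg) (auto simp: abs_square_le_1)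
      ultimately show ?thesis by linarith
    qed
    also have "\<dots> \<le> (H2_norm h)\<^sup>2" by (rule sum_le_H2_norm_sq[OF h])
    finally show ?thesis .
  qed
  have "f z = 0" if "z \<notin> unit_disc" for z using H2_zero_off[OF h that] by (simp add: f_def)
  note * = H2I_bounded_sums[OF fhol this le]
  show "(\<lambda>z. blaschke_factor a z * h z) \<in> H2" using *(1) by (simp add: f_def)
  show "H2_norm (\<lambda>z. blaschke_factor a z * h z) \<le> H2_norm h"
    using *(2) H2_norm_nonneg[OF h] by (simp add: f_def power2_le_iff_abs_le)
qed

text \<open>Let \<open>f = (a - z) u\<close>. The quotient is \<open>(1 - cnj a z) u\<close> up to a unimodular constant, and the
  telescoping identity bounds its partial sums by those of \<open>f\<close> plus \<open>|u\<^sub>N|\<^sup>2\<close>. The recursion \<open>u\<^sub>n = a u\<^sub>n\<^sub>+\<^sub>1 - f\<^sub>n\<^sub>+\<^sub>1\<close>, read from large indices to small ones, shows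
  \<open>|u\<^sub>N| \<le> sup {|f\<^sub>k| | k > N} / (1 - |a|)\<close>, which tends to \<open>0\<close>; this is where \<open>f a = 0\<close>, that is,
  holomorphy of \<open>u\<close> at \<open>a\<close>, is needed.\<close>

lemma H2_divide_blaschke_factor:
  assumes a: "cmod a < 1" and f: "f \<in> H2" and fa: "f a = 0"
  obtains h where "h \<in> H2" "f = (\<lambda>z. blaschke_factor a z * h z)" "H2_norm h \<le> H2_norm f"
proof -
  define c where "c = (if a = 0 then -1 else of_real (cmod a) / a)"
  have c: "cmod c = 1" by (simp add: c_def norm_divide)
  have c0: "c \<noteq> 0" using c by auto
  define u where "u = (\<lambda>z. - (if z = a then deriv f a else (f z - f a) / (z - a)))"
  have u: "u holomorphic_on unit_disc"
    unfolding u_def by (intro holomorphic_intros pole_lemma_open H2_holomorphic f) simp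
  have fu: "f z = (a - z) * u z" for z using fa by (auto simp: u_def divide_simps algebra_simps)
  define h where "h = (\<lambda>z. if z \<in> unit_disc then (1 - cnj a * z) * u z else 0)"
  have hhol: "h holomorphic_on unit_disc"
    unfolding h_def
    by (rule holomorphic_transform[of "\<lambda>z. (1 - cnj a * z) * u z"])
      (auto intro!: holomorphic_intros u)
  note tele = telescoping_blaschke_factor[of u f a h, OF u fu]
  have u_bound: "cmod (taylor_coeff u n) \<le> M / (1 - cmod a)"
    if M: "\<And>k. k > n \<Longrightarrow> cmod (taylor_coeff f k) \<le> M" for n M
  proof -
    have M0: "0 \<le> M" using M[of "Suc n"] by (meson lessI norm_ge_zero order_trans)
    have it: "cmod (taylor_coeff u n) \<le> M * (\<Sum>i<j. cmod a ^ i) + cmod a ^ j * cmod (taylor_coeff u (n + j))" for j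
    proof (induction j)
      case (Suc j)
      have "taylor_coeff u (n + j) = a * taylor_coeff u (Suc (n + j)) - taylor_coeff f (Suc (n + j))"
        using tele(2)[of "n + j"] by (simp add: h_def)
      then have "cmod (taylor_coeff u (n + j)) \<le> cmod a * cmod (taylor_coeff u (Suc (n + j))) + M"
        using norm_triangle_ineq4[of "a * taylor_coeff u (Suc (n + j))" "taylor_coeff f (Suc (n + j))"]
          M[of "Suc (n + j)"] by (simp add: norm_mult)
      then have "cmod a ^ j * cmod (taylor_coeff u (n + j)) \<le>
          cmod a ^ j * (cmod a * cmod (taylor_coeff u (Suc (n + j))) + M)"
        by (intro mult_left_mono) auto
      then show ?case using Suc by (simp add: algebra_simps)
    qed simp
    have lim: "(\<lambda>j. cmod a ^ j * cmod (taylor_coeff u (n + j))) \<longlonglongrightarrow> 0"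
    proof (cases "a = 0")
      case True
      then show ?thesis by (intro tendsto_eventually) (auto simp: eventually_sequentially intro!: exI[of _ 1])
    next
      case False
      have "summable (\<lambda>k. taylor_coeff u k * a ^ k)"
        using sums_taylor_coeff[OF u, of a] a by (auto simp: sums_iff)
      then have "(\<lambda>k. cmod (taylor_coeff u k * a ^ k)) \<longlonglongrightarrow> 0"
        using summable_LIMSEQ_zero tendsto_norm_zero by blast
      then have "(\<lambda>j. cmod (taylor_coeff u (j + n) * a ^ (j + n))) \<longlonglongrightarrow> 0"
        by (rule LIMSEQ_ignore_initial_segment)
      then have "(\<lambda>j. inverse (cmod a ^ n) * cmod (taylor_coeff u (j + n) * a ^ (j + n))) \<longlonglongrightarrow> inverse (cmod a ^ n) * 0"
        by (intro tendsto_intros)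
      moreover have "inverse (cmod a ^ n) * cmod (taylor_coeff u (j + n) * a ^ (j + n)) =
          cmod a ^ j * cmod (taylor_coeff u (n + j))" for j
        using False by (simp add: norm_mult norm_power power_add add.commute field_simps)
      ultimately show ?thesis by simp
    qed
    have "cmod (taylor_coeff u n) \<le> M / (1 - cmod a) + cmod a ^ j * cmod (taylor_coeff u (n + j))" for j
    proof -
      have "(\<Sum>i<j. cmod a ^ i) \<le> (\<Sum>i. cmod a ^ i)"
        using a by (intro sum_le_suminf summable_geometric) auto
      also have "\<dots> = 1 / (1 - cmod a)" using a by (simp add: suminf_geometric)
      finally show ?thesis using it[of j] mult_left_mono[of "\<Sum>i<j. cmod a ^ i" "1 / (1 - cmod a)" M] M0
        by simp
    qed
    moreover have "(\<lambda>j. M / (1 - cmod a) + cmod a ^ j * cmod (taylor_coeff u (n + j))) \<longlonglongrightarrow> M / (1 - cmod a) + 0"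
      by (intro tendsto_intros lim)
    ultimately show ?thesis using LIMSEQ_le_const by fastforce
  qed
  have f0: "(\<lambda>n. taylor_coeff f n) \<longlonglongrightarrow> 0"
  proof -
    have "(\<lambda>n. (cmod (taylor_coeff f n))\<^sup>2) \<longlonglongrightarrow> 0"
      by (rule summable_LIMSEQ_zero[OF summable_taylor_coeff_H2[OF f]])
    then have "(\<lambda>n. sqrt ((cmod (taylor_coeff f n))\<^sup>2)) \<longlonglongrightarrow> sqrt 0" by (rule tendsto_real_sqrt)
    then show ?thesis by (simp add: tendsto_norm_zero_iff)
  qed
  have u0: "(\<lambda>n. taylor_coeff u n) \<longlonglongrightarrow> 0"
  proof (rule LIMSEQ_I)
    fix r :: real assume r: "0 < r"
    define M where "M = r * (1 - cmod a) / 2"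
    have M: "M > 0" using r a by (simp add: M_def)
    then obtain K where K: "\<And>k. k \<ge> K \<Longrightarrow> cmod (taylor_coeff f k) < M"
      using LIMSEQ_D[OF f0 M] by auto
    have "cmod (taylor_coeff u n) \<le> M / (1 - cmod a)" if "n \<ge> K" for n
      using that K by (intro u_bound) (auto intro!: less_imp_le)
    also have "M / (1 - cmod a) < r" using r a by (auto simp: M_def field_simps)
    finally show "\<exists>no. \<forall>n\<ge>no. norm (taylor_coeff u n - 0) < r" by auto
  qed
  have le: "(\<Sum>n<N. (cmod (taylor_coeff h n))\<^sup>2) \<le> (H2_norm f)\<^sup>2" for N
  proof -
    have "(\<lambda>m. (H2_norm f)\<^sup>2 + (1 - (cmod a)\<^sup>2) * (cmod (taylor_coeff u m))\<^sup>2)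
        \<longlonglongrightarrow> (H2_norm f)\<^sup>2 + (1 - (cmod a)\<^sup>2) * (cmod 0)\<^sup>2"
      by (intro tendsto_intros u0)
    then have lim: "(\<lambda>m. (H2_norm f)\<^sup>2 + (1 - (cmod a)\<^sup>2) * (cmod (taylor_coeff u m))\<^sup>2)
        \<longlonglongrightarrow> (H2_norm f)\<^sup>2" by simp
    have "(\<Sum>n<N. (cmod (taylor_coeff h n))\<^sup>2) \<le>
        (H2_norm f)\<^sup>2 + (1 - (cmod a)\<^sup>2) * (cmod (taylor_coeff u m))\<^sup>2" if "m \<ge> N" for m
    proof -
      have "(\<Sum>n<N. (cmod (taylor_coeff h n))\<^sup>2) \<le> (\<Sum>n<Suc m. (cmod (taylor_coeff h n))\<^sup>2)"
        using that by (intro sum_mono2) auto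
      also have "\<dots> = (\<Sum>n<Suc m. (cmod (taylor_coeff f n))\<^sup>2)
          + (1 - (cmod a)\<^sup>2) * (cmod (taylor_coeff u m))\<^sup>2"
        by (rule tele(1)) (simp add: h_def)
      finally show ?thesis using sum_le_H2_norm_sq[OF f, of "Suc m"] by linarith
    qed
    then show ?thesis using LIMSEQ_le_const[OF lim] by blast
  qed
  have hoff: "h z = 0" if "z \<notin> unit_disc" for z using that by (simp add: h_def)
  note hH = H2I_bounded_sums[OF hhol hoff le]
  define g where "g = (\<lambda>z. inverse c * h z)"
  have gH: "g \<in> H2" unfolding g_def by (rule H2_cmult[OF hH(1)])
  have cg: "cmod (taylor_coeff g n) = cmod (taylor_coeff h n)" for n
    unfolding g_def using c by (simp add: taylor_coeff_cmult[OF hhol] norm_mult norm_inverse)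
  show thesis
  proof (rule that[OF gH])
    show "f = (\<lambda>z. blaschke_factor a z * g z)"
    proof (rule H2_eqI[OF f H2_mult_blaschke_factor(1)[OF a gH]])
      fix z assume z: "z \<in> unit_disc"
      then have "1 - cnj a * z \<noteq> 0" using moebius_denom_nonzero[OF a, of z] by simp
      then show "f z = blaschke_factor a z * g z"
        using z c0 by (simp add: fu[of z] g_def h_def blaschke_factor_moebius moebius_def c_def[symmetric])
    qed
    have "H2_norm g = H2_norm h" by (simp add: H2_norm_def cg)
    then show "H2_norm g \<le> H2_norm f"
      using hH(2) H2_norm_nonneg[OF f] H2_norm_nonneg[OF gH] by (simp add: power2_le_iff_abs_le)
  qed
qed

text \<open>Fatou's lemma for the coefficients, which converge one by one.\<close>

lemma H2_locally_uniform_limit: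
  assumes fk: "\<And>k. f k \<in> H2" "\<And>k. H2_norm (f k) \<le> C"
    and lim: "uniform_limit (cball 0 (1/2)) f g sequentially"
    and g: "g holomorphic_on unit_disc" "\<And>z. z \<notin> unit_disc \<Longrightarrow> g z = 0"
  shows "g \<in> H2" "H2_norm g \<le> C"
proof -
  have C: "C \<ge> 0" using fk[of 0] H2_norm_nonneg[OF fk(1)[of 0]] by linarith
  have sub: "ball 0 (1/2) \<subseteq> (unit_disc :: complex set)" by auto
  have coeff: "(\<lambda>k. taylor_coeff (f k) n) \<longlonglongrightarrow> taylor_coeff g n" for n
    unfolding taylor_coeff_def
  proof (intro tendsto_divide tendsto_const higher_deriv_complex_uniform_limit)
    show "uniform_limit (ball 0 (1/2)) f g sequentially"
      by (rule uniform_limit_on_subset[OF lim]) auto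
    show "\<forall>\<^sub>F k in sequentially. f k holomorphic_on ball 0 (1/2)"
      using H2_holomorphic[OF fk(1)] holomorphic_on_subset[OF _ sub] by (intro always_eventually) blast
  qed auto
  have le: "(\<Sum>n<N. (cmod (taylor_coeff g n))\<^sup>2) \<le> C\<^sup>2" for N
  proof (rule LIMSEQ_le_const2)
    show "(\<lambda>k. \<Sum>n<N. (cmod (taylor_coeff (f k) n))\<^sup>2) \<longlonglongrightarrow> (\<Sum>n<N. (cmod (taylor_coeff g n))\<^sup>2)"
      by (intro tendsto_intros coeff)
    have "(\<Sum>n<N. (cmod (taylor_coeff (f k) n))\<^sup>2) \<le> C\<^sup>2" for k
    proof -
      have "(H2_norm (f k))\<^sup>2 \<le> C\<^sup>2" by (rule power_mono[OF fk(2) H2_norm_nonneg[OF fk(1)]])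
      then show ?thesis using sum_le_H2_norm_sq[OF fk(1), of k N] by linarith
    qed
    then show "\<exists>M. \<forall>k\<ge>M. (\<Sum>n<N. (cmod (taylor_coeff (f k) n))\<^sup>2) \<le> C\<^sup>2" by blast
  qed
  note * = H2I_bounded_sums[OF g le]
  show "g \<in> H2" by (rule *(1))
  show "H2_norm g \<le> C" using *(2) C by (simp add: power2_le_iff_abs_le)
qed

lemma H2_evaluation_bound:
  assumes f: "f \<in> H2" and z: "z \<in> unit_disc"
  shows "cmod (f z) \<le> H2_norm f / sqrt (1 - (cmod z)\<^sup>2)"
proof -
  define y where "y = Ell2 (\<lambda>n. z ^ n)"
  have "(\<lambda>n. (cmod (z ^ n))\<^sup>2) = (\<lambda>n. ((cmod z)\<^sup>2) ^ n)"
    by (simp add: norm_power power_mult[symmetric] mult.commute)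
  moreover have zz: "(cmod z)\<^sup>2 < 1" using z by (simp add: abs_square_less_1)
  ultimately have s: "(\<lambda>n. (cmod (z ^ n))\<^sup>2) sums (1 / (1 - (cmod z)\<^sup>2))"
    using geometric_sums[of "(cmod z)\<^sup>2"] by simp
  have ny: "nth_ell2 y = (\<lambda>n. z ^ n)" using s by (simp add: y_def Ell2_inverse sums_iff)
  have normy: "(norm y)\<^sup>2 = 1 / (1 - (cmod z)\<^sup>2)" using s by (simp add: norm_ell2_sq ny sums_iff)
  obtain x where x: "x = H2_seq f" by simp
  have part: "cmod (\<Sum>n<N. taylor_coeff f n * z ^ n) \<le> H2_norm f * norm y" for N
  proof -
    have "cmod (\<Sum>n<N. taylor_coeff f n * z ^ n) \<le> (\<Sum>n<N. \<bar>cmod (taylor_coeff f n)\<bar> * \<bar>cmod (z ^ n)\<bar>)"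
      by (rule order_trans[OF norm_sum]) (simp add: norm_mult)
    also have "\<dots> \<le> L2_set (\<lambda>n. cmod (taylor_coeff f n)) {..<N} * L2_set (\<lambda>n. cmod (z ^ n)) {..<N}"
      by (rule L2_set_mult_ineq)
    also have "\<dots> \<le> H2_norm f * norm y"
    proof (intro mult_mono)
      show "L2_set (\<lambda>n. cmod (taylor_coeff f n)) {..<N} \<le> H2_norm f"
        unfolding L2_set_def using sum_le_H2_norm_sq[OF f] H2_norm_nonneg[OF f] by (intro real_le_lsqrt)
      show "L2_set (\<lambda>n. cmod (z ^ n)) {..<N} \<le> norm y"
        unfolding L2_set_def using sum_le_norm_ell2_sq[of y N] by (intro real_le_lsqrt) (auto simp: ny)
    qed (auto simp: H2_norm_nonneg[OF f] L2_set_nonneg)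
    finally show ?thesis .
  qed
  have "(\<lambda>N. cmod (\<Sum>n<N. taylor_coeff f n * z ^ n)) \<longlonglongrightarrow> cmod (f z)"
    using sums_taylor_coeff[OF H2_holomorphic[OF f] z] by (intro tendsto_norm) (simp add: sums_def)
  then have "cmod (f z) \<le> H2_norm f * norm y" by (rule LIMSEQ_le_const2) (use part in blast)
  moreover have "norm y = 1 / sqrt (1 - (cmod z)\<^sup>2)"
    by (metis normy norm_ge_zero real_sqrt_abs abs_of_nonneg real_sqrt_divide real_sqrt_one)
  ultimately show ?thesis by simp
qed

section \<open>Blaschke products\<close>

definition blaschke_sequence :: "nat set \<Rightarrow> (nat \<Rightarrow> complex) \<Rightarrow> bool" where
  "blaschke_sequence I a \<longleftrightarrow> (\<forall>n\<in>I. cmod (a n) < 1) \<and> (\<lambda>n. 1 - cmod (a n)) summable_on I"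

definition blaschke_product :: "nat set \<Rightarrow> (nat \<Rightarrow> complex) \<Rightarrow> complex \<Rightarrow> complex" where
  "blaschke_product I a z = (\<Prod>n. if n \<in> I then blaschke_factor (a n) z else 1)"

lemma blaschke_sequence_subset: "blaschke_sequence I a \<Longrightarrow> J \<subseteq> I \<Longrightarrow> blaschke_sequence J a"
  unfolding blaschke_sequence_def using summable_on_subset_banach by blast

lemma blaschke_sequence_summable:
  assumes "blaschke_sequence I a"
  shows "summable (\<lambda>n. if n \<in> I then 1 - cmod (a n) else 0)"
proof -
  have "(\<lambda>n. if n \<in> I then 1 - cmod (a n) else 0) summable_on UNIV"
    using assms unfolding blaschke_sequence_def
    by (subst summable_on_cong_neutral[where T = I and g = "\<lambda>n. 1 - cmod (a n)"]) auto
  then show ?thesis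
    using assms by (subst (asm) summable_on_UNIV_nonneg_real_iff)
      (auto simp: blaschke_sequence_def less_imp_le)
qed

lemma blaschke_with_zeros_altdef:
  "blaschke_with_zeros I a b \<longleftrightarrow> blaschke_sequence I a \<and>
    (\<exists>c\<in>unit_circle. b = (\<lambda>z. if z \<in> unit_disc then c * blaschke_product I a z else 0))"
  unfolding blaschke_with_zeros_def blaschke_sequence_def blaschke_product_def
  by (simp add: image_subset_iff conj_assoc)

lemma blaschke_partial_prod:
  "(\<Prod>n<N::nat. if n \<in> I then f n else (1::'a::comm_monoid_mult)) = (\<Prod>n\<in>I \<inter> {..<N}. f n)"
  using prod.inter_restrict[OF finite_lessThan[of N], of f I] by (simp add: Int_commute)

lemma blaschke_product_uniform_limit:
  assumes I: "blaschke_sequence I a" and K: "compact K" "K \<subseteq> unit_disc"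
  shows "uniform_limit K (\<lambda>N z. \<Prod>n\<in>I \<inter> {..<N}. blaschke_factor (a n) z) (blaschke_product I a) sequentially"
    and "z \<in> unit_disc \<Longrightarrow> abs_convergent_prod (\<lambda>n. if n \<in> I then blaschke_factor (a n) z else 1)"
proof -
  let ?F = "\<lambda>n z. if n \<in> I then blaschke_factor (a n) z else 1"
  let ?d = "\<lambda>n. if n \<in> I then 1 - cmod (a n) else 0"
  have le: "norm (?F n z - 1) \<le> 2 / (1 - cmod z) * ?d n" if "z \<in> unit_disc" for n z
    using cmod_one_minus_blaschke_factor_le[of "a n" z] that I by (auto simp: blaschke_sequence_def)
  show conv: "abs_convergent_prod (\<lambda>n. ?F n z)" if "z \<in> unit_disc" for z
  proof (rule summable_imp_abs_convergent_prod)
    show "summable (\<lambda>n. norm (?F n z - 1))"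
      by (rule summable_comparison_test'[where N = 0, 
            OF summable_mult[OF blaschke_sequence_summable[OF I], of "2 / (1 - cmod z)"]])
        (use le[OF that] in simp)
  qed
  have "uniformly_convergent_on K (\<lambda>N z. \<Prod>n<N. ?F n z)"
  proof (rule uniformly_convergent_on_prod')
    show "continuous_on K (?F n)" for n
    proof (cases "n \<in> I")
      case True
      then have "blaschke_factor (a n) holomorphic_on unit_disc"
        using I by (intro holomorphic_on_blaschke_factor) (auto simp: blaschke_sequence_def)
      then have "continuous_on K (blaschke_factor (a n))"
        using holomorphic_on_imp_continuous_on K(2) continuous_on_subset by blast
      then show ?thesis using True by simp
    qed simp
    show "compact K" by fact
    show "uniformly_convergent_on K (\<lambda>N z. \<Sum>n<N. norm (?F n z - 1))"
    proof (cases "K = {}")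
      case False
      obtain w where w: "w \<in> K" "\<And>z. z \<in> K \<Longrightarrow> cmod z \<le> cmod w"
        using continuous_attains_sup[OF K(1) False, of cmod] by (auto intro: continuous_intros)
      have w1: "cmod w < 1" using w(1) K(2) by auto
      show ?thesis
      proof (rule Weierstrass_m_test')
        show "summable (\<lambda>n. 2 / (1 - cmod w) * ?d n)"
          by (intro summable_mult blaschke_sequence_summable I)
        fix n z assume z: "z \<in> K"
        have "norm (norm (?F n z - 1)) \<le> 2 / (1 - cmod z) * ?d n" using le[of z n] z K(2) by auto
        also have "\<dots> \<le> 2 / (1 - cmod w) * ?d n"
          using w(2)[OF z] w1 I by (intro mult_right_mono divide_left_mono)
            (auto simp: blaschke_sequence_def intro!: less_imp_le)
        finally show "norm (norm (?F n z - 1)) \<le> 2 / (1 - cmod w) * ?d n" .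
      qed
    qed (simp add: uniformly_convergent_on_def)
  qed
  then have "uniform_limit K (\<lambda>N z. \<Prod>n<N. ?F n z) (\<lambda>z. lim (\<lambda>N. \<Prod>n<N. ?F n z)) sequentially"
    by (simp add: uniformly_convergent_uniform_limit_iff)
  moreover have "lim (\<lambda>N. \<Prod>n<N. ?F n z) = blaschke_product I a z" if "z \<in> K" for z
  proof -
    have "convergent_prod (\<lambda>n. ?F n z)"
      using conv[of z] that K(2) by (intro abs_convergent_prod_imp_convergent_prod) auto
    then have "(\<lambda>N. \<Prod>n\<le>N. ?F n z) \<longlonglongrightarrow> blaschke_product I a z"
      unfolding blaschke_product_def by (rule convergent_prod_LIMSEQ)
    then have "(\<lambda>N. \<Prod>n<Suc N. ?F n z) \<longlonglongrightarrow> blaschke_product I a z" by (simp only: lessThan_Suc_atMost)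
    then have "(\<lambda>N. \<Prod>n<N. ?F n z) \<longlonglongrightarrow> blaschke_product I a z" by (rule LIMSEQ_imp_Suc)
    then show ?thesis by (rule limI)
  qed
  ultimately have "uniform_limit K (\<lambda>N z. \<Prod>n<N. ?F n z) (blaschke_product I a) sequentially"
    by (subst (asm) uniform_limit_cong') auto
  then show "uniform_limit K (\<lambda>N z. \<Prod>n\<in>I \<inter> {..<N}. blaschke_factor (a n) z) (blaschke_product I a) sequentially"
    by (simp only: blaschke_partial_prod)
qed

lemma blaschke_product_LIMSEQ:
  assumes I: "blaschke_sequence I a" and z: "z \<in> unit_disc"
  shows "(\<lambda>N. \<Prod>n\<in>I \<inter> {..<N}. blaschke_factor (a n) z) \<longlonglongrightarrow> blaschke_product I a z"
  using blaschke_product_uniform_limit(1)[OF I, of "{z}"] z by (auto intro: tendsto_uniform_limitI)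

lemma blaschke_convergent_prod:
  assumes I: "blaschke_sequence I a" and z: "z \<in> unit_disc"
  shows "convergent_prod (\<lambda>n. if n \<in> I then blaschke_factor (a n) z else 1)"
  using blaschke_product_uniform_limit(2)[OF I compact_empty _ z] abs_convergent_prod_imp_convergent_prod
  by blast

lemma cmod_blaschke_product_LIMSEQ:
  assumes I: "blaschke_sequence I a" and z: "z \<in> unit_disc"
  shows "(\<lambda>N. \<Prod>n\<in>I \<inter> {..<N}. pseudo_hyperbolic z (a n)) \<longlonglongrightarrow> cmod (blaschke_product I a z)"
  using tendsto_norm[OF blaschke_product_LIMSEQ[OF I z]]
  by (simp add: prod_norm[symmetric] cmod_blaschke_factor)

lemma holomorphic_on_finite_blaschke:
  assumes "\<And>n. n \<in> F \<Longrightarrow> cmod (a n) < 1"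
  shows "(\<lambda>z. \<Prod>n\<in>F. blaschke_factor (a n) z) holomorphic_on unit_disc"
  by (intro holomorphic_intros holomorphic_on_blaschke_factor assms)

lemma holomorphic_on_blaschke_product:
  assumes I: "blaschke_sequence I a"
  shows "blaschke_product I a holomorphic_on unit_disc"
proof (rule holomorphic_uniform_sequence)
  show "(\<lambda>z. \<Prod>n\<in>I \<inter> {..<N}. blaschke_factor (a n) z) holomorphic_on unit_disc" for N
    using I by (intro holomorphic_on_finite_blaschke) (auto simp: blaschke_sequence_def)
  fix x :: complex assume "x \<in> unit_disc"
  then obtain d where "d > 0" "cball x d \<subseteq> unit_disc" 
    by (metis open_ball open_contains_cball)
  then show "\<exists>d>0. cball x d \<subseteq> unit_disc \<and> uniform_limit (cball x d)
      (\<lambda>N z. \<Prod>n\<in>I \<inter> {..<N}. blaschke_factor (a n) z) (blaschke_product I a) sequentially"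
    using blaschke_product_uniform_limit(1)[OF I compact_cball] by blast
qed simp

lemma finite_blaschke_le_1:
  assumes "\<And>n. n \<in> F \<Longrightarrow> cmod (a n) < 1" "z \<in> unit_disc"
  shows "(\<Prod>n\<in>F. pseudo_hyperbolic z (a n)) \<le> 1"
  using assms by (intro prod_le_1) (auto intro!: less_imp_le[OF pseudo_hyperbolic_less_1])

lemma cmod_blaschke_product_le_finite:
  assumes I: "blaschke_sequence I a" and z: "z \<in> unit_disc" and F: "finite F" "F \<subseteq> I"
  shows "cmod (blaschke_product I a z) \<le> (\<Prod>n\<in>F. pseudo_hyperbolic z (a n))"
proof (rule LIMSEQ_le_const2[OF cmod_blaschke_product_LIMSEQ[OF I z]])
  obtain M where M: "F \<subseteq> {..<M}" using F(1) finite_nat_iff_bounded by blast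
  have "(\<Prod>n\<in>I \<inter> {..<N}. pseudo_hyperbolic z (a n)) \<le> (\<Prod>n\<in>F. pseudo_hyperbolic z (a n))"
    if "N \<ge> M" for N
  proof -
    have sub: "F \<subseteq> I \<inter> {..<N}" using M F that by auto
    have "(\<Prod>n\<in>I \<inter> {..<N} - F. pseudo_hyperbolic z (a n)) \<le> 1"
      using I z by (intro finite_blaschke_le_1) (auto simp: blaschke_sequence_def)
    then have "(\<Prod>n\<in>I \<inter> {..<N} - F. pseudo_hyperbolic z (a n)) * (\<Prod>n\<in>F. pseudo_hyperbolic z (a n))
        \<le> (\<Prod>n\<in>F. pseudo_hyperbolic z (a n))"
      by (intro mult_left_le_one_le prod_nonneg) auto
    then show ?thesis by (subst prod.subset_diff[OF sub]) auto
  qed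
  then show "\<exists>M. \<forall>N\<ge>M. (\<Prod>n\<in>I \<inter> {..<N}. pseudo_hyperbolic z (a n)) \<le> (\<Prod>n\<in>F. pseudo_hyperbolic z (a n))"
    by blast
qed

lemma cmod_blaschke_product_le_1:
  assumes "blaschke_sequence I a" "z \<in> unit_disc"
  shows "cmod (blaschke_product I a z) \<le> 1"
  using cmod_blaschke_product_le_finite[OF assms, of "{}"] by simp

lemma blaschke_product_remove:
  assumes I: "blaschke_sequence I a" and z: "z \<in> unit_disc" and n: "n \<in> I"
  shows "blaschke_product I a z = blaschke_factor (a n) z * blaschke_product (I - {n}) a z"
proof (rule LIMSEQ_unique[OF blaschke_product_LIMSEQ[OF I z]])
  have "(\<lambda>N. blaschke_factor (a n) z * (\<Prod>n\<in>(I - {n}) \<inter> {..<N}. blaschke_factor (a n) z))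
      \<longlonglongrightarrow> blaschke_factor (a n) z * blaschke_product (I - {n}) a z"
    by (intro tendsto_intros blaschke_product_LIMSEQ blaschke_sequence_subset[OF I] z) auto
  moreover have "(\<Prod>n\<in>I \<inter> {..<N}. blaschke_factor (a n) z) =
      blaschke_factor (a n) z * (\<Prod>n\<in>(I - {n}) \<inter> {..<N}. blaschke_factor (a n) z)" if "N > n" for N
  proof -
    have "(I - {n}) \<inter> {..<N} = (I \<inter> {..<N}) - {n}" by auto
    then show ?thesis using that n by (simp add: prod.remove)
  qed
  ultimately show "(\<lambda>N. \<Prod>n\<in>I \<inter> {..<N}. blaschke_factor (a n) z)
      \<longlonglongrightarrow> blaschke_factor (a n) z * blaschke_product (I - {n}) a z"
    by (elim Lim_transform_eventually)
      (auto simp: eventually_sequentially intro!: exI[of _ "Suc n"])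
qed

lemma blaschke_product_eq_0_iff:
  assumes I: "blaschke_sequence I a" and z: "z \<in> unit_disc"
  shows "blaschke_product I a z = 0 \<longleftrightarrow> z \<in> a ` I"
proof -
  let ?f = "\<lambda>n. if n \<in> I then blaschke_factor (a n) z else 1"
  have "?f has_prod blaschke_product I a z"
    unfolding blaschke_product_def by (rule convergent_prod_has_prod[OF blaschke_convergent_prod[OF I z]])
  from has_prod_eq_0_iff[OF this] have "blaschke_product I a z = 0 \<longleftrightarrow> (\<exists>n\<in>I. blaschke_factor (a n) z = 0)"
    by (auto split: if_splits)
  also have "\<dots> \<longleftrightarrow> (\<exists>n\<in>I. z = a n)"
    using z I by (intro bex_cong refl)
      (auto simp: blaschke_sequence_def norm_eq_zero[symmetric, of "blaschke_factor _ _"]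
        cmod_blaschke_factor pseudo_hyperbolic_eq_0_iff simp del: norm_eq_zero)
  finally show ?thesis by auto
qed

lemma prodinf_pseudo_hyperbolic:
  assumes I: "blaschke_sequence I a" and z: "z \<in> unit_disc"
  shows "(\<Prod>n. if n \<in> I then pseudo_hyperbolic z (a n) else 1) = cmod (blaschke_product I a z)"
proof -
  have "(\<lambda>n. if n \<in> I then blaschke_factor (a n) z else 1) has_prod blaschke_product I a z"
    unfolding blaschke_product_def by (rule convergent_prod_has_prod[OF blaschke_convergent_prod[OF I z]])
  from has_prod_norm[OF this]
  have "(\<lambda>n. if n \<in> I then pseudo_hyperbolic z (a n) else 1) has_prod cmod (blaschke_product I a z)"
    by (simp add: if_distrib[of cmod] cmod_blaschke_factor cong: if_cong)
  then show ?thesis using has_prod_unique by metis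
qed

lemma image_restrict_vimage: "S \<subseteq> f ` I \<Longrightarrow> f ` (I \<inter> f -` S) = S"
  by auto

text \<open>The modulus of a Blaschke product is the infimum of the finite subproducts, so it depends only on
  the zero set, and transforms with it under an isometry of the pseudo-hyperbolic distance.\<close>

lemma cmod_blaschke_product_isometry_le:
  assumes I: "blaschke_sequence I a" and inj: "inj_on a I"
    and iso: "\<And>z w. z \<in> unit_disc \<Longrightarrow> w \<in> unit_disc \<Longrightarrow>
      \<phi> z \<in> unit_disc \<and> pseudo_hyperbolic (\<phi> z) (\<phi> w) = pseudo_hyperbolic z w"
    and img: "\<phi> ` a ` I \<subseteq> a ` I" and z: "z \<in> unit_disc"
  shows "cmod (blaschke_product I a (\<phi> z)) \<le> cmod (blaschke_product I a z)"
proof (rule LIMSEQ_le_const[OF cmod_blaschke_product_LIMSEQ[OF I z]])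
  have a: "a n \<in> unit_disc" if "n \<in> I" for n using that I by (auto simp: blaschke_sequence_def)
  have inj\<phi>: "inj_on \<phi> unit_disc"
  proof (rule inj_onI)
    fix x y assume xy: "x \<in> unit_disc" "y \<in> unit_disc" "\<phi> x = \<phi> y"
    then have "pseudo_hyperbolic x y = 0" using iso[OF xy(1,2)] by (simp add: pseudo_hyperbolic_def)
    then show "x = y" using xy by (simp add: pseudo_hyperbolic_eq_0_iff)
  qed
  have "cmod (blaschke_product I a (\<phi> z)) \<le> (\<Prod>n\<in>I \<inter> {..<N}. pseudo_hyperbolic z (a n))" for N
  proof -
    define F where "F = I \<inter> a -` (\<phi> ` a ` (I \<inter> {..<N}))"
    have "\<phi> ` a ` (I \<inter> {..<N}) \<subseteq> a ` I" using img by blast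
    then have aF: "a ` F = \<phi> ` a ` (I \<inter> {..<N})"
      unfolding F_def by (rule image_restrict_vimage)
    have "F \<subseteq> I" by (auto simp: F_def)
    then have bij: "bij_betw a F (\<phi> ` a ` (I \<inter> {..<N}))"
      unfolding bij_betw_def using inj_on_subset[OF inj] aF by simp
    have fin: "finite F" using bij_betw_finite[OF bij] by simp
    have "cmod (blaschke_product I a (\<phi> z)) \<le> (\<Prod>n\<in>F. pseudo_hyperbolic (\<phi> z) (a n))"
      using iso[OF z z] by (intro cmod_blaschke_product_le_finite I fin) (auto simp: F_def)
    also have "\<dots> = (\<Prod>w\<in>\<phi> ` a ` (I \<inter> {..<N}). pseudo_hyperbolic (\<phi> z) w)"
      by (rule prod.reindex_bij_betw[OF bij])
    also have "\<dots> = (\<Prod>w\<in>a ` (I \<inter> {..<N}). pseudo_hyperbolic (\<phi> z) (\<phi> w))"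
      by (rule prod.reindex_cong[of \<phi>]) (use a in \<open>auto intro!: inj_on_subset[OF inj\<phi>]\<close>)
    also have "\<dots> = (\<Prod>n\<in>I \<inter> {..<N}. pseudo_hyperbolic (\<phi> z) (\<phi> (a n)))"
      by (rule prod.reindex_cong[of a]) (auto intro!: inj_on_subset[OF inj])
    also have "\<dots> = (\<Prod>n\<in>I \<inter> {..<N}. pseudo_hyperbolic z (a n))"
      using iso[OF z a] by (intro prod.cong) auto
    finally show ?thesis .
  qed
  then show "\<exists>M. \<forall>N\<ge>M. cmod (blaschke_product I a (\<phi> z)) \<le> (\<Prod>n\<in>I \<inter> {..<N}. pseudo_hyperbolic z (a n))"
    by blast
qed

section \<open>Zeros of functions in the Hardy space\<close>

lemma H2_mult_finite_blaschke:
  assumes F: "finite F" "\<And>n. n \<in> F \<Longrightarrow> cmod (a n) < 1" and h: "h \<in> H2"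
  shows "(\<lambda>z. (\<Prod>n\<in>F. blaschke_factor (a n) z) * h z) \<in> H2 \<and>
    H2_norm (\<lambda>z. (\<Prod>n\<in>F. blaschke_factor (a n) z) * h z) \<le> H2_norm h"
  using F
proof (induction F rule: finite_induct)
  case (insert m F)
  then have IH: "(\<lambda>z. (\<Prod>n\<in>F. blaschke_factor (a n) z) * h z) \<in> H2"
    "H2_norm (\<lambda>z. (\<Prod>n\<in>F. blaschke_factor (a n) z) * h z) \<le> H2_norm h" by auto
  have am: "cmod (a m) < 1" using insert by auto
  show ?case using H2_mult_blaschke_factor[OF am IH(1)] IH(2) insert.hyps by (auto simp: mult.assoc)
qed (use h in simp)

lemma H2_divide_finite_blaschke:
  assumes F: "finite F" "\<And>n. n \<in> F \<Longrightarrow> cmod (a n) < 1" "inj_on a F"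
    and f: "f \<in> H2" "\<And>n. n \<in> F \<Longrightarrow> f (a n) = 0"
  shows "\<exists>h\<in>H2. f = (\<lambda>z. (\<Prod>n\<in>F. blaschke_factor (a n) z) * h z) \<and> H2_norm h \<le> H2_norm f"
  using F f(2)
proof (induction F rule: finite_induct)
  case empty
  then show ?case using f(1) by (intro bexI[of _ f]) auto
next
  case (insert m F)
  then obtain h where h: "h \<in> H2" "f = (\<lambda>z. (\<Prod>n\<in>F. blaschke_factor (a n) z) * h z)" "H2_norm h \<le> H2_norm f"
    by auto
  have am: "cmod (a m) < 1" "f (a m) = 0" using insert by auto
  have "blaschke_factor (a n) (a m) \<noteq> 0" if "n \<in> F" for n
  proof -
    have "a n \<noteq> a m" using insert that by (auto simp: inj_on_def)
    then have "pseudo_hyperbolic (a m) (a n) \<noteq> 0"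
      using am insert.prems(1)[of n] that by (simp add: pseudo_hyperbolic_eq_0_iff)
    then show ?thesis by (metis cmod_blaschke_factor norm_zero)
  qed
  then have "(\<Prod>n\<in>F. blaschke_factor (a n) (a m)) \<noteq> 0" using insert.hyps by simp
  then have "h (a m) = 0" using am(2) unfolding h(2) by simp
  then obtain k where k: "k \<in> H2" "h = (\<lambda>z. blaschke_factor (a m) z * k z)" "H2_norm k \<le> H2_norm h"
    using H2_divide_blaschke_factor[OF am(1) h(1)] by blast
  have "f = (\<lambda>z. (\<Prod>n\<in>insert m F. blaschke_factor (a n) z) * k z)"
    unfolding h(2) k(2) using insert.hyps by (simp add: mult_ac)
  then show ?case using k(1) order_trans[OF k(3) h(3)] by blast
qed

lemma H2_bounded_subsequence:
  assumes f: "\<And>k::nat. f k \<in> H2" "\<And>k. H2_norm (f k) \<le> C"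
  shows "\<exists>g r. g \<in> H2 \<and> strict_mono (r :: nat \<Rightarrow> nat) \<and> (\<forall>z\<in>unit_disc. (\<lambda>k. f (r k) z) \<longlonglongrightarrow> g z)"
proof -
  have C: "C \<ge> 0" using f[of 0] H2_norm_nonneg[OF f(1)[of 0]] by linarith
  obtain g r where g: "g holomorphic_on unit_disc" and r: "strict_mono (r :: nat \<Rightarrow> nat)"
    and lim: "\<And>z. z \<in> unit_disc \<Longrightarrow> (\<lambda>k. f (r k) z) \<longlonglongrightarrow> g z"
    and ulim: "\<And>K. compact K \<Longrightarrow> K \<subseteq> unit_disc \<Longrightarrow> uniform_limit K (f \<circ> r) g sequentially"
  proof (rule Montel[of unit_disc "range f" f])
    fix K :: "complex set" assume K: "compact K" "K \<subseteq> unit_disc"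
    show "\<exists>B. \<forall>h\<in>range f. \<forall>z\<in>K. cmod (h z) \<le> B"
    proof (cases "K = {}")
      case False
      obtain w where w: "w \<in> K" "\<And>z. z \<in> K \<Longrightarrow> cmod z \<le> cmod w"
        using continuous_attains_sup[OF K(1) False, of cmod] by (auto intro: continuous_intros)
      have w1: "cmod w < 1" using w(1) K(2) by auto
      have "cmod (f k z) \<le> C / sqrt (1 - (cmod w)\<^sup>2)" if z: "z \<in> K" for k z
      proof -
        have "cmod (f k z) \<le> H2_norm (f k) / sqrt (1 - (cmod z)\<^sup>2)"
          using H2_evaluation_bound[OF f(1)] z K by auto
        also have "\<dots> \<le> C / sqrt (1 - (cmod w)\<^sup>2)"
          using w1 w(2)[OF z] f(2) C
          by (intro frac_le) (auto simp: abs_square_less_1 intro!: power_mono)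
        finally show ?thesis .
      qed
      then show ?thesis by blast
    qed simp
  qed (use H2_holomorphic[OF f(1)] in \<open>auto\<close>)
  define g' where "g' = (\<lambda>z. if z \<in> unit_disc then g z else 0)"
  have "g' \<in> H2"
  proof (rule H2_locally_uniform_limit(1))
    show "f (r k) \<in> H2" "H2_norm (f (r k)) \<le> C" for k using f by auto
    have "uniform_limit (cball 0 (1/2)) (\<lambda>k. f (r k)) g sequentially"
      using ulim[of "cball 0 (1/2)"] by (simp add: o_def subset_eq)
    then show "uniform_limit (cball 0 (1/2)) (\<lambda>k. f (r k)) g' sequentially"
      by (subst uniform_limit_cong'[where g = "\<lambda>k. f (r k)" and i = g]) (auto simp: g'_def)
    show "g' holomorphic_on unit_disc"
      by (rule holomorphic_transform[OF g]) (simp add: g'_def)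
  qed (simp add: g'_def)
  then show ?thesis using r lim by (intro exI[of _ g'] exI[of _ r]) (simp add: g'_def)
qed

text \<open>F. Riesz factorization: dividing out finitely many zeros does not increase the norm, so the quotients
  by the partial products have a convergent subsequence, whose limit is the cofactor.\<close>

lemma H2_vanishing_iff_blaschke_multiple:
  assumes I: "blaschke_sequence I a" and inj: "inj_on a I" and f: "f \<in> H2"
  shows "(\<forall>n\<in>I. f (a n) = 0) \<longleftrightarrow> (\<exists>h\<in>H2. f = (\<lambda>z. blaschke_product I a z * h z))"
proof
  assume "\<exists>h\<in>H2. f = (\<lambda>z. blaschke_product I a z * h z)"
  then show "\<forall>n\<in>I. f (a n) = 0"
    using blaschke_product_eq_0_iff[OF I] I by (auto simp: blaschke_sequence_def)
next
  assume zero: "\<forall>n\<in>I. f (a n) = 0"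
  have a: "cmod (a n) < 1" if "n \<in> I" for n using that I by (auto simp: blaschke_sequence_def)
  have "\<exists>h\<in>H2. f = (\<lambda>z. (\<Prod>n\<in>I \<inter> {..<N}. blaschke_factor (a n) z) * h z) \<and> H2_norm h \<le> H2_norm f" for N
    using zero a f by (intro H2_divide_finite_blaschke inj_on_subset[OF inj]) auto
  then obtain h where h: "\<And>N. h N \<in> H2" "\<And>N. f = (\<lambda>z. (\<Prod>n\<in>I \<inter> {..<N}. blaschke_factor (a n) z) * h N z)"
    "\<And>N. H2_norm (h N) \<le> H2_norm f" by metis
  obtain g r where g: "g \<in> H2" and r: "strict_mono (r :: nat \<Rightarrow> nat)"
    and lim: "\<And>z. z \<in> unit_disc \<Longrightarrow> (\<lambda>k. h (r k) z) \<longlonglongrightarrow> g z"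
    using H2_bounded_subsequence[of h, OF h(1) h(3)] by metis
  have "f z = blaschke_product I a z * g z" for z
  proof (cases "z \<in> unit_disc")
    case True
    have "(\<lambda>k. (\<Prod>n\<in>I \<inter> {..<r k}. blaschke_factor (a n) z) * h (r k) z) \<longlonglongrightarrow> blaschke_product I a z * g z"
      using LIMSEQ_subseq_LIMSEQ[OF blaschke_product_LIMSEQ[OF I True] r]
      by (intro tendsto_mult lim True) (simp add: o_def)
    moreover have "(\<Prod>n\<in>I \<inter> {..<r k}. blaschke_factor (a n) z) * h (r k) z = f z" for k
      by (subst h(2)[of "r k"]) simp
    ultimately show ?thesis by (simp add: LIMSEQ_const_iff)
  next
    case False
    then show ?thesis using H2_zero_off[OF f] H2_zero_off[OF g] by simp
  qed
  then show "\<exists>h\<in>H2. f = (\<lambda>z. blaschke_product I a z * h z)" using g by blast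
qed

lemma H2_mult_blaschke_product:
  assumes I: "blaschke_sequence I a" and h: "h \<in> H2"
  shows "(\<lambda>z. blaschke_product I a z * h z) \<in> H2"
proof -
  let ?f = "\<lambda>N z. (\<Prod>n\<in>I \<inter> {..<N}. blaschke_factor (a n) z) * h z"
  have f: "?f N \<in> H2 \<and> H2_norm (?f N) \<le> H2_norm h" for N
    using I by (intro H2_mult_finite_blaschke h) (auto simp: blaschke_sequence_def)
  obtain g r where g: "g \<in> H2" and r: "strict_mono (r :: nat \<Rightarrow> nat)"
    and lim: "\<And>z. z \<in> unit_disc \<Longrightarrow> (\<lambda>k. ?f (r k) z) \<longlonglongrightarrow> g z"
    using H2_bounded_subsequence[of ?f "H2_norm h"] f by metis
  have "blaschke_product I a z * h z = g z" for z
  proof (cases "z \<in> unit_disc")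
    case True
    have "(\<lambda>k. ?f (r k) z) \<longlonglongrightarrow> blaschke_product I a z * h z"
      using LIMSEQ_subseq_LIMSEQ[OF blaschke_product_LIMSEQ[OF I True] r]
      by (intro tendsto_intros) (simp add: o_def)
    then show ?thesis using lim[OF True] LIMSEQ_unique by blast
  next
    case False
    then show ?thesis using H2_zero_off[OF h] H2_zero_off[OF g] by simp
  qed
  then show ?thesis using g by presburger
qed

text \<open>Jensen's bound without logarithms: at a point where the function does not vanish, all finite
  products of pseudo-hyperbolic distances to its zeros are bounded below.\<close>

lemma H2_zeros_summable:
  assumes f: "f \<in> H2" and f0: "f z0 \<noteq> 0" and A: "A \<subseteq> unit_disc" "\<And>w. w \<in> A \<Longrightarrow> f w = 0"
  shows "(\<lambda>w. 1 - cmod w) summable_on A"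
proof -
  have z0: "z0 \<in> unit_disc" using H2_zero_off[OF f] f0 by blast
  define E where "E = H2_norm f / sqrt (1 - (cmod z0)\<^sup>2)"
  have z0': "0 < 1 - (cmod z0)\<^sup>2" using z0 by (simp add: abs_square_less_1)
  have E: "E > 0" using H2_evaluation_bound[OF f z0] f0 unfolding E_def[symmetric]
    by (meson less_le_trans zero_less_norm_iff)
  have bound: "(\<Sum>w\<in>F. 1 - cmod w) \<le> 8 / (1 - (cmod z0)\<^sup>2) * ln (E / cmod (f z0))"
    if F: "finite F" "F \<subseteq> A" for F
  proof -
    have disc: "cmod w < 1" if "w \<in> F" for w using that F A by auto
    have "\<exists>h\<in>H2. f = (\<lambda>z. (\<Prod>w\<in>F. blaschke_factor w z) * h z) \<and> H2_norm h \<le> H2_norm f"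
      using F disc A(2) by (intro H2_divide_finite_blaschke f) auto
    then obtain h where h: "h \<in> H2" "f = (\<lambda>z. (\<Prod>w\<in>F. blaschke_factor w z) * h z)" "H2_norm h \<le> H2_norm f"
      by blast
    have "cmod (f z0) = (\<Prod>w\<in>F. pseudo_hyperbolic z0 w) * cmod (h z0)"
      by (subst h(2)) (simp add: norm_mult prod_norm[symmetric] cmod_blaschke_factor)
    also have "\<dots> \<le> (\<Prod>w\<in>F. exp (- (1 - pseudo_hyperbolic z0 w))) * E"
    proof (rule mult_mono)
      show "(\<Prod>w\<in>F. pseudo_hyperbolic z0 w) \<le> (\<Prod>w\<in>F. exp (- (1 - pseudo_hyperbolic z0 w)))"
        using exp_ge_add_one_self[of "- (1 - pseudo_hyperbolic z0 _)"] by (intro prod_mono) auto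
      show "cmod (h z0) \<le> E"
        unfolding E_def using h(3) z0' H2_evaluation_bound[OF h(1) z0]
        by (meson divide_right_mono order_trans real_sqrt_ge_zero less_imp_le)
    qed (auto intro: prod_nonneg)
    also have "(\<Prod>w\<in>F. exp (- (1 - pseudo_hyperbolic z0 w))) = exp (- (\<Sum>w\<in>F. 1 - pseudo_hyperbolic z0 w))"
      using F(1) by (simp only: exp_sum sum_negf[symmetric])
    finally have "exp (\<Sum>w\<in>F. 1 - pseudo_hyperbolic z0 w) \<le> E / cmod (f z0)"
      using f0 by (simp add: exp_minus field_simps)
    then have S: "(\<Sum>w\<in>F. 1 - pseudo_hyperbolic z0 w) \<le> ln (E / cmod (f z0))"
      using E f0 by (simp add: ln_ge_iff)
    \<comment> \<open>A factor 4 comes from \<open>|1 - cnj w z0| \<le> 2\<close> in the formula for \<open>1 - p\<^sup>2\<close>, and a factor 2 from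
      \<open>1 - p\<^sup>2 \<le> 2 (1 - p)\<close>.\<close>
    have "(1 - (cmod z0)\<^sup>2) / 8 * (1 - cmod w) \<le> 1 - pseudo_hyperbolic z0 w" if "w \<in> F" for w
    proof -
      define p where "p = pseudo_hyperbolic z0 w"
      have w: "cmod w < 1" by (rule disc[OF that])
      have p: "0 \<le> p" "p < 1" using z0 w by (auto simp: p_def pseudo_hyperbolic_less_1)
      have dn: "0 < cmod (1 - cnj w * z0)" using moebius_denom_nonzero[of w z0] w z0 by simp
      have "cmod (1 - cnj w * z0) \<le> 1 + cmod w * cmod z0"
        using norm_triangle_ineq4[of 1 "cnj w * z0"] by (simp add: norm_mult)
      also have "\<dots> \<le> 2" using w z0 by (simp add: mult_le_one)
      finally have d4: "(cmod (1 - cnj w * z0))\<^sup>2 \<le> 2\<^sup>2" by (intro power_mono) auto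
      have "1 - cmod w \<le> 1 - (cmod w)\<^sup>2" using w by (simp add: power2_eq_square mult_left_le)
      then have "(1 - (cmod z0)\<^sup>2) * (1 - cmod w) / 4 \<le>
          (1 - (cmod z0)\<^sup>2) * (1 - (cmod w)\<^sup>2) / (cmod (1 - cnj w * z0))\<^sup>2"
        using z0 z0' d4 w dn by (intro frac_le mult_left_mono mult_nonneg_nonneg) (auto simp: abs_square_le_1)
      also have "\<dots> = 1 - p\<^sup>2"
        using one_minus_pseudo_hyperbolic_sq[of z0 w] z0 w by (simp add: p_def)
      also have "\<dots> = (1 - p) * (1 + p)" by (simp add: power2_eq_square algebra_simps)
      also have "\<dots> \<le> (1 - p) * 2" using p by (intro mult_left_mono) auto
      finally show ?thesis by (simp add: p_def)
    qed
    then have "(\<Sum>w\<in>F. (1 - (cmod z0)\<^sup>2) / 8 * (1 - cmod w)) \<le> ln (E / cmod (f z0))"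
      by (intro order_trans[OF sum_mono S])
    then have "(1 - (cmod z0)\<^sup>2) / 8 * (\<Sum>w\<in>F. (1 - cmod w)) \<le> ln (E / cmod (f z0))"
      by (simp only: sum_distrib_left)
    then show ?thesis using z0' by (simp add: field_simps)
  qed
  show ?thesis
  proof (rule nonneg_bdd_above_summable_on)
    show "0 \<le> 1 - cmod w" if "w \<in> A" for w using A(1) that by (auto intro: less_imp_le)
    show "bdd_above (sum (\<lambda>w. 1 - cmod w) ` {F. F \<subseteq> A \<and> finite F})"
      by (rule bdd_aboveI2, rule bound) auto
  qed
qed

lemma blaschke_enumeration:
  fixes A :: "complex set"
  assumes "A \<subseteq> unit_disc" "(\<lambda>w. 1 - cmod w) summable_on A"
  obtains I a where "blaschke_sequence I a" "inj_on a I" "a ` I = A"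
proof -
  have "countable {w \<in> A. 1 - cmod w \<noteq> 0}" by (rule summable_countable_real[OF assms(2)])
  moreover have "{w \<in> A. 1 - cmod w \<noteq> 0} = A" using assms(1) by auto
  ultimately have c: "countable A" by simp
  define I where "I = to_nat_on A ` A"
  define a where "a = from_nat_into A"
  have a: "a (to_nat_on A w) = w" if "w \<in> A" for w using c that by (simp add: a_def)
  have img: "a ` I = A" using a by (force simp: I_def)
  have inj: "inj_on a I" by (rule inj_onI) (use a in \<open>auto simp: I_def\<close>)
  have "(\<lambda>n. 1 - cmod (a n)) summable_on I"
    using assms(2) summable_on_reindex[OF inj, of "\<lambda>w. 1 - cmod w"] by (simp add: img o_def)
  then have "blaschke_sequence I a" using assms(1) img by (force simp: blaschke_sequence_def)
  then show thesis using that inj img by blast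
qed

section \<open>Automorphisms of the disc and their iterates\<close>

lemma disc_automorphism_in_disc: "disc_automorphism \<phi> \<Longrightarrow> z \<in> unit_disc \<Longrightarrow> \<phi> z \<in> unit_disc"
  unfolding disc_automorphism_def bij_betw_def by blast

lemma disc_automorphism_inverse:
  assumes "disc_automorphism \<phi>"
  shows "\<exists>\<psi>. disc_automorphism \<psi> \<and> (\<forall>z\<in>unit_disc. \<psi> (\<phi> z) = z \<and> \<phi> (\<psi> z) = z)"
proof -
  have hol: "\<phi> holomorphic_on unit_disc" and bij: "bij_betw \<phi> unit_disc unit_disc"
    using assms by (auto simp: disc_automorphism_def)
  have inj: "inj_on \<phi> unit_disc" and img: "\<phi> ` unit_disc = unit_disc"
    using bij by (auto simp: bij_betw_def)
  have "\<exists>\<psi>. \<psi> holomorphic_on \<phi> ` unit_disc \<and> (\<forall>z\<in>unit_disc. \<psi> (\<phi> z) = z)"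
  proof (rule holomorphic_has_inverse[OF hol open_ball inj])
    fix g assume "g holomorphic_on \<phi> ` unit_disc" "\<And>z. z \<in> unit_disc \<Longrightarrow> g (\<phi> z) = z"
    then show ?thesis by (intro exI[of _ g]) simp
  qed
  then obtain \<psi> where \<psi>: "\<psi> holomorphic_on unit_disc" "\<And>z. z \<in> unit_disc \<Longrightarrow> \<psi> (\<phi> z) = z"
    unfolding img by auto
  have *: "\<phi> (\<psi> z) = z" if "z \<in> unit_disc" for z
  proof -
    have "z \<in> \<phi> ` unit_disc" unfolding img by (rule that)
    then obtain w where "w \<in> unit_disc" "z = \<phi> w" by blast
    then show ?thesis using \<psi>(2) by simp
  qed
  have in_disc: "\<psi> z \<in> unit_disc" if "z \<in> unit_disc" for z
  proof -
    have "z \<in> \<phi> ` unit_disc" unfolding img by (rule that)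
    then obtain w where "w \<in> unit_disc" "z = \<phi> w" by blast
    then show ?thesis using \<psi>(2) by simp
  qed
  have "bij_betw \<psi> unit_disc unit_disc"
    by (rule bij_betw_byWitness[where f' = \<phi>])
      (use * \<psi>(2) in_disc disc_automorphism_in_disc[OF assms] in auto)
  then show ?thesis using \<psi> * by (intro exI[of _ \<psi>]) (simp add: disc_automorphism_def)
qed

text \<open>Compose \<open>\<phi>\<close> with the involution that exchanges \<open>0\<close> and the preimage of \<open>0\<close>. The result and
  its inverse fix \<open>0\<close>, and the Schwarz lemma for both makes it a rotation.\<close>

lemma disc_automorphism_form:
  assumes \<phi>: "disc_automorphism \<phi>"
  shows "\<exists>a c. cmod a < 1 \<and> cmod c = 1 \<and> (\<forall>z\<in>unit_disc. \<phi> z = c * moebius a z)"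
proof -
  obtain \<psi> where \<psi>: "disc_automorphism \<psi>" "\<And>z. z \<in> unit_disc \<Longrightarrow> \<psi> (\<phi> z) = z"
    "\<And>z. z \<in> unit_disc \<Longrightarrow> \<phi> (\<psi> z) = z" using disc_automorphism_inverse[OF \<phi>] by auto
  define a where "a = \<psi> 0"
  have a: "cmod a < 1" using disc_automorphism_in_disc[OF \<psi>(1), of 0] by (simp add: a_def)
  have m: "moebius a z \<in> unit_disc" if "z \<in> unit_disc" for z
    using cmod_moebius_less_1[OF a] that by simp
  have m': "moebius a ` unit_disc \<subseteq> unit_disc" using m by blast
  have \<psi>': "\<psi> ` unit_disc \<subseteq> unit_disc" using disc_automorphism_in_disc[OF \<psi>(1)] by blast
  define h where "h = \<phi> \<circ> moebius a"
  define k where "k = moebius a \<circ> \<psi>"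
  have h: "h holomorphic_on unit_disc"
    unfolding h_def using \<phi> m' by (intro holomorphic_on_compose_gen[of _ _ _ unit_disc] holomorphic_on_moebius a)
      (auto simp: disc_automorphism_def)
  have k: "k holomorphic_on unit_disc"
    unfolding k_def using \<psi> \<psi>' by (intro holomorphic_on_compose_gen[of _ _ _ unit_disc] holomorphic_on_moebius a)
      (auto simp: disc_automorphism_def)
  have h0: "h 0 = 0" using \<psi>(3)[of 0] by (simp add: h_def moebius_def a_def)
  have k0: "k 0 = 0" by (simp add: k_def a_def moebius_def)
  have hd: "cmod (h z) < 1" if "cmod z < 1" for z
    using disc_automorphism_in_disc[OF \<phi> m[of z]] that by (simp add: h_def)
  have kd: "cmod (k z) < 1" if "cmod z < 1" for z
    using m[OF disc_automorphism_in_disc[OF \<psi>(1), of z]] that by (simp add: k_def)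
  have kh: "k (h z) = z" if "cmod z < 1" for z
    using \<psi>(2)[OF m[of z]] moebius_involution[OF a that] that by (simp add: k_def h_def)
  have "cmod (h (1/2)) = cmod (1/2)"
  proof (rule antisym)
    show "cmod (h (1/2)) \<le> cmod (1/2)" by (rule Schwarz_Lemma(1)[OF h h0 hd]) auto
    have "cmod (k (h (1/2))) \<le> cmod (h (1/2))" by (rule Schwarz_Lemma(1)[OF k k0 kd]) (auto intro: hd)
    then show "cmod (1/2) \<le> cmod (h (1/2))" using kh[of "1/2"] by simp
  qed
  then have "\<exists>z. cmod z < 1 \<and> z \<noteq> 0 \<and> cmod (h z) = cmod z"
    by (intro exI[of _ "1/2"]) auto
  from Schwarz_Lemma(3)[OF h h0 hd _ disjI1[OF this], of 0]
  obtain c where c: "\<And>z. cmod z < 1 \<Longrightarrow> h z = c * z" "cmod c = 1" by auto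
  have "\<phi> z = c * moebius a z" if "z \<in> unit_disc" for z
    using c(1)[of "moebius a z"] m[OF that] moebius_involution[OF a, of z] that by (simp add: h_def)
  then show ?thesis using a c(2) by blast
qed

lemma pseudo_hyperbolic_moebius_invariant:
  assumes a: "cmod a < 1" and "cmod z < 1" "cmod w < 1"
  shows "pseudo_hyperbolic (moebius a z) (moebius a w) = pseudo_hyperbolic z w"
proof -
  have dz: "1 - cnj a * z \<noteq> 0" and dw: "1 - cnj a * w \<noteq> 0"
    using assms moebius_denom_nonzero[of a] by (auto simp del: right_minus_eq eq_iff_diff_eq_0[symmetric])
  have dw': "1 - a * cnj w \<noteq> 0" using moebius_denom_nonzero[of "cnj a" "cnj w"] assms by simp
  have e: "1 - a * cnj a \<noteq> 0" using moebius_denom_nonzero[of a a] a by (simp add: mult.commute)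
  have num: "moebius a w - moebius a z =
      (1 - a * cnj a) * (z - w) / ((1 - cnj a * z) * (1 - cnj a * w))"
    using dz dw by (simp add: moebius_def divide_simps algebra_simps)
  have den: "1 - cnj (moebius a w) * moebius a z =
      (1 - a * cnj a) * (1 - cnj w * z) / ((1 - cnj a * z) * (1 - a * cnj w))"
    using dz dw' by (simp add: moebius_def divide_simps) (simp add: algebra_simps)
  have nrm: "cmod (1 - a * cnj w) = cmod (1 - cnj a * w)"
    by (metis complex_cnj_cnj complex_cnj_diff complex_cnj_mult complex_cnj_one complex_mod_cnj)
  show ?thesis
    unfolding pseudo_hyperbolic_def num den
    using dz dw dw' e by (simp add: norm_divide norm_mult nrm norm_minus_commute)
qed

lemma disc_automorphism_isometry:
  assumes \<phi>: "disc_automorphism \<phi>" and "z \<in> unit_disc" "w \<in> unit_disc"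
  shows "pseudo_hyperbolic (\<phi> z) (\<phi> w) = pseudo_hyperbolic z w"
proof -
  obtain a c where ac: "cmod a < 1" "cmod c = 1" "\<And>z. z \<in> unit_disc \<Longrightarrow> \<phi> z = c * moebius a z"
    using disc_automorphism_form[OF \<phi>] by blast
  have "cnj c * c = 1" using ac(2) by (metis complex_norm_square mult.commute of_real_1 one_power2)
  then have eq: "cnj (c * moebius a w) * (c * moebius a z) = cnj (moebius a w) * moebius a z"
    by (simp add: mult_ac)
  then have "pseudo_hyperbolic (c * moebius a z) (c * moebius a w) =
      pseudo_hyperbolic (moebius a z) (moebius a w)"
    unfolding pseudo_hyperbolic_def eq using ac(2)
    by (simp add: norm_divide norm_mult right_diff_distrib[symmetric])
  then show ?thesis using assms ac pseudo_hyperbolic_moebius_invariant[OF ac(1), of z w] by simp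
qed

lemma disc_automorphism_funpow:
  assumes \<phi>: "disc_automorphism \<phi>"
  shows "disc_automorphism (\<phi> ^^ n)"
proof (induction n)
  case 0
  then show ?case by (simp add: disc_automorphism_def bij_betw_def holomorphic_on_id[unfolded id_def])
next
  case (Suc n)
  have "bij_betw (\<phi> \<circ> \<phi> ^^ n) unit_disc unit_disc"
    using Suc \<phi> by (auto simp: disc_automorphism_def intro: bij_betw_trans)
  moreover have "(\<phi> \<circ> \<phi> ^^ n) holomorphic_on unit_disc"
    using Suc \<phi> by (intro holomorphic_on_compose_gen[of _ _ _ unit_disc])
      (auto simp: disc_automorphism_def bij_betw_def)
  ultimately show ?case by (simp only: disc_automorphism_def funpow.simps)
qed

text \<open>Write the automorphism with a matrix of determinant 1 as \<open>z \<mapsto> (p z + q) / (cnj q z + cnj p)\<close>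
  with \<open>Re p \<ge> 0\<close>. If the half-trace \<open>t = Re p\<close> were below 1, the quadratic equation for the fixed
  points would have a root in the disc. So \<open>t \<ge> 1\<close>, and the orbit of \<open>0\<close> is \<open>q / (cnj p - r\<^sub>n)\<close> for
  the increasing bounded real sequence \<open>r\<^sub>0 = 0\<close>, \<open>r\<^sub>n\<^sub>+\<^sub>1 = 1 / (2 t - r\<^sub>n)\<close>.\<close>

lemma orbit_of_0_tends_to_circle:
  assumes \<phi>: "disc_automorphism \<phi>" and nofix: "\<And>z. z \<in> unit_disc \<Longrightarrow> \<phi> z \<noteq> z"
  shows "\<exists>\<zeta>\<in>unit_circle. (\<lambda>n. (\<phi> ^^ n) 0) \<longlonglongrightarrow> \<zeta>"
proof -
  obtain a c where a: "cmod a < 1" and c: "cmod c = 1"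
    and form: "\<And>z. z \<in> unit_disc \<Longrightarrow> \<phi> z = c * moebius a z"
    using disc_automorphism_form[OF \<phi>] by blast
  define v where "v = csqrt (- c)"
  have v2: "v * v = - c" using power2_csqrt[of "- c"] by (simp add: v_def power2_eq_square)
  have "cmod v * cmod v = 1" using c v2 by (metis norm_minus_cancel norm_mult)
  then have nv: "cmod v = 1" by (metis abs_norm_cancel abs_mult_self_eq real_sqrt_abs2 real_sqrt_one)
  then have vv: "v * cnj v = 1" by (metis complex_norm_square of_real_1 one_power2)
  define s where "s = 1 / sqrt (1 - (cmod a)\<^sup>2)"
  have a2: "0 < 1 - (cmod a)\<^sup>2" using a by (simp add: abs_square_less_1)
  have s: "s > 0" "s\<^sup>2 * (1 - (cmod a)\<^sup>2) = 1" using a2 by (auto simp: s_def power_divide)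
  define p where "p = of_real s * v"
  define q where "q = - (a * p)"
  define t where "t = Re p"
  have np: "cmod p = s" using s by (simp add: p_def norm_mult nv)
  have p0: "p \<noteq> 0" using np s by auto
  have t0: "t \<ge> 0" unfolding t_def p_def v_def
    using s Re_csqrt[of "- c"] by simp
  have detr: "(cmod p)\<^sup>2 - (cmod q)\<^sup>2 = 1"
    using s(2) by (simp add: q_def norm_mult power_mult_distrib np algebra_simps)
  have det: "p * cnj p - q * cnj q = 1"
    using detr by (metis complex_norm_square of_real_1 of_real_diff)
  have den: "cnj q * z + cnj p = cnj p * (1 - cnj a * z)" for z by (simp add: q_def algebra_simps)
  have den0: "cnj q * z + cnj p \<noteq> 0" if "z \<in> unit_disc" for z
    unfolding den using p0 moebius_denom_nonzero[OF a, of z] that by simp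
  have mat: "\<phi> z = (p * z + q) / (cnj q * z + cnj p)" if z: "z \<in> unit_disc" for z
  proof -
    have "p = - c * cnj p"
    proof -
      have "- c * cnj v = v" using vv v2 by (metis mult.assoc mult.right_neutral)
      then have "of_real s * (- c * cnj v) = p" by (simp add: p_def)
      then show ?thesis by (simp add: p_def mult_ac)
    qed
    have "p * z + q = - p * (a - z)" by (simp add: q_def algebra_simps)
    also have "\<dots> = c * cnj p * (a - z)" by (subst \<open>p = - c * cnj p\<close>) simp
    finally show ?thesis
      using p0 form[OF z] by (simp add: den moebius_def)
  qed
  have q0: "q \<noteq> 0"
  proof
    assume "q = 0"
    then have "a = 0" using p0 by (simp add: q_def)
    then have "\<phi> 0 = 0" using form[of 0] by (simp add: moebius_def)
    then show False using nofix[of 0] by simp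
  qed
  have t1: "t \<ge> 1"
  proof (rule ccontr)
    assume "\<not> t \<ge> 1"
    define y where "y = Im p"
    \<comment> \<open>The roots of the fixed point equation are \<open>\<i> (y \<plusminus> sqrt (1 - t\<^sup>2)) / cnj q\<close>, and the product of
      their moduli is 1; the sign of \<open>\<sigma>\<close> selects the smaller one.\<close>
    define \<sigma> where "\<sigma> = (if y \<ge> 0 then 1 else -1) * sqrt (1 - t\<^sup>2)"
    have tt: "0 < 1 - t\<^sup>2" using \<open>\<not> t \<ge> 1\<close> t0 by (simp add: abs_square_less_1)
    then have \<sigma>2: "\<sigma>\<^sup>2 = 1 - t\<^sup>2" "\<sigma> \<noteq> 0" by (auto simp: \<sigma>_def power_mult_distrib)
    have nq: "(cmod q)\<^sup>2 = y\<^sup>2 - \<sigma>\<^sup>2"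
      using detr by (simp add: \<sigma>2 cmod_power2[of p] t_def[symmetric] y_def[symmetric])
    have nq0: "0 < (cmod q)\<^sup>2" using q0 by simp
    have "\<sigma>\<^sup>2 < y * \<sigma>"
    proof -
      have "\<bar>\<sigma>\<bar> < \<bar>y\<bar>" using nq nq0 by (simp add: abs_le_square_iff[symmetric] flip: not_le)
      then have "\<bar>\<sigma>\<bar> * \<bar>\<sigma>\<bar> < \<bar>y\<bar> * \<bar>\<sigma>\<bar>" using \<sigma>2(2) by (intro mult_strict_right_mono) auto
      also have "\<bar>y\<bar> * \<bar>\<sigma>\<bar> = y * \<sigma>" using tt by (auto simp: \<sigma>_def abs_mult)
      finally show ?thesis by (simp add: power2_eq_square)
    qed
    then have lt: "(y - \<sigma>)\<^sup>2 < (cmod q)\<^sup>2" unfolding nq by (simp add: power2_eq_square algebra_simps)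
    define z where "z = \<i> * of_real (y - \<sigma>) / cnj q"
    have "cmod z = \<bar>y - \<sigma>\<bar> / cmod q" by (simp add: z_def norm_divide norm_mult del: of_real_diff)
    also have "\<dots> < 1" using lt q0 by (simp add: abs_le_square_iff[symmetric] flip: not_le)
    finally have z: "z \<in> unit_disc" by simp
    have qq: "q * cnj q = of_real (y\<^sup>2 - \<sigma>\<^sup>2)" using nq by (metis complex_norm_square)
    have pp: "p - cnj p = 2 * \<i> * of_real y" by (simp add: complex_eq_iff y_def)
    have qz: "cnj q * z = \<i> * of_real (y - \<sigma>)" using q0 by (simp add: z_def)
    have "cnj q * ((p - cnj p) * z + q - z * (cnj q * z)) =
        (p - cnj p) * (cnj q * z) + q * cnj q - (cnj q * z) * (cnj q * z)" by (simp add: algebra_simps)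
    also have "\<dots> = (2 * \<i> * of_real y) * (\<i> * of_real (y - \<sigma>)) + of_real (y\<^sup>2 - \<sigma>\<^sup>2)
          - (\<i> * of_real (y - \<sigma>)) * (\<i> * of_real (y - \<sigma>))"
      unfolding qq pp qz ..
    also have "\<dots> = 0" by (simp add: complex_eq_iff power2_eq_square algebra_simps)
    finally have "(p - cnj p) * z + q - z * (cnj q * z) = 0" using q0 by simp
    then have "p * z + q = z * (cnj q * z + cnj p)" by (simp add: algebra_simps)
    then have "\<phi> z = z" using mat[OF z] den0[OF z] by simp
    then show False using nofix[OF z] by simp
  qed
  define r :: "nat \<Rightarrow> real" where "r n = ((\<lambda>x. 1 / (2 * t - x)) ^^ n) 0" for n
  have r0: "r 0 = 0" and rS: "r (Suc n) = 1 / (2 * t - r n)" for n by (auto simp: r_def)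
  \<comment> \<open>The smaller fixed point of \<open>x \<mapsto> 1 / (2 t - x)\<close> bounds the sequence.\<close>
  define e where "e = t - sqrt (t\<^sup>2 - 1)"
  have t2: "t\<^sup>2 - 1 \<ge> 0" using t1 by (simp add: power2_eq_square mult_ge1_I)
  have e_eq: "e * (2 * t - e) = 1" using real_sqrt_pow2[OF t2]
    by (simp add: e_def power2_eq_square algebra_simps)
  have et: "e \<le> t" using t2 by (simp add: e_def)
  have e_pos: "e > 0"
  proof -
    have "0 < 2 * t - e" using et t1 by linarith
    moreover have "0 < e * (2 * t - e)" using e_eq by simp
    ultimately show ?thesis using zero_less_mult_pos2 by blast
  qed
  have r_bounds: "0 \<le> r n \<and> r n \<le> e" for n
  proof (induction n)
    case (Suc n)
    have "1 / (2 * t - r n) \<le> 1 / (2 * t - e)" using Suc et t1 by (intro divide_left_mono) auto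
    also have "\<dots> = e" using e_eq et t1 by (auto simp: field_simps)
    finally show ?case using Suc et t1 by (simp add: rS)
  qed (use r0 e_pos in simp)
  have quad: "0 \<le> 1 - 2 * t * r n + (r n)\<^sup>2" for n
  proof -
    have "0 \<le> (e - r n) * ((2 * t - e) - r n)" using r_bounds[of n] et by (intro mult_nonneg_nonneg) auto
    also have "\<dots> = 1 - 2 * t * r n + (r n)\<^sup>2" using e_eq by (simp add: power2_eq_square algebra_simps)
    finally show ?thesis .
  qed
  have inc: "incseq r"
  proof (rule incseq_SucI)
    fix n
    have "r n * (2 * t - r n) \<le> 1" using quad[of n] by (simp add: power2_eq_square algebra_simps)
    then show "r n \<le> r (Suc n)" using r_bounds[of n] et t1 by (simp add: rS field_simps)
  qed
  obtain L where L: "r \<longlonglongrightarrow> L" "\<And>n. r n \<le> L"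
    using incseq_convergent[OF inc, of e] r_bounds by blast
  have Le: "L \<le> e" by (rule LIMSEQ_le_const2[OF L(1)]) (use r_bounds in auto)
  have L_eq: "L * (2 * t - L) = 1"
  proof -
    have "(\<lambda>n. r (Suc n) * (2 * t - r n)) \<longlonglongrightarrow> L * (2 * t - L)"
      by (intro tendsto_intros L LIMSEQ_Suc)
    moreover have "r (Suc n) * (2 * t - r n) = 1" for n using r_bounds[of n] et t1 by (simp add: rS)
    ultimately show ?thesis by (simp add: LIMSEQ_const_iff)
  qed
  have nrm: "(cmod (cnj p - of_real x))\<^sup>2 = (cmod q)\<^sup>2 + (1 - 2 * t * x + x\<^sup>2)" for x
  proof -
    have "(cmod (cnj p - of_real x))\<^sup>2 = (cmod p)\<^sup>2 + (x\<^sup>2 - 2 * t * x)"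
      by (simp only: cmod_power2) (simp add: t_def power2_eq_square algebra_simps)
    then show ?thesis using detr by linarith
  qed
  have nz: "cnj p - of_real (r n) \<noteq> 0" for n
    using nrm[of "r n"] quad[of n] q0 by (auto simp: power2_eq_square) (smt (verit) mult_pos_pos zero_less_norm_iff)
  have orbit: "(\<phi> ^^ Suc n) 0 = q / (cnj p - of_real (r n))" for n
  proof (induction n)
    case 0
    then show ?case using mat[of 0] by (simp add: r0)
  next
    case (Suc n)
    let ?w = "q / (cnj p - of_real (r n))"
    have w: "?w \<in> unit_disc" using disc_automorphism_in_disc[OF disc_automorphism_funpow[OF \<phi>], of 0 "Suc n"] Suc by simp
    have pos: "2 * t - r n > 0" using r_bounds[of n] et t1 by linarith
    have pt: "p + cnj p = of_real (2 * t)" by (simp add: complex_eq_iff t_def)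
    have clear_den: "(cnj q * (q / B) + cnj p) * B = q * cnj q + cnj p * B" if "B \<noteq> 0" for B
      using that by (simp add: field_simps)
    have "(\<phi> ^^ Suc (Suc n)) 0 = \<phi> ?w" using Suc by simp
    also have "\<dots> = (p * ?w + q) / (cnj q * ?w + cnj p)" by (rule mat[OF w])
    also have "\<dots> = ((p * ?w + q) * (cnj p - of_real (r n))) / ((cnj q * ?w + cnj p) * (cnj p - of_real (r n)))"
      using nz[of n] by simp
    also have "(p * ?w + q) * (cnj p - of_real (r n)) = q * (p + cnj p - of_real (r n))"
      using nz[of n] by (simp add: distrib_right) (simp add: algebra_simps)
    also have "\<dots> = q * of_real (2 * t - r n)" by (simp add: pt)
    also have "(cnj q * ?w + cnj p) * (cnj p - of_real (r n)) = q * cnj q + cnj p * (cnj p - of_real (r n))"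
      by (rule clear_den[OF nz])
    also have "\<dots> = cnj p * (p + cnj p - of_real (r n)) - 1" using det by (simp add: algebra_simps)
    also have "\<dots> = (cnj p - of_real (r (Suc n))) * of_real (2 * t - r n)"
      using pos unfolding pt rS by (simp add: algebra_simps del: of_real_diff flip: of_real_mult of_real_diff)
    finally show ?case using pos by (simp del: of_real_diff)
  qed
  have Lnz: "(cmod (cnj p - of_real L))\<^sup>2 = (cmod q)\<^sup>2"
    using nrm[of L] L_eq by (simp add: power2_eq_square algebra_simps)
  then have Ln: "cmod (cnj p - of_real L) = cmod q" by (simp add: power2_eq_iff_nonneg)
  have lim: "(\<lambda>n. (\<phi> ^^ Suc n) 0) \<longlonglongrightarrow> q / (cnj p - of_real L)"
    unfolding orbit using Ln q0 by (intro tendsto_intros L(1)) auto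
  have "(\<lambda>n. (\<phi> ^^ n) 0) \<longlonglongrightarrow> q / (cnj p - of_real L)" by (rule LIMSEQ_imp_Suc[OF lim])
  moreover have "q / (cnj p - of_real L) \<in> unit_circle" using Ln q0 by (simp add: norm_divide)
  ultimately show ?thesis by blast
qed

lemma non_elliptic_orbit:
  assumes "non_elliptic_automorphism \<phi>"
  shows "disc_automorphism \<phi>" "\<exists>\<zeta>\<in>unit_circle. (\<lambda>n. (\<phi> ^^ n) 0) \<longlonglongrightarrow> \<zeta>"
proof -
  show \<phi>: "disc_automorphism \<phi>" using assms by (simp add: non_elliptic_automorphism_def)
  have "fixed_points \<phi> \<subseteq> unit_circle"
    using assms by (auto simp: non_elliptic_automorphism_def hyperbolic_def parabolic_def)
  then have "\<phi> z \<noteq> z" if "z \<in> unit_disc" for z using that by (auto simp: fixed_points_def)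
  then show "\<exists>\<zeta>\<in>unit_circle. (\<lambda>n. (\<phi> ^^ n) 0) \<longlonglongrightarrow> \<zeta>" by (rule orbit_of_0_tends_to_circle[OF \<phi>])
qed

text \<open>The pseudo-hyperbolic distance from \<open>(\<phi> ^^ n) z\<close> to \<open>(\<phi> ^^ n) 0\<close> does not depend on \<open>n\<close>, so
  every orbit leaves all compact subsets of the disc along with the orbit of \<open>0\<close>.\<close>

lemma orbit_norm_tends_to_1:
  assumes \<phi>: "disc_automorphism \<phi>" and \<zeta>: "\<zeta> \<in> unit_circle" and lim: "(\<lambda>n. (\<phi> ^^ n) 0) \<longlonglongrightarrow> \<zeta>"
    and z: "z \<in> unit_disc"
  shows "(\<lambda>n. cmod ((\<phi> ^^ n) z)) \<longlonglongrightarrow> 1"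
proof -
  define w where "w n = (\<phi> ^^ n) 0" for n
  have wD: "cmod (w n) < 1" for n
    using disc_automorphism_in_disc[OF disc_automorphism_funpow[OF \<phi>], of 0 n] by (simp add: w_def)
  have zD: "cmod ((\<phi> ^^ n) z) < 1" for n
    using disc_automorphism_in_disc[OF disc_automorphism_funpow[OF \<phi>] z, of n] by simp
  have wlim: "(\<lambda>n. cmod (w n)) \<longlonglongrightarrow> 1" using tendsto_norm[OF lim] \<zeta> by (simp add: w_def)
  have z2: "0 < 1 - (cmod z)\<^sup>2" using z by (simp add: abs_square_less_1)
  have le: "1 - cmod ((\<phi> ^^ n) z) \<le> 2 / (1 - (cmod z)\<^sup>2) * (1 - (cmod (w n))\<^sup>2)" for n
  proof -
    define x where "x = cmod ((\<phi> ^^ n) z)"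
    have x: "0 \<le> x" "x < 1" using zD by (auto simp: x_def)
    have "pseudo_hyperbolic ((\<phi> ^^ n) z) (w n) = cmod z"
      using disc_automorphism_isometry[OF disc_automorphism_funpow[OF \<phi>] z, of 0 n] by (simp add: w_def)
    then have eq: "1 - (cmod z)\<^sup>2 =
        (1 - x\<^sup>2) * (1 - (cmod (w n))\<^sup>2) / (cmod (1 - cnj (w n) * (\<phi> ^^ n) z))\<^sup>2"
      using one_minus_pseudo_hyperbolic_sq[OF zD[of n] wD[of n]] by (simp add: x_def)
    have "cmod (cnj (w n) * (\<phi> ^^ n) z) \<le> x"
      using wD[of n] by (simp add: norm_mult x_def mult_left_le_one_le)
    then have "1 - x \<le> cmod (1 - cnj (w n) * (\<phi> ^^ n) z)"
      using norm_triangle_ineq2[of 1 "cnj (w n) * (\<phi> ^^ n) z"] by simp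
    then have "(1 - x)\<^sup>2 \<le> (cmod (1 - cnj (w n) * (\<phi> ^^ n) z))\<^sup>2" using x by (intro power_mono) auto
    then have "1 - (cmod z)\<^sup>2 \<le> (1 - x\<^sup>2) * (1 - (cmod (w n))\<^sup>2) / (1 - x)\<^sup>2"
      unfolding eq using x wD[of n] by (intro divide_left_mono mult_nonneg_nonneg mult_pos_pos)
        (auto simp: abs_square_le_1 intro: less_le_trans[of 0 "(1 - x)\<^sup>2"])
    also have "\<dots> = (1 + x) * (1 - (cmod (w n))\<^sup>2) / (1 - x)"
      using x by (simp add: power2_eq_square divide_simps) (simp add: algebra_simps)
    also have "\<dots> \<le> 2 * (1 - (cmod (w n))\<^sup>2) / (1 - x)"
      using x wD[of n] by (intro divide_right_mono mult_right_mono) (auto simp: abs_square_le_1)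
    finally show ?thesis using x z2 by (simp add: field_simps x_def[symmetric])
  qed
  have "(\<lambda>n. 1 - 2 / (1 - (cmod z)\<^sup>2) * (1 - (cmod (w n))\<^sup>2)) \<longlonglongrightarrow> 1 - 2 / (1 - (cmod z)\<^sup>2) * (1 - 1\<^sup>2)"
    by (intro tendsto_intros wlim)
  then have lower: "(\<lambda>n. 1 - 2 / (1 - (cmod z)\<^sup>2) * (1 - (cmod (w n))\<^sup>2)) \<longlonglongrightarrow> 1" by simp
  show ?thesis
  proof (rule tendsto_sandwich[OF _ _ lower tendsto_const])
    show "\<forall>\<^sub>F n in sequentially. 1 - 2 / (1 - (cmod z)\<^sup>2) * (1 - (cmod (w n))\<^sup>2) \<le> cmod ((\<phi> ^^ n) z)"
    proof (intro always_eventually allI)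
      show "1 - 2 / (1 - (cmod z)\<^sup>2) * (1 - (cmod (w n))\<^sup>2) \<le> cmod ((\<phi> ^^ n) z)" for n
        using le[of n] by linarith
    qed
    show "\<forall>\<^sub>F n in sequentially. cmod ((\<phi> ^^ n) z) \<le> 1"
      using zD by (intro always_eventually allI less_imp_le)
  qed
qed

section \<open>Rigidity of bounded functions on the disc\<close>

text \<open>Near a point where \<open>g\<close> does not vanish the quotient has constant modulus, so it is constant there by
  the maximum modulus principle, and the identity theorem extends the relation to the disc.\<close>

lemma holomorphic_eq_modulus_imp_multiple:
  assumes f: "f holomorphic_on unit_disc" and g: "g holomorphic_on unit_disc"
    and eq: "\<And>z. z \<in> unit_disc \<Longrightarrow> cmod (f z) = cmod (g z)"
  shows "\<exists>\<gamma>\<in>unit_circle. \<forall>z\<in>unit_disc. f z = \<gamma> * g z"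
proof (cases "\<forall>z\<in>unit_disc. g z = 0")
  case True
  then show ?thesis using eq by (intro bexI[of _ 1]) auto
next
  case False
  then obtain z0 where z0: "z0 \<in> unit_disc" "g z0 \<noteq> 0" by blast
  define U where "U = unit_disc \<inter> g -` (- {0})"
  have opU: "open U"
    unfolding U_def by (rule continuous_open_preimage[OF holomorphic_on_imp_continuous_on[OF g]]) auto
  have z0U: "z0 \<in> U" using z0 by (simp add: U_def)
  obtain e where e: "e > 0" "ball z0 e \<subseteq> U" using opU z0U by (metis open_contains_ball)
  have "(\<lambda>z. f z / g z) constant_on ball z0 e"
  proof (rule maximum_modulus_principle[where U = "ball z0 e" and \<xi> = z0])
    show "(\<lambda>z. f z / g z) holomorphic_on ball z0 e"
      using e f g by (intro holomorphic_intros) (auto simp: U_def intro: holomorphic_on_subset)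
    fix z assume "z \<in> ball z0 e"
    then have "z \<in> U" using e by blast
    then show "cmod (f z / g z) \<le> cmod (f z0 / g z0)"
      using z0 eq by (simp add: norm_divide U_def)
  qed (use e in auto)
  then obtain \<gamma> where \<gamma>: "\<And>z. z \<in> ball z0 e \<Longrightarrow> f z / g z = \<gamma>" unfolding constant_on_def by blast
  have "cmod \<gamma> = 1"
    using \<gamma>[of z0] eq[OF z0(1)] z0 e by (auto simp: norm_divide)
  have "f z = \<gamma> * g z" if "z \<in> unit_disc" for z
  proof (rule analytic_continuation_open[of "ball z0 e" unit_disc f "\<lambda>z. \<gamma> * g z"])
    show "f w = \<gamma> * g w" if "w \<in> ball z0 e" for w
    proof -
      have "w \<in> U" using that e by blast
      then show ?thesis using \<gamma>[OF that] by (auto simp: U_def)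
    qed
    show "ball z0 e \<subseteq> unit_disc" using e by (auto simp: U_def)
  qed (use that e f g in \<open>auto intro!: holomorphic_intros\<close>)
  then show ?thesis using \<open>cmod \<gamma> = 1\<close> by (intro bexI[of _ \<gamma>]) auto
qed

text \<open>This is the Schwarz lemma for \<open>C\<close> composed with the involutions at \<open>a\<close> and at \<open>C a\<close>. It is used
  when \<open>|C a|\<close> is close to 1: then \<open>C\<close> is nearly constant within any fixed pseudo-hyperbolic distance
  of \<open>a\<close>.\<close>

lemma near_constancy:
  assumes C: "C holomorphic_on unit_disc" and bd: "\<And>z. z \<in> unit_disc \<Longrightarrow> cmod (C z) \<le> 1"
    and a: "a \<in> unit_disc" and z: "z \<in> unit_disc"
  shows "(1 - (pseudo_hyperbolic z a)\<^sup>2) * (cmod (C z - C a))\<^sup>2 \<le> 1 - (cmod (C a))\<^sup>2"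
proof -
  have a1: "cmod a < 1" using a by simp
  \<comment> \<open>The Schwarz lemma needs values in the open disc, hence the factor \<open>r < 1\<close>, which tends to 1 in
    the end.\<close>
  define K where "K = (1 - (pseudo_hyperbolic z a)\<^sup>2) * (cmod (C z - C a))\<^sup>2 + (cmod (C a))\<^sup>2"
  have shrink: "r\<^sup>2 * K \<le> 1" if r: "0 < r" "r < 1" for r
  proof -
    define g where "g = (\<lambda>w. of_real r * C (moebius a w))"
    define c where "c = of_real r * C a"
    define w where "w = moebius a z"
    have mD: "moebius a w \<in> unit_disc" if "cmod w < 1" for w
      using cmod_moebius_less_1[OF a1 that] by simp
    have gr: "cmod (g w) < 1" if "cmod w < 1" for w
    proof -
      have "cmod (g w) \<le> r * 1" using bd[OF mD[OF that]] r by (simp add: g_def norm_mult)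
      then show ?thesis using r by linarith
    qed
    have w1: "cmod w < 1" using cmod_moebius_less_1[OF a1, of z] z by (simp add: w_def)
    have g0: "g 0 = c" by (simp add: g_def c_def moebius_def)
    have gw: "g w = of_real r * C z" using moebius_involution[OF a1, of z] z by (simp add: g_def w_def)
    have c1: "cmod c < 1" using gr[of 0] g0 by simp
    have ghol: "g holomorphic_on unit_disc"
    proof -
      have "(C \<circ> moebius a) holomorphic_on unit_disc"
        by (rule holomorphic_on_compose_gen[OF holomorphic_on_moebius[OF a1] C]) (use mD in auto)
      then show ?thesis unfolding g_def o_def by (intro holomorphic_intros)
    qed
    have hhol: "(moebius c \<circ> g) holomorphic_on unit_disc"
      by (rule holomorphic_on_compose_gen[OF ghol holomorphic_on_moebius[OF c1]]) (use gr in auto)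
    have "cmod ((moebius c \<circ> g) w) \<le> cmod w"
    proof (rule Schwarz_Lemma(1)[OF hhol])
      show "(moebius c \<circ> g) 0 = 0" by (simp add: g0 moebius_def)
      show "cmod ((moebius c \<circ> g) w) < 1" if "cmod w < 1" for w
        using cmod_moebius_less_1[OF c1 gr[OF that]] by simp
    qed (rule w1)
    then have S: "cmod (moebius c (g w)) \<le> cmod w" by simp
    define x where "x = g w"
    define m where "m = cmod (moebius c x)"
    have x1: "cmod x < 1" using gr[OF w1] by (simp add: x_def)
    have dn: "1 - cnj c * x \<noteq> 0" using moebius_denom_nonzero[OF c1, of x] x1 by simp
    have id: "1 - m\<^sup>2 = (1 - (cmod c)\<^sup>2) * (1 - (cmod x)\<^sup>2) / (cmod (1 - cnj c * x))\<^sup>2"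
      using moebius_norm_identity[OF c1, of x] x1 by (simp add: m_def)
    have cx: "(cmod (c - x))\<^sup>2 = m\<^sup>2 * (cmod (1 - cnj c * x))\<^sup>2"
      using dn by (simp add: m_def moebius_def norm_divide power_divide)
    have m1: "0 \<le> m" "m < 1" using cmod_moebius_less_1[OF c1 x1] by (auto simp: m_def)
    have "(1 - (cmod w)\<^sup>2) * (cmod (c - x))\<^sup>2 \<le> (1 - m\<^sup>2) * (cmod (c - x))\<^sup>2"
      using S m1 by (intro mult_right_mono) (auto simp: m_def x_def intro!: power_mono)
    also have "\<dots> = m\<^sup>2 * ((1 - (cmod c)\<^sup>2) * (1 - (cmod x)\<^sup>2))"
      unfolding cx id using dn by simp
    also have "\<dots> \<le> 1 * ((1 - (cmod c)\<^sup>2) * 1)"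
      using m1 c1 x1 by (intro mult_mono mult_nonneg_nonneg) (auto simp: abs_square_le_1)
    finally have bound: "(1 - (cmod w)\<^sup>2) * (cmod (c - x))\<^sup>2 + (cmod c)\<^sup>2 \<le> 1" by simp
    have "c - x = of_real r * (C a - C z)" by (simp add: c_def x_def gw algebra_simps)
    then have "(cmod (c - x))\<^sup>2 = r\<^sup>2 * (cmod (C z - C a))\<^sup>2"
      by (simp add: norm_mult power_mult_distrib norm_minus_commute)
    moreover have "(cmod c)\<^sup>2 = r\<^sup>2 * (cmod (C a))\<^sup>2" by (simp add: c_def norm_mult power_mult_distrib)
    moreover have "cmod w = pseudo_hyperbolic z a" by (simp add: w_def pseudo_hyperbolic_moebius)
    ultimately have "r\<^sup>2 * K = (1 - (cmod w)\<^sup>2) * (cmod (c - x))\<^sup>2 + (cmod c)\<^sup>2"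
      by (simp add: K_def algebra_simps)
    then show ?thesis using bound by simp
  qed
  have "K \<le> 1"
  proof (rule ccontr)
    assume "\<not> K \<le> 1"
    then have K: "K > 1" by simp
    define r where "r = sqrt (2 / (1 + K))"
    have "0 < r" "r < 1" using K by (auto simp: r_def real_sqrt_lt_1_iff)
    from shrink[OF this] have "2 / (1 + K) * K \<le> 1" using K by (simp add: r_def)
    then show False using K by (simp add: field_simps)
  qed
  then show ?thesis by (simp add: K_def)
qed

section \<open>Small values of thin Blaschke products\<close>

text \<open>Hoffman's lemma. On the pseudo-hyperbolic circles of radius \<open>\<eta>\<close> about the zeros the product is
  bounded below by \<open>near_constancy\<close>, and outside the discs the minimum modulus principle
  propagates this bound, because a finite Blaschke product is unimodular on the unit circle.\<close>

lemma finite_blaschke_lower_bound: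
  assumes F: "finite F" "\<And>n. n \<in> F \<Longrightarrow> cmod (a n) < 1"
    and \<eta>: "0 < \<eta>" "\<eta> < 1" and \<delta>: "0 \<le> \<delta>" "\<delta> \<le> 1"
    and sep: "\<And>n. n \<in> F \<Longrightarrow> \<delta> \<le> (\<Prod>j\<in>F - {n}. pseudo_hyperbolic (a n) (a j))"
    and m: "m = \<delta> - sqrt ((1 - \<delta>\<^sup>2) / (1 - \<eta>\<^sup>2))" "0 < m"
    and z: "cmod z < 1" "\<And>n. n \<in> F \<Longrightarrow> \<eta> \<le> pseudo_hyperbolic z (a n)"
  shows "\<eta> * m \<le> (\<Prod>n\<in>F. pseudo_hyperbolic z (a n))"
proof -
  define G where "G = (\<lambda>z. \<Prod>n\<in>F. blaschke_factor (a n) z)"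
  have Gn: "cmod (G z) = (\<Prod>n\<in>F. pseudo_hyperbolic z (a n))" for z
    by (simp add: G_def prod_norm[symmetric] cmod_blaschke_factor)
  define S where "S = {z \<in> cball 0 1. \<forall>n\<in>F. \<eta> \<le> cmod (moebius (a n) z)}"
  have \<eta>2: "0 < 1 - \<eta>\<^sup>2" using \<eta> by (simp add: abs_square_less_1)
  have m1: "m \<le> 1"
  proof -
    have "0 \<le> sqrt ((1 - \<delta>\<^sup>2) / (1 - \<eta>\<^sup>2))" 
      using \<eta>2 \<delta> by (intro real_sqrt_ge_zero divide_nonneg_pos) (auto simp: power_le_one)
    then show ?thesis using m(1) \<delta>(2) by linarith
  qed
  have S_eq: "S = cball 0 1 \<inter> (\<Inter>n\<in>F. cball 0 1 \<inter> (\<lambda>z. cmod (moebius (a n) z)) -` {\<eta>..})"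
    by (auto simp: S_def)
  have closedS: "closed S"
    unfolding S_eq
    by (intro closed_Int closed_INT ballI continuous_closed_preimage continuous_intros
        continuous_on_moebius F closed_cball closed_atLeast)
  define V where "V = unit_disc \<inter> (\<Inter>n\<in>F. unit_disc \<inter> (\<lambda>z. cmod (moebius (a n) z)) -` {\<eta><..})"
  have openV: "open V"
    unfolding V_def
    by (intro open_Int open_INT ballI continuous_open_preimage continuous_intros F
        holomorphic_on_imp_continuous_on holomorphic_on_moebius open_ball open_greaterThan)
  have VS: "V \<subseteq> S" by (auto simp: V_def S_def intro: less_imp_le)
  have contG: "continuous_on (cball 0 1) G"
    unfolding G_def blaschke_factor_moebius
    by (intro continuous_intros continuous_on_moebius F)
  have G0: "G z \<noteq> 0" if "z \<in> S" for z
  proof -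
    have "0 < cmod (G z)" unfolding Gn using that \<eta>
      by (intro prod_pos) (force simp: S_def pseudo_hyperbolic_moebius)
    then show ?thesis by auto
  qed
  have intS: "interior S \<subseteq> unit_disc"
  proof -
    have "interior S \<subseteq> interior (cball 0 1)" by (rule interior_mono) (auto simp: S_def)
    then show ?thesis by simp
  qed
  have "cmod (1 / G z) \<le> 1 / (\<eta> * m)"
  proof (rule maximum_modulus_frontier[where S = S and f = "\<lambda>z. 1 / G z"])
    show "(\<lambda>z. 1 / G z) holomorphic_on interior S"
    proof (rule holomorphic_on_divide[OF holomorphic_on_const])
      show "G holomorphic_on interior S"
        unfolding G_def using holomorphic_on_finite_blaschke[of F a] F intS
        by (blast intro: holomorphic_on_subset)
      show "\<And>z. z \<in> interior S \<Longrightarrow> G z \<noteq> 0" using G0 interior_subset by blast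
    qed
    show "continuous_on (closure S) (\<lambda>z. 1 / G z)"
      unfolding closure_closed[OF closedS] using G0
      by (intro continuous_intros continuous_on_subset[OF contG]) (auto simp: S_def)
    show "bounded S" by (rule bounded_subset[OF bounded_cball[of 0 1]]) (auto simp: S_def)
    show "z \<in> S" using z by (simp add: S_def pseudo_hyperbolic_moebius)
    fix w assume "w \<in> frontier S"
    then have w: "w \<in> S" "w \<notin> interior S" using closure_closed[OF closedS] by (auto simp: frontier_def)
    have "\<eta> * m \<le> cmod (G w)"
    proof (cases "cmod w = 1")
      case True
      have "cmod (G w) = 1" unfolding Gn
        using True F by (intro prod.neutral) (simp add: pseudo_hyperbolic_moebius cmod_moebius_eq_1)
      then show ?thesis using \<eta> m m1 mult_le_one[of \<eta> m] by simp
    next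
      case False
      then have wD: "w \<in> unit_disc" using w(1) by (simp add: S_def)
      have "w \<notin> V" using w(2) openV VS interior_maximal by blast
      then have "\<exists>n\<in>F. \<not> \<eta> < cmod (moebius (a n) w)" using wD unfolding V_def by blast
      then obtain n where n: "n \<in> F" "cmod (moebius (a n) w) \<le> \<eta>" by force
      then have pn: "pseudo_hyperbolic w (a n) = \<eta>"
        using w(1) by (auto simp: S_def pseudo_hyperbolic_moebius intro: antisym)
      define C where "C = (\<lambda>z. \<Prod>j\<in>F - {n}. blaschke_factor (a j) z)"
      have Cn: "cmod (C z) = (\<Prod>j\<in>F - {n}. pseudo_hyperbolic z (a j))" for z
        by (simp add: C_def prod_norm[symmetric] cmod_blaschke_factor)
      have an: "a n \<in> unit_disc" using F n by simp
      have Cle: "cmod (C z) \<le> 1" if "z \<in> unit_disc" for z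
        unfolding Cn using that F by (intro finite_blaschke_le_1) auto
      have "(1 - (pseudo_hyperbolic w (a n))\<^sup>2) * (cmod (C w - C (a n)))\<^sup>2 \<le> 1 - (cmod (C (a n)))\<^sup>2"
        by (rule near_constancy[OF _ Cle an wD])
          (use F in \<open>auto simp: C_def intro!: holomorphic_on_finite_blaschke\<close>)
      also have "\<dots> \<le> 1 - \<delta>\<^sup>2"
        using sep[OF n(1)] \<delta> by (simp add: Cn[symmetric] power_mono)
      finally have "(cmod (C w - C (a n)))\<^sup>2 \<le> (1 - \<delta>\<^sup>2) / (1 - \<eta>\<^sup>2)"
        using \<eta>2 by (simp add: pn field_simps)
      then have "cmod (C w - C (a n)) \<le> sqrt ((1 - \<delta>\<^sup>2) / (1 - \<eta>\<^sup>2))" by (rule real_le_rsqrt)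
      moreover have "cmod (C (a n)) - cmod (C w) \<le> cmod (C w - C (a n))"
        by (metis norm_minus_commute norm_triangle_ineq2)
      moreover have "\<delta> \<le> cmod (C (a n))" using sep[OF n(1)] by (simp add: Cn)
      ultimately have "m \<le> cmod (C w)" unfolding m(1) by linarith
      moreover have "cmod (G w) = \<eta> * cmod (C w)"
        unfolding Gn Cn using F(1) n(1) by (simp add: prod.remove pn)
      ultimately show ?thesis using \<eta> by simp
    qed
    then show "cmod (1 / G w) \<le> 1 / (\<eta> * m)"
      using \<eta> m by (simp add: norm_divide frac_le)
  qed
  moreover have "G z \<noteq> 0" using G0 z by (simp add: S_def pseudo_hyperbolic_moebius)
  ultimately have "\<eta> * m \<le> cmod (G z)" using \<eta> m(2) by (simp add: norm_divide field_simps)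
  then show ?thesis by (simp add: Gn)
qed

lemma pseudo_hyperbolic_tendsto_1:
  assumes w: "\<And>k. w k \<in> unit_disc" "(\<lambda>k. cmod (w k)) \<longlonglongrightarrow> 1" and a: "cmod a < 1"
  shows "(\<lambda>k. pseudo_hyperbolic (w k) a) \<longlonglongrightarrow> 1"
proof -
  have w1: "cmod (w k) < 1" for k using w(1)[of k] by simp
  have bound: "1 - (1 - (cmod (w k))\<^sup>2) / (1 - cmod a)\<^sup>2 \<le> (pseudo_hyperbolic (w k) a)\<^sup>2" for k
  proof -
    have "cmod (cnj a * w k) \<le> cmod a" using w1[of k] by (simp add: norm_mult mult_left_le)
    then have "1 - cmod a \<le> cmod (1 - cnj a * w k)"
      using norm_triangle_ineq2[of 1 "cnj a * w k"] by simp
    then have sq: "(1 - cmod a)\<^sup>2 \<le> (cmod (1 - cnj a * w k))\<^sup>2" using a by (intro power_mono) auto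
    have "1 - (pseudo_hyperbolic (w k) a)\<^sup>2 =
        (1 - (cmod (w k))\<^sup>2) * (1 - (cmod a)\<^sup>2) / (cmod (1 - cnj a * w k))\<^sup>2"
      by (rule one_minus_pseudo_hyperbolic_sq[OF w1 a])
    also have "\<dots> \<le> (1 - (cmod (w k))\<^sup>2) * 1 / (1 - cmod a)\<^sup>2"
      using sq a w1[of k] by (intro frac_le mult_left_mono) (auto simp: abs_square_le_1)
    finally show ?thesis by simp
  qed
  have "(\<lambda>k. 1 - (1 - (cmod (w k))\<^sup>2) / (1 - cmod a)\<^sup>2) \<longlonglongrightarrow> 1 - (1 - 1\<^sup>2) / (1 - cmod a)\<^sup>2"
    by (intro tendsto_intros w) (use a in auto)
  then have lower: "(\<lambda>k. 1 - (1 - (cmod (w k))\<^sup>2) / (1 - cmod a)\<^sup>2) \<longlonglongrightarrow> 1" by simp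
  have "(\<lambda>k. (pseudo_hyperbolic (w k) a)\<^sup>2) \<longlonglongrightarrow> 1"
  proof (rule tendsto_sandwich[OF _ _ lower tendsto_const])
    show "\<forall>\<^sub>F k in sequentially. 1 - (1 - (cmod (w k))\<^sup>2) / (1 - cmod a)\<^sup>2 \<le> (pseudo_hyperbolic (w k) a)\<^sup>2"
      by (intro always_eventually allI bound)
    show "\<forall>\<^sub>F k in sequentially. (pseudo_hyperbolic (w k) a)\<^sup>2 \<le> 1"
      using pseudo_hyperbolic_less_1[OF w1 a] by (intro always_eventually allI power_le_one) (auto intro: less_imp_le)
  qed
  then have "(\<lambda>k. sqrt ((pseudo_hyperbolic (w k) a)\<^sup>2)) \<longlonglongrightarrow> sqrt 1" by (rule tendsto_real_sqrt)
  then show ?thesis by simp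
qed

definition thin_sequence :: "(nat \<Rightarrow> complex) \<Rightarrow> bool" where
  "thin_sequence a \<longleftrightarrow> blaschke_sequence UNIV a \<and> inj a \<and>
    (\<lambda>k. cmod (blaschke_product (- {k}) a (a k))) \<longlonglongrightarrow> 1"

text \<open>The product of the pseudo-hyperbolic distances from \<open>a\<^sub>k\<close> to the other zeros is the modulus at \<open>a\<^sub>k\<close>
  of the Blaschke product without the factor of \<open>a\<^sub>k\<close>.\<close>

lemma thin_blaschke_product_altdef:
  "thin_blaschke_product B \<longleftrightarrow> (\<exists>a. thin_sequence a \<and>
    (\<exists>c\<in>unit_circle. B = (\<lambda>z. if z \<in> unit_disc then c * blaschke_product UNIV a z else 0)))"
proof -
  have "(\<Prod>n. if n = k then 1 else pseudo_hyperbolic (a n) (a k)) = cmod (blaschke_product (- {k}) a (a k))"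
    if "blaschke_sequence UNIV a" for a k
  proof -
    have "blaschke_sequence (- {k}) a" by (rule blaschke_sequence_subset[OF that]) simp
    moreover have "a k \<in> unit_disc" using that by (simp add: blaschke_sequence_def)
    ultimately have "(\<Prod>n. if n \<in> - {k} then pseudo_hyperbolic (a k) (a n) else 1) =
        cmod (blaschke_product (- {k}) a (a k))" by (rule prodinf_pseudo_hyperbolic)
    moreover have "(\<lambda>n. if n \<in> - {k} then pseudo_hyperbolic (a k) (a n) else 1) =
        (\<lambda>n. if n = k then 1 else pseudo_hyperbolic (a n) (a k))"
      by (auto simp: pseudo_hyperbolic_commute)
    ultimately show ?thesis by simp
  qed
  then show ?thesis
    unfolding thin_blaschke_product_def thin_sequence_def blaschke_with_zeros_altdef
    by (auto cong: conj_cong)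
qed

text \<open>The radius \<open>\<eta>\<close> depends on \<open>\<epsilon>\<close> only, while finitely many zeros may be discarded: the product over them
  tends to 1 at the boundary. The rest is uniformly as separated as desired, because the sequence is
  thin, so \<open>finite_blaschke_lower_bound\<close> applies to its finite parts.\<close>

lemma thin_small_value_near_zero:
  assumes thin: "thin_sequence a"
    and w: "\<And>k. w k \<in> unit_disc" "(\<lambda>k. cmod (w k)) \<longlonglongrightarrow> 1" and \<epsilon>: "0 \<le> \<epsilon>" "\<epsilon> < 1"
  shows "\<exists>\<eta>>0. \<eta> < 1 \<and> (\<forall>N. \<forall>\<^sub>F k in sequentially.
    cmod (blaschke_product UNIV a (w k)) \<le> \<epsilon> \<longrightarrow> (\<exists>n\<ge>N. pseudo_hyperbolic (w k) (a n) < \<eta>))"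
proof -
  have bs: "blaschke_sequence UNIV a" using thin by (simp add: thin_sequence_def)
  have a1: "cmod (a n) < 1" for n using bs by (simp add: blaschke_sequence_def)
  have w1: "cmod (w k) < 1" for k using w(1)[of k] by simp
  \<comment> \<open>Any \<open>\<eta>\<close> between \<open>\<epsilon>\<close> and 1 will do, since the lower bound \<open>\<eta> * m \<delta>\<close> tends to \<open>\<eta>\<close> as \<open>\<delta>\<close> tends to 1.\<close>
  define \<eta> where "\<eta> = (1 + \<epsilon>) / 2"
  have \<eta>: "0 < \<eta>" "\<eta> < 1" "\<epsilon> < \<eta>" using \<epsilon> by (auto simp: \<eta>_def)
  have \<eta>2: "0 < 1 - \<eta>\<^sup>2" using \<eta> by (simp add: abs_square_less_1)
  define m where "m \<delta> = \<delta> - sqrt ((1 - \<delta>\<^sup>2) / (1 - \<eta>\<^sup>2))" for \<delta>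
  obtain \<delta> where \<delta>: "0 \<le> \<delta>" "\<delta> < 1" "\<epsilon> < \<eta> * m \<delta>"
  proof -
    have "(\<lambda>j. 1 - 1 / real (Suc j)) \<longlonglongrightarrow> 1 - 0"
      by (intro tendsto_intros lim_1_over_n[THEN LIMSEQ_Suc])
    then have "(\<lambda>j. \<eta> * m (1 - 1 / real (Suc j))) \<longlonglongrightarrow> \<eta> * (1 - sqrt ((1 - 1\<^sup>2) / (1 - \<eta>\<^sup>2)))"
      unfolding m_def using \<eta>2 by (intro tendsto_intros) auto
    then have "\<forall>\<^sub>F j in sequentially. \<epsilon> < \<eta> * m (1 - 1 / real (Suc j))"
      by (rule order_tendstoD(1)) (use \<eta> in simp)
    then obtain j where "\<epsilon> < \<eta> * m (1 - 1 / real (Suc j))"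
      unfolding eventually_sequentially by blast
    then show thesis by (intro that[of "1 - 1 / real (Suc j)"]) (auto simp: field_simps)
  qed
  have m0: "0 < m \<delta>"
  proof -
    have "0 < \<eta> * m \<delta>" using \<delta>(3) \<epsilon>(1) by linarith
    then show ?thesis using \<eta>(1) by (simp add: zero_less_mult_iff)
  qed
  have "(\<lambda>k. cmod (blaschke_product (- {k}) a (a k))) \<longlonglongrightarrow> 1" using thin by (simp add: thin_sequence_def)
  then have "\<forall>\<^sub>F k in sequentially. \<delta> < cmod (blaschke_product (- {k}) a (a k))"
    by (rule order_tendstoD(1)) (rule \<delta>(2))
  then obtain N0 where N0: "\<And>n. n \<ge> N0 \<Longrightarrow> \<delta> < cmod (blaschke_product (- {n}) a (a n))"
    unfolding eventually_sequentially by blast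
  have "\<forall>\<^sub>F k in sequentially. cmod (blaschke_product UNIV a (w k)) \<le> \<epsilon> \<longrightarrow>
      (\<exists>n\<ge>N. pseudo_hyperbolic (w k) (a n) < \<eta>)" for N
  proof -
    define N1 where "N1 = max N N0"
    have "(\<lambda>k. (\<Prod>n<N1. pseudo_hyperbolic (w k) (a n)) * (\<eta> * m \<delta>)) \<longlonglongrightarrow> (\<Prod>n<N1. 1) * (\<eta> * m \<delta>)"
      by (intro tendsto_intros pseudo_hyperbolic_tendsto_1 w a1)
    then have "\<forall>\<^sub>F k in sequentially. \<epsilon> < (\<Prod>n<N1. pseudo_hyperbolic (w k) (a n)) * (\<eta> * m \<delta>)"
      by (rule order_tendstoD(1)) (use \<delta> in simp)
    then show ?thesis
    proof (rule eventually_mono, intro impI)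
      fix k
      assume big: "\<epsilon> < (\<Prod>n<N1. pseudo_hyperbolic (w k) (a n)) * (\<eta> * m \<delta>)"
        and small: "cmod (blaschke_product UNIV a (w k)) \<le> \<epsilon>"
      show "\<exists>n\<ge>N. pseudo_hyperbolic (w k) (a n) < \<eta>"
      proof (rule ccontr)
        assume "\<not> ?thesis"
        then have far: "\<eta> \<le> pseudo_hyperbolic (w k) (a n)" if "n \<ge> N" for n using that by force
        have tail: "\<eta> * m \<delta> \<le> (\<Prod>n\<in>{N1..<M}. pseudo_hyperbolic (w k) (a n))" for M
        proof (rule finite_blaschke_lower_bound[OF _ _ \<eta>(1,2) \<delta>(1)])
          show "\<delta> \<le> (\<Prod>j\<in>{N1..<M} - {n}. pseudo_hyperbolic (a n) (a j))" if "n \<in> {N1..<M}" for n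
          proof -
            have "\<delta> < cmod (blaschke_product (- {n}) a (a n))" using that by (intro N0) (auto simp: N1_def)
            also have "\<dots> \<le> (\<Prod>j\<in>{N1..<M} - {n}. pseudo_hyperbolic (a n) (a j))"
              using a1 by (intro cmod_blaschke_product_le_finite blaschke_sequence_subset[OF bs]) auto
            finally show ?thesis by simp
          qed
          show "m \<delta> = \<delta> - sqrt ((1 - \<delta>\<^sup>2) / (1 - \<eta>\<^sup>2))" by (rule m_def)
        qed (use a1 w1 \<delta> m0 far in \<open>auto simp: N1_def\<close>)
        have "(\<Prod>n<N1. pseudo_hyperbolic (w k) (a n)) * (\<eta> * m \<delta>) \<le> cmod (blaschke_product UNIV a (w k))"
        proof (rule LIMSEQ_le_const[OF cmod_blaschke_product_LIMSEQ[OF bs w(1)]], intro exI allI impI)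
          fix M assume M: "M \<ge> N1"
          have "(\<Prod>n<N1. pseudo_hyperbolic (w k) (a n)) * (\<eta> * m \<delta>) \<le>
              (\<Prod>n<N1. pseudo_hyperbolic (w k) (a n)) * (\<Prod>n\<in>{N1..<M}. pseudo_hyperbolic (w k) (a n))"
            by (intro mult_left_mono tail prod_nonneg) auto
          also have "\<dots> = (\<Prod>n<M. pseudo_hyperbolic (w k) (a n))"
            using prod.atLeastLessThan_concat[of 0 N1 M "\<lambda>n. pseudo_hyperbolic (w k) (a n)"] M
            by (simp add: atLeast0LessThan)
          finally show "(\<Prod>n<N1. pseudo_hyperbolic (w k) (a n)) * (\<eta> * m \<delta>) \<le>
              (\<Prod>n\<in>UNIV \<inter> {..<M}. pseudo_hyperbolic (w k) (a n))" by simp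
        qed
        then show False using big small by linarith
      qed
    qed
  qed
  then show ?thesis using \<eta> by blast
qed

text \<open>If the limit is unimodular at \<open>0\<close>, then it is constant by \<open>near_constancy\<close>. Otherwise the image
  of \<open>0\<close> stays near zeros \<open>a (n N)\<close> with \<open>n N\<close> tending to infinity; around such a zero the product is
  one Blaschke factor times a function that is nearly a unimodular constant. The preimages \<open>x N\<close> of
  these zeros stay in a compact part of the disc, and \<open>\<alpha>\<close> is a limit point of them.\<close>

lemma thin_limit_classification:
  assumes thin: "thin_sequence a"
    and \<psi>: "\<And>k. disc_automorphism (\<psi> k)" "(\<lambda>k. cmod (\<psi> k 0)) \<longlonglongrightarrow> 1"
    and g: "g holomorphic_on unit_disc"
    and lim: "\<And>z. z \<in> unit_disc \<Longrightarrow> (\<lambda>k. blaschke_product UNIV a (\<psi> k z)) \<longlonglongrightarrow> g z"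
  shows "(\<exists>\<gamma>\<in>unit_circle. \<forall>z\<in>unit_disc. g z = \<gamma>) \<or>
    (\<exists>\<alpha>\<in>unit_disc. (\<forall>z\<in>unit_disc. cmod (g z) = pseudo_hyperbolic z \<alpha>) \<and>
      (\<exists>k n x. (\<forall>N. k N \<ge> N \<and> n N \<ge> N \<and> x N \<in> unit_disc \<and> \<psi> (k N) (x N) = a (n N)) \<and> x \<longlonglongrightarrow> \<alpha>))"
proof -
  have bs: "blaschke_sequence UNIV a" using thin by (simp add: thin_sequence_def)
  have a1: "a n \<in> unit_disc" for n using bs by (simp add: blaschke_sequence_def)
  have D: "\<psi> k z \<in> unit_disc" if "z \<in> unit_disc" for k z by (rule disc_automorphism_in_disc[OF \<psi>(1) that])
  have g1: "cmod (g z) \<le> 1" if "z \<in> unit_disc" for z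
    by (rule LIMSEQ_le_const2[OF tendsto_norm[OF lim[OF that]]])
      (use cmod_blaschke_product_le_1[OF bs D[OF that]] in blast)
  show ?thesis
  proof (cases "cmod (g 0) = 1")
    case True
    have const: "g z = g 0" if z: "z \<in> unit_disc" for z
    proof -
      have "(1 - (cmod z)\<^sup>2) * (cmod (g z - g 0))\<^sup>2 \<le> 0"
        using near_constancy[OF g g1, of 0 z] z True by simp
      moreover have "0 < 1 - (cmod z)\<^sup>2" using z by (simp add: abs_square_less_1)
      ultimately show ?thesis by (simp add: mult_le_0_iff)
    qed
    show ?thesis
    proof (intro disjI1 bexI[of _ "g 0"] ballI)
      show "g 0 \<in> unit_circle" using True by simp
    qed (rule const)
  next
    case False
    then have g0: "cmod (g 0) < 1" using g1[of 0] by simp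
    define \<epsilon> where "\<epsilon> = (1 + cmod (g 0)) / 2"
    have \<epsilon>: "0 \<le> \<epsilon>" "\<epsilon> < 1" "cmod (g 0) < \<epsilon>" using g0 by (auto simp: \<epsilon>_def add_nonneg_nonneg)
    have "\<forall>\<^sub>F k in sequentially. cmod (blaschke_product UNIV a (\<psi> k 0)) < \<epsilon>"
      by (rule order_tendstoD(2)[OF tendsto_norm[OF lim] \<epsilon>(3)]) simp
    then have small: "\<forall>\<^sub>F k in sequentially. cmod (blaschke_product UNIV a (\<psi> k 0)) \<le> \<epsilon>"
      by (rule eventually_mono) simp
    obtain \<eta> where \<eta>: "0 < \<eta>" "\<eta> < 1"
      and near: "\<And>N. \<forall>\<^sub>F k in sequentially. cmod (blaschke_product UNIV a (\<psi> k 0)) \<le> \<epsilon> \<longrightarrow>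
        (\<exists>n\<ge>N. pseudo_hyperbolic (\<psi> k 0) (a n) < \<eta>)"
    proof -
      have "\<psi> k 0 \<in> unit_disc" for k by (rule D) simp
      from thin_small_value_near_zero[OF thin this \<psi>(2) \<epsilon>(1,2)] show thesis
        using that by meson
    qed
    have "\<exists>k n y. k \<ge> N \<and> n \<ge> N \<and> y \<in> unit_disc \<and> \<psi> k y = a n \<and> cmod y < \<eta>" for N
    proof -
      have "\<forall>\<^sub>F k in sequentially. k \<ge> N \<and> (\<exists>n\<ge>N. pseudo_hyperbolic (\<psi> k 0) (a n) < \<eta>)"
        using near[of N] small eventually_ge_at_top[of N] by eventually_elim blast
      then obtain k n where kn: "k \<ge> N" "n \<ge> N" "pseudo_hyperbolic (\<psi> k 0) (a n) < \<eta>"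
        unfolding eventually_sequentially by blast
      have "a n \<in> \<psi> k ` unit_disc" using \<psi>(1)[of k] a1[of n] by (simp add: disc_automorphism_def bij_betw_def)
      then obtain y where y: "y \<in> unit_disc" "\<psi> k y = a n" by (metis imageE)
      have "cmod y = pseudo_hyperbolic (\<psi> k y) (\<psi> k 0)"
        using disc_automorphism_isometry[OF \<psi>(1) y(1), of 0 k] by simp
      then have "cmod y < \<eta>" using kn(3) y(2) by (simp add: pseudo_hyperbolic_commute)
      then show ?thesis using kn y by blast
    qed
    then obtain kk nn y where y: "\<And>N. kk N \<ge> N" "\<And>N. nn N \<ge> N" "\<And>N. y N \<in> unit_disc"
      "\<And>N. \<psi> (kk N) (y N) = a (nn N)" "\<And>N. cmod (y N) < \<eta>" by metis
    have "\<forall>N. y N \<in> cball 0 \<eta>" using y(5) by (simp add: less_imp_le)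
    then obtain \<alpha> r where \<alpha>: "\<alpha> \<in> cball 0 \<eta>" "strict_mono (r :: nat \<Rightarrow> nat)" "(y \<circ> r) \<longlonglongrightarrow> \<alpha>"
      using compact_cball[of "0::complex" \<eta>] unfolding compact_eq_seq_compact_metric seq_compact_def by blast
    define k where "k = kk \<circ> r"
    define n where "n = nn \<circ> r"
    define x where "x = y \<circ> r"
    have rge: "r N \<ge> N" for N using \<alpha>(2) by (simp add: seq_suble)
    have kN: "k N \<ge> N" for N using order_trans[OF rge y(1)] by (simp add: k_def)
    have nN: "n N \<ge> N" for N using order_trans[OF rge y(2)] by (simp add: n_def)
    have xD: "x N \<in> unit_disc" for N using y(3) by (simp add: x_def)
    have ax: "\<psi> (k N) (x N) = a (n N)" for N by (simp add: k_def n_def x_def y(4))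
    have \<alpha>D: "\<alpha> \<in> unit_disc" using \<alpha>(1) \<eta> by simp
    have xlim: "x \<longlonglongrightarrow> \<alpha>" using \<alpha>(3) by (simp add: x_def)
    have kinf: "filterlim k at_top sequentially"
      by (rule filterlim_at_top_mono[OF filterlim_ident]) (simp add: kN)
    have ninf: "filterlim n at_top sequentially"
      by (rule filterlim_at_top_mono[OF filterlim_ident]) (simp add: nN)
    have "cmod (g z) = pseudo_hyperbolic z \<alpha>" if z: "z \<in> unit_disc" for z
    proof (rule LIMSEQ_unique)
      define P where "P N = cmod (blaschke_product (- {n N}) a (a (n N)))" for N
      define Q where "Q N = cmod (blaschke_product (- {n N}) a (\<psi> (k N) z))" for N
      have Plim: "P \<longlonglongrightarrow> 1"
        using filterlim_compose[OF _ ninf] thin unfolding P_def thin_sequence_def by auto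
      have \<rho>lim: "(\<lambda>N. pseudo_hyperbolic z (x N)) \<longlonglongrightarrow> pseudo_hyperbolic z \<alpha>"
        unfolding pseudo_hyperbolic_def using moebius_denom_nonzero[of \<alpha> z] \<alpha>D z
        by (intro tendsto_intros xlim) auto
      have \<rho>1: "pseudo_hyperbolic z (x N) < 1" for N using z xD[of N] by (simp add: pseudo_hyperbolic_less_1)
      have \<rho>\<alpha>: "(pseudo_hyperbolic z \<alpha>)\<^sup>2 < 1" using z \<alpha>D by (simp add: pseudo_hyperbolic_less_1 abs_square_less_1)
      have Qest: "\<bar>Q N - P N\<bar> \<le> sqrt ((1 - (P N)\<^sup>2) / (1 - (pseudo_hyperbolic z (x N))\<^sup>2))" for N
      proof -
        have bsn: "blaschke_sequence (- {n N}) a" by (rule blaschke_sequence_subset[OF bs]) simp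
        have "(1 - (pseudo_hyperbolic (\<psi> (k N) z) (a (n N)))\<^sup>2) *
            (cmod (blaschke_product (- {n N}) a (\<psi> (k N) z) - blaschke_product (- {n N}) a (a (n N))))\<^sup>2
            \<le> 1 - (P N)\<^sup>2"
          unfolding P_def
          by (rule near_constancy[OF holomorphic_on_blaschke_product[OF bsn] cmod_blaschke_product_le_1[OF bsn] a1 D[OF z]])
        moreover have "pseudo_hyperbolic (\<psi> (k N) z) (a (n N)) = pseudo_hyperbolic z (x N)"
          using disc_automorphism_isometry[OF \<psi>(1) z xD, of "k N" N] by (simp add: ax)
        moreover have "0 < 1 - (pseudo_hyperbolic z (x N))\<^sup>2" using \<rho>1[of N] by (simp add: abs_square_less_1)
        ultimately have "(cmod (blaschke_product (- {n N}) a (\<psi> (k N) z) - blaschke_product (- {n N}) a (a (n N))))\<^sup>2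
            \<le> (1 - (P N)\<^sup>2) / (1 - (pseudo_hyperbolic z (x N))\<^sup>2)"
          by (simp add: field_simps)
        then have "cmod (blaschke_product (- {n N}) a (\<psi> (k N) z) - blaschke_product (- {n N}) a (a (n N)))
            \<le> sqrt ((1 - (P N)\<^sup>2) / (1 - (pseudo_hyperbolic z (x N))\<^sup>2))" by (rule real_le_rsqrt)
        then show ?thesis unfolding Q_def P_def using norm_triangle_ineq3 order_trans by blast
      qed
      have "(\<lambda>N. sqrt ((1 - (P N)\<^sup>2) / (1 - (pseudo_hyperbolic z (x N))\<^sup>2)))
          \<longlonglongrightarrow> sqrt ((1 - 1\<^sup>2) / (1 - (pseudo_hyperbolic z \<alpha>)\<^sup>2))"
        using \<rho>\<alpha> by (intro tendsto_intros Plim \<rho>lim) auto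
      then have "(\<lambda>N. sqrt ((1 - (P N)\<^sup>2) / (1 - (pseudo_hyperbolic z (x N))\<^sup>2))) \<longlonglongrightarrow> 0" by simp
      then have "(\<lambda>N. Q N - P N) \<longlonglongrightarrow> 0"
        by (rule Lim_null_comparison[rotated]) (use Qest in \<open>simp add: always_eventually\<close>)
      from tendsto_add[OF this Plim] have "Q \<longlonglongrightarrow> 1" by simp
      from tendsto_mult[OF \<rho>lim this]
      have "(\<lambda>N. pseudo_hyperbolic z (x N) * Q N) \<longlonglongrightarrow> pseudo_hyperbolic z \<alpha>" by simp
      moreover have "pseudo_hyperbolic z (x N) * Q N = cmod (blaschke_product UNIV a (\<psi> (k N) z))" for N
      proof -
        have "blaschke_product UNIV a (\<psi> (k N) z) =
            blaschke_factor (a (n N)) (\<psi> (k N) z) * blaschke_product (UNIV - {n N}) a (\<psi> (k N) z)"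
          by (rule blaschke_product_remove[OF bs D[OF z]]) simp
        moreover have "pseudo_hyperbolic (\<psi> (k N) z) (a (n N)) = pseudo_hyperbolic z (x N)"
          using disc_automorphism_isometry[OF \<psi>(1) z xD, of "k N" N] by (simp add: ax)
        ultimately show ?thesis
          by (simp add: Q_def norm_mult cmod_blaschke_factor Compl_eq_Diff_UNIV)
      qed
      ultimately show "(\<lambda>N. cmod (blaschke_product UNIV a (\<psi> (k N) z))) \<longlonglongrightarrow> pseudo_hyperbolic z \<alpha>" by simp
      show "(\<lambda>N. cmod (blaschke_product UNIV a (\<psi> (k N) z))) \<longlonglongrightarrow> cmod (g z)"
        using filterlim_compose[OF tendsto_norm[OF lim[OF z]] kinf] .
    qed
    then show ?thesis using \<alpha>D kN nN xD ax xlim by blast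
  qed
qed

section \<open>The limit set of a thin Blaschke product and its orthogonal complement\<close>

definition disc_restrict :: "(complex \<Rightarrow> complex) \<Rightarrow> complex \<Rightarrow> complex" where
  "disc_restrict f z = (if z \<in> unit_disc then f z else 0)"

lemma taylor_coeff_disc_restrict: "taylor_coeff (disc_restrict f) n = taylor_coeff f n"
  by (rule taylor_coeff_cong) (simp add: disc_restrict_def)

lemma holomorphic_on_disc_restrict: "f holomorphic_on unit_disc \<Longrightarrow> disc_restrict f holomorphic_on unit_disc"
  by (rule holomorphic_transform) (auto simp: disc_restrict_def)

lemma taylor_coeff_const: "taylor_coeff (\<lambda>_. c) n = (if n = 0 then c else 0)"
proof (rule taylor_coeff_unique)
  fix z :: complex
  have "(\<lambda>n. if n = 0 then c else 0) sums c" using sums_single[of 0 "\<lambda>_. c"] by simp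
  moreover have "(\<lambda>n. (if n = 0 then c else 0) * z ^ n) = (\<lambda>n. if n = 0 then c else 0)" by auto
  ultimately show "(\<lambda>n. (if n = 0 then c else 0) * z ^ n) sums c" by simp
qed

lemma taylor_coeff_moebius:
  assumes \<alpha>: "cmod \<alpha> < 1"
  shows "taylor_coeff (moebius \<alpha>) n =
    (case n of 0 \<Rightarrow> \<alpha> | Suc k \<Rightarrow> - of_real (1 - (cmod \<alpha>)\<^sup>2) * cnj \<alpha> ^ k)"
proof (rule taylor_coeff_unique)
  fix z :: complex assume z: "z \<in> unit_disc"
  let ?d = "complex_of_real (1 - (cmod \<alpha>)\<^sup>2)"
  let ?a = "\<lambda>n. case n of 0 \<Rightarrow> \<alpha> | Suc k \<Rightarrow> - ?d * cnj \<alpha> ^ k"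
  have dn: "1 - cnj \<alpha> * z \<noteq> 0" using moebius_denom_nonzero[OF \<alpha>, of z] z by simp
  have lt: "cmod (cnj \<alpha> * z) < 1" using \<alpha> z norm_mult_less[of "cnj \<alpha>" 1 z 1] by simp
  have "(\<lambda>k. (- ?d * z) * (cnj \<alpha> * z) ^ k) sums ((- ?d * z) * (1 / (1 - cnj \<alpha> * z)))"
    by (intro sums_mult geometric_sums lt)
  then have "(\<lambda>k. ?a (Suc k) * z ^ Suc k) sums ((- ?d * z) * (1 / (1 - cnj \<alpha> * z)))"
    by (simp add: power_mult_distrib mult_ac)
  from sums_Suc[OF this] have "(\<lambda>k. ?a k * z ^ k) sums ((- ?d * z) * (1 / (1 - cnj \<alpha> * z)) + \<alpha>)" by simp
  moreover have "(- ?d * z) * (1 / (1 - cnj \<alpha> * z)) + \<alpha> = moebius \<alpha> z"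
  proof -
    have "?d = 1 - \<alpha> * cnj \<alpha>" by (simp only: of_real_diff of_real_1 complex_norm_square)
    then show ?thesis using dn by (simp add: moebius_def field_simps)
  qed
  ultimately show "(\<lambda>k. ?a k * z ^ k) sums moebius \<alpha> z" by simp
qed

lemma H2_disc_restrict_const: "disc_restrict (\<lambda>_. c) \<in> H2"
proof (rule H2I_bounded_sums(1)[where M = "(cmod c)\<^sup>2"])
  show "disc_restrict (\<lambda>_. c) holomorphic_on unit_disc"
    by (intro holomorphic_on_disc_restrict holomorphic_intros)
  show "disc_restrict (\<lambda>_. c) z = 0" if "z \<notin> unit_disc" for z using that by (simp add: disc_restrict_def)
  fix N
  have "(\<Sum>n<N. (cmod (taylor_coeff (disc_restrict (\<lambda>_. c)) n))\<^sup>2) = (\<Sum>n<N. if n = 0 then (cmod c)\<^sup>2 else 0)"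
    by (intro sum.cong) (auto simp: taylor_coeff_disc_restrict taylor_coeff_const)
  also have "\<dots> \<le> (cmod c)\<^sup>2" by simp
  finally show "(\<Sum>n<N. (cmod (taylor_coeff (disc_restrict (\<lambda>_. c)) n))\<^sup>2) \<le> (cmod c)\<^sup>2" .
qed

lemma H2_disc_restrict_moebius:
  assumes \<alpha>: "cmod \<alpha> < 1"
  shows "disc_restrict (\<lambda>z. \<gamma> * moebius \<alpha> z) \<in> H2"
proof -
  define k where "k = (if \<alpha> = 0 then - 1 else of_real (cmod \<alpha>) / \<alpha>)"
  have "k \<noteq> 0" by (simp add: k_def)
  then have "disc_restrict (\<lambda>z. \<gamma> * moebius \<alpha> z) =
      (\<lambda>z. (\<gamma> / k) * (blaschke_factor \<alpha> z * disc_restrict (\<lambda>_. 1) z))"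
    by (auto simp: disc_restrict_def blaschke_factor_moebius k_def[symmetric])
  then show ?thesis
    by (simp only:) (intro H2_cmult H2_mult_blaschke_factor(1) \<alpha> H2_disc_restrict_const)
qed

lemma H2_split_constant:
  assumes f: "f \<in> H2"
  shows "\<exists>h\<in>H2. f = (\<lambda>z. disc_restrict (\<lambda>_. f 0) z + z * h z)"
proof -
  define k where "k = (\<lambda>z. f z - disc_restrict (\<lambda>_. f 0) z)"
  have k: "k \<in> H2" unfolding k_def by (intro H2_diff f H2_disc_restrict_const)
  have k0: "k 0 = 0" by (simp add: k_def disc_restrict_def)
  have "\<exists>h\<in>H2. k = (\<lambda>z. blaschke_factor 0 z * h z)"
  proof (rule H2_divide_blaschke_factor[OF _ k k0])
    fix h assume "h \<in> H2" "k = (\<lambda>z. blaschke_factor 0 z * h z)"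
    then show ?thesis by (intro bexI[of _ h])
  qed simp
  then obtain h where h: "h \<in> H2" "k = (\<lambda>z. z * h z)" by (auto simp: blaschke_factor_def)
  have "f z = disc_restrict (\<lambda>_. f 0) z + z * h z" for z
    using fun_cong[OF h(2), of z] by (simp add: k_def algebra_simps)
  from ext[of f, OF this] h(1) show ?thesis by (rule bexI)
qed

lemma H2_inner_const:
  assumes "f \<in> H2"
  shows "H2_inner f (disc_restrict (\<lambda>_. \<gamma>)) = cnj \<gamma> * f 0"
proof -
  have "(\<lambda>n. taylor_coeff f n * cnj (taylor_coeff (disc_restrict (\<lambda>_. \<gamma>)) n)) =
      (\<lambda>n. if n = 0 then f 0 * cnj \<gamma> else 0)"
    by (auto simp: taylor_coeff_disc_restrict taylor_coeff_const taylor_coeff_0)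
  moreover have "(\<lambda>n::nat. if n = 0 then f 0 * cnj \<gamma> else 0) sums (f 0 * cnj \<gamma>)"
    using sums_single[of 0 "\<lambda>_. f 0 * cnj \<gamma>"] by simp
  ultimately show ?thesis by (simp add: H2_inner_def sums_iff mult.commute)
qed

text \<open>A disc involution is an affine function of a reproducing kernel, so pairing \<open>f(0) + z h\<close> with it
  evaluates \<open>h\<close> at its zero.\<close>

lemma H2_inner_moebius:
  assumes \<alpha>: "\<alpha> \<in> unit_disc" and f: "f \<in> H2" and h: "h \<in> H2"
    and split: "f = (\<lambda>z. disc_restrict (\<lambda>_. f 0) z + z * h z)"
  shows "H2_inner f (disc_restrict (\<lambda>z. \<gamma> * moebius \<alpha> z)) =
    cnj \<gamma> * (f 0 * cnj \<alpha> - of_real (1 - (cmod \<alpha>)\<^sup>2) * h \<alpha>)"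
proof -
  let ?d = "complex_of_real (1 - (cmod \<alpha>)\<^sup>2)"
  let ?t = "\<lambda>n. taylor_coeff f n * cnj (taylor_coeff (disc_restrict (\<lambda>z. \<gamma> * moebius \<alpha> z)) n)"
  have \<alpha>1: "cmod \<alpha> < 1" using \<alpha> by simp
  have gc: "taylor_coeff (disc_restrict (\<lambda>z. \<gamma> * moebius \<alpha> z)) n =
      \<gamma> * (case n of 0 \<Rightarrow> \<alpha> | Suc k \<Rightarrow> - ?d * cnj \<alpha> ^ k)" for n
    by (simp add: taylor_coeff_disc_restrict taylor_coeff_cmult holomorphic_on_moebius[OF \<alpha>1]
        taylor_coeff_moebius[OF \<alpha>1])
  have fc: "taylor_coeff f (Suc n) = taylor_coeff h n" for n
  proof -
    have "taylor_coeff f (Suc n) = taylor_coeff (\<lambda>z. disc_restrict (\<lambda>_. f 0) z + z * h z) (Suc n)"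
      by (simp only: split[symmetric])
    also have "\<dots> = taylor_coeff (disc_restrict (\<lambda>_. f 0)) (Suc n) + taylor_coeff (\<lambda>z. z * h z) (Suc n)"
      by (intro taylor_coeff_add H2_holomorphic H2_disc_restrict_const H2_mult_z h)
    finally show ?thesis
      by (simp add: taylor_coeff_disc_restrict taylor_coeff_const taylor_coeff_mult_z H2_holomorphic[OF h])
  qed
  have "(\<lambda>n. (- cnj \<gamma> * ?d) * (taylor_coeff h n * \<alpha> ^ n)) sums ((- cnj \<gamma> * ?d) * h \<alpha>)"
    by (intro sums_mult sums_taylor_coeff H2_holomorphic h \<alpha>)
  moreover have "?t (Suc n) = (- cnj \<gamma> * ?d) * (taylor_coeff h n * \<alpha> ^ n)" for n
    by (simp add: gc fc algebra_simps)
  ultimately have "(\<lambda>n. ?t (Suc n)) sums ((- cnj \<gamma> * ?d) * h \<alpha>)" by simp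
  from sums_Suc[OF this] have "?t sums ((- cnj \<gamma> * ?d) * h \<alpha> + f 0 * cnj (\<gamma> * \<alpha>))"
    by (simp add: gc taylor_coeff_0) (simp add: disc_restrict_def moebius_def)
  then show ?thesis by (simp add: H2_inner_def sums_iff algebra_simps)
qed

subsection \<open>Existence and invariance of limits\<close>

lemma L_setI:
  assumes "g \<in> Hinf" "strict_mono n"
    "\<And>K. compact K \<Longrightarrow> K \<subseteq> unit_disc \<Longrightarrow> uniform_limit K (\<lambda>k z. f ((\<phi> ^^ n k) z)) g sequentially"
  shows "g \<in> L_set \<phi> f"
  using assms by (auto simp: L_set_def o_def)

lemma L_setD:
  assumes "g \<in> L_set \<phi> f"
  shows "g \<in> Hinf"
    "\<exists>n. strict_mono n \<and> (\<forall>K. compact K \<longrightarrow> K \<subseteq> unit_disc \<longrightarrow>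
      uniform_limit K (\<lambda>k z. f ((\<phi> ^^ n k) z)) g sequentially)"
  using assms by (auto simp: L_set_def o_def)

text \<open>The iterates may be taken along any prescribed increasing sequence of times: with all times this
  makes the limit set nonempty, and with selected times it produces limits with prescribed zeros.\<close>

lemma L_set_montel:
  assumes \<phi>: "disc_automorphism \<phi>" and B: "B holomorphic_on unit_disc"
    and bd: "\<And>z. z \<in> unit_disc \<Longrightarrow> cmod (B z) \<le> 1" and m: "strict_mono (m :: nat \<Rightarrow> nat)"
  shows "\<exists>g\<in>L_set \<phi> B. \<exists>r. strict_mono (r :: nat \<Rightarrow> nat) \<and>
    (\<forall>z\<in>unit_disc. (\<lambda>k. B ((\<phi> ^^ m (r k)) z)) \<longlonglongrightarrow> g z)"
proof -
  define F where "F k = B \<circ> (\<phi> ^^ m k)" for k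
  have aut: "disc_automorphism (\<phi> ^^ k)" for k by (rule disc_automorphism_funpow[OF \<phi>])
  have D: "(\<phi> ^^ k) z \<in> unit_disc" if "z \<in> unit_disc" for k z by (rule disc_automorphism_in_disc[OF aut that])
  have Fhol: "F k holomorphic_on unit_disc" for k
    unfolding F_def using aut[of "m k"] D
    by (intro holomorphic_on_compose_gen[OF _ B]) (auto simp: disc_automorphism_def)
  have Fbd: "cmod (F k z) \<le> 1" if "z \<in> unit_disc" for k z using bd[OF D[OF that]] by (simp add: F_def)
  obtain g r where g: "g holomorphic_on unit_disc" and r: "strict_mono (r :: nat \<Rightarrow> nat)"
    and lim: "\<And>z. z \<in> unit_disc \<Longrightarrow> (\<lambda>k. F (r k) z) \<longlonglongrightarrow> g z"
    and ulim: "\<And>K. compact K \<Longrightarrow> K \<subseteq> unit_disc \<Longrightarrow> uniform_limit K (F \<circ> r) g sequentially"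
  proof (rule Montel[of unit_disc "range F" F])
    show "h holomorphic_on unit_disc" if "h \<in> range F" for h using that Fhol by auto
    show "\<exists>B. \<forall>h\<in>range F. \<forall>z\<in>K. cmod (h z) \<le> B" if "K \<subseteq> unit_disc" for K
      using that Fbd by (intro exI[of _ 1]) blast
  qed auto
  have g1: "cmod (g z) \<le> 1" if "z \<in> unit_disc" for z
    by (rule LIMSEQ_le_const2[OF tendsto_norm[OF lim[OF that]]]) (use Fbd[OF that] in blast)
  have "disc_restrict g \<in> L_set \<phi> B"
  proof (rule L_setI)
    have "bounded (disc_restrict g ` unit_disc)"
      unfolding bounded_iff using g1 by (intro exI[of _ 1]) (auto simp: disc_restrict_def)
    then show "disc_restrict g \<in> Hinf"
      by (simp add: Hinf_def hol_disc_def holomorphic_on_disc_restrict[OF g]) (simp add: disc_restrict_def)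
    show "strict_mono (m \<circ> r)" using m r by (simp add: strict_mono_o)
    fix K :: "complex set" assume K: "compact K" "K \<subseteq> unit_disc"
    have "uniform_limit K (\<lambda>k z. B ((\<phi> ^^ (m \<circ> r) k) z)) g sequentially"
      using ulim[OF K] by (simp add: F_def o_def)
    then show "uniform_limit K (\<lambda>k z. B ((\<phi> ^^ (m \<circ> r) k) z)) (disc_restrict g) sequentially"
      by (subst (asm) uniform_limit_cong'[where g = "\<lambda>k z. B ((\<phi> ^^ (m \<circ> r) k) z)" and i = "disc_restrict g"])
        (use K in \<open>auto simp: disc_restrict_def\<close>)
  qed
  moreover have "(\<lambda>k. B ((\<phi> ^^ m (r k)) z)) \<longlonglongrightarrow> disc_restrict g z" if "z \<in> unit_disc" for z
    using lim[OF that] that by (simp add: F_def disc_restrict_def)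
  ultimately show ?thesis using r by blast
qed

text \<open>With \<open>\<tau> = \<phi>\<close> or its inverse the shift of indices is \<open>n k + 1\<close> or \<open>n (k + 1) - 1\<close>; the offset \<open>j\<close>
  makes \<open>n\<close> positive in the latter case.\<close>

lemma L_set_compose:
  assumes g: "g \<in> L_set \<phi> B" and \<tau>: "disc_automorphism \<tau>"
    and shift: "\<And>n. strict_mono (n :: nat \<Rightarrow> nat) \<Longrightarrow> \<exists>n' j. strict_mono (n' :: nat \<Rightarrow> nat) \<and>
      (\<forall>k. \<forall>z\<in>unit_disc. (\<phi> ^^ n' k) z = (\<phi> ^^ n (k + j)) (\<tau> z))"
  shows "disc_restrict (\<lambda>z. g (\<tau> z)) \<in> L_set \<phi> B"
proof -
  obtain n where n: "strict_mono n" and lim: "\<And>K. compact K \<Longrightarrow> K \<subseteq> unit_disc \<Longrightarrow>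
      uniform_limit K (\<lambda>k z. B ((\<phi> ^^ n k) z)) g sequentially"
    using L_setD(2)[OF g] by blast
  obtain n' j where n': "strict_mono n'" "\<And>k z. z \<in> unit_disc \<Longrightarrow> (\<phi> ^^ n' k) z = (\<phi> ^^ n (k + j)) (\<tau> z)"
    using shift[OF n] by blast
  have \<tau>hol: "\<tau> holomorphic_on unit_disc" and \<tau>D: "\<tau> ` unit_disc \<subseteq> unit_disc"
    using \<tau> by (auto simp: disc_automorphism_def bij_betw_def)
  have ghol: "g holomorphic_on unit_disc" and gbd: "bounded (g ` unit_disc)"
    using L_setD(1)[OF g] by (auto simp: Hinf_def hol_disc_def)
  show ?thesis
  proof (rule L_setI[OF _ n'(1)])
    have "(g \<circ> \<tau>) holomorphic_on unit_disc" by (rule holomorphic_on_compose_gen[OF \<tau>hol ghol \<tau>D])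
    then have "disc_restrict (\<lambda>z. g (\<tau> z)) holomorphic_on unit_disc"
      by (intro holomorphic_on_disc_restrict) (simp add: o_def)
    moreover have "bounded (disc_restrict (\<lambda>z. g (\<tau> z)) ` unit_disc)"
      by (rule bounded_subset[OF gbd]) (use \<tau>D in \<open>auto simp: disc_restrict_def\<close>)
    ultimately show "disc_restrict (\<lambda>z. g (\<tau> z)) \<in> Hinf"
      by (simp add: Hinf_def hol_disc_def) (simp add: disc_restrict_def)
    fix K :: "complex set" assume K: "compact K" "K \<subseteq> unit_disc"
    have "compact (\<tau> ` K)"
      by (intro compact_continuous_image K continuous_on_subset[OF holomorphic_on_imp_continuous_on[OF \<tau>hol]])
    moreover have "\<tau> ` K \<subseteq> unit_disc" using K \<tau>D by blast
    ultimately have ul: "uniform_limit (\<tau> ` K) (\<lambda>k z. B ((\<phi> ^^ n k) z)) g sequentially" by (rule lim)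
    show "uniform_limit K (\<lambda>k z. B ((\<phi> ^^ n' k) z)) (disc_restrict (\<lambda>z. g (\<tau> z))) sequentially"
    proof (rule uniform_limitI)
      fix e :: real assume "e > 0"
      from uniform_limitD[OF ul this] obtain M where
        M: "\<And>k w. k \<ge> M \<Longrightarrow> w \<in> \<tau> ` K \<Longrightarrow> dist (B ((\<phi> ^^ n k) w)) (g w) < e"
        unfolding eventually_sequentially by blast
      have "dist (B ((\<phi> ^^ n' k) z)) (disc_restrict (\<lambda>z. g (\<tau> z)) z) < e" if "k \<ge> M" "z \<in> K" for k z
      proof -
        have "z \<in> unit_disc" using that K by blast
        then show ?thesis using M[of "k + j" "\<tau> z"] that n'(2)[of z k] by (simp add: disc_restrict_def)
      qed
      then show "\<forall>\<^sub>F k in sequentially. \<forall>z\<in>K. dist (B ((\<phi> ^^ n' k) z)) (disc_restrict (\<lambda>z. g (\<tau> z)) z) < e"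
        unfolding eventually_sequentially by blast
    qed
  qed
qed

definition limit_zeros :: "(complex \<Rightarrow> complex) \<Rightarrow> (complex \<Rightarrow> complex) \<Rightarrow> complex set" where
  "limit_zeros \<phi> B = {\<alpha> \<in> unit_disc. \<exists>g\<in>L_set \<phi> B. g \<alpha> = 0}"

lemma limit_zeros_image_subset:
  assumes \<phi>: "disc_automorphism \<phi>"
  shows "\<phi> ` limit_zeros \<phi> B \<subseteq> limit_zeros \<phi> B"
    and "\<alpha> \<in> unit_disc \<Longrightarrow> \<phi> \<alpha> \<in> limit_zeros \<phi> B \<Longrightarrow> \<alpha> \<in> limit_zeros \<phi> B"
proof -
  obtain \<psi> where \<psi>: "disc_automorphism \<psi>" "\<And>z. z \<in> unit_disc \<Longrightarrow> \<psi> (\<phi> z) = z"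
    "\<And>z. z \<in> unit_disc \<Longrightarrow> \<phi> (\<psi> z) = z" using disc_automorphism_inverse[OF \<phi>] by auto
  show "\<phi> ` limit_zeros \<phi> B \<subseteq> limit_zeros \<phi> B"
  proof (rule image_subsetI)
    fix \<alpha> assume "\<alpha> \<in> limit_zeros \<phi> B"
    then obtain g where g: "\<alpha> \<in> unit_disc" "g \<in> L_set \<phi> B" "g \<alpha> = 0" by (auto simp: limit_zeros_def)
    have "disc_restrict (\<lambda>z. g (\<psi> z)) \<in> L_set \<phi> B"
    proof (rule L_set_compose[OF g(2) \<psi>(1)])
      fix n :: "nat \<Rightarrow> nat" assume n: "strict_mono n"
      have pos: "n (k + 1) > 0" for k using strict_monoD[OF n, of 0 "k + 1"] by simp
      have "strict_mono (\<lambda>k. n (k + 1) - 1)"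
        by (rule strict_monoI) (use strict_monoD[OF n] pos in \<open>simp add: diff_less_mono Suc_leI\<close>)
      moreover have "(\<phi> ^^ (n (k + 1) - 1)) z = (\<phi> ^^ n (k + 1)) (\<psi> z)" if "z \<in> unit_disc" for k z
      proof -
        obtain i where i: "n (k + 1) = Suc i" using pos[of k] gr0_implies_Suc by blast
        show ?thesis unfolding i using \<psi>(3)[OF that] by (simp only: funpow_Suc_right o_apply diff_Suc_1)
      qed
      ultimately show "\<exists>n' j. strict_mono (n' :: nat \<Rightarrow> nat) \<and>
          (\<forall>k. \<forall>z\<in>unit_disc. (\<phi> ^^ n' k) z = (\<phi> ^^ n (k + j)) (\<psi> z))"
        by (intro exI[of _ "\<lambda>k. n (k + 1) - 1"] exI[of _ 1]) simp
    qed
    moreover have "\<phi> \<alpha> \<in> unit_disc" by (rule disc_automorphism_in_disc[OF \<phi> g(1)])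
    moreover have "disc_restrict (\<lambda>z. g (\<psi> z)) (\<phi> \<alpha>) = 0"
      using g \<psi>(2)[OF g(1)] by (simp add: disc_restrict_def)
    ultimately show "\<phi> \<alpha> \<in> limit_zeros \<phi> B" by (auto simp: limit_zeros_def)
  qed
  assume \<alpha>: "\<alpha> \<in> unit_disc" "\<phi> \<alpha> \<in> limit_zeros \<phi> B"
  then obtain g where g: "g \<in> L_set \<phi> B" "g (\<phi> \<alpha>) = 0" by (auto simp: limit_zeros_def)
  have "disc_restrict (\<lambda>z. g (\<phi> z)) \<in> L_set \<phi> B"
  proof (rule L_set_compose[OF g(1) \<phi>])
    fix n :: "nat \<Rightarrow> nat" assume n: "strict_mono n"
    then have "strict_mono (\<lambda>k. Suc (n k))" by (simp add: strict_mono_def)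
    then show "\<exists>n' j. strict_mono (n' :: nat \<Rightarrow> nat) \<and>
        (\<forall>k. \<forall>z\<in>unit_disc. (\<phi> ^^ n' k) z = (\<phi> ^^ n (k + j)) (\<phi> z))"
      by (intro exI[of _ "\<lambda>k. Suc (n k)"] exI[of _ 0]) (simp add: funpow_swap1)
  qed
  moreover have "disc_restrict (\<lambda>z. g (\<phi> z)) \<alpha> = 0" using g \<alpha> by (simp add: disc_restrict_def)
  ultimately show "\<alpha> \<in> limit_zeros \<phi> B" using \<alpha>(1) by (auto simp: limit_zeros_def)
qed

subsection \<open>Orthogonal complement of the limit set\<close>

lemma L_set_thin_cases:
  assumes \<phi>: "disc_automorphism \<phi>" and \<zeta>: "\<zeta> \<in> unit_circle" "(\<lambda>n. (\<phi> ^^ n) 0) \<longlonglongrightarrow> \<zeta>"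
    and a: "thin_sequence a" and c: "c \<in> unit_circle"
    and B: "\<forall>z\<in>unit_disc. B z = c * blaschke_product UNIV a z"
    and g: "g \<in> L_set \<phi> B"
  shows "(\<exists>\<gamma>\<in>unit_circle. g = disc_restrict (\<lambda>_. \<gamma>)) \<or>
    (\<exists>\<alpha>\<in>unit_disc. \<exists>\<gamma>\<in>unit_circle. g = disc_restrict (\<lambda>z. \<gamma> * moebius \<alpha> z) \<and>
      (\<exists>k n x. (\<forall>N. k N \<ge> N \<and> n N \<ge> N \<and> x N \<in> unit_disc \<and> (\<phi> ^^ k N) (x N) = a (n N)) \<and> x \<longlonglongrightarrow> \<alpha>))"
proof -
  obtain n where n: "strict_mono n" and lim: "\<And>K. compact K \<Longrightarrow> K \<subseteq> unit_disc \<Longrightarrow>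
      uniform_limit K (\<lambda>k z. B ((\<phi> ^^ n k) z)) g sequentially"
    using L_setD(2)[OF g] by blast
  have ghol: "g holomorphic_on unit_disc" and goff: "\<And>z. z \<notin> unit_disc \<Longrightarrow> g z = 0"
    using L_setD(1)[OF g] by (auto simp: Hinf_def hol_disc_def)
  have c0: "c \<noteq> 0" and c1: "cmod c = 1" using c by auto
  define h where "h = (\<lambda>z. inverse c * g z)"
  have hhol: "h holomorphic_on unit_disc" unfolding h_def by (intro holomorphic_intros ghol)
  have aut: "disc_automorphism (\<phi> ^^ k)" for k by (rule disc_automorphism_funpow[OF \<phi>])
  have w1: "(\<lambda>k. cmod ((\<phi> ^^ n k) 0)) \<longlonglongrightarrow> 1"
    using LIMSEQ_subseq_LIMSEQ[OF tendsto_norm[OF \<zeta>(2)] n] \<zeta>(1) by (simp add: o_def)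
  have hlim: "(\<lambda>k. blaschke_product UNIV a ((\<phi> ^^ n k) z)) \<longlonglongrightarrow> h z" if z: "z \<in> unit_disc" for z
  proof -
    have "(\<lambda>k. B ((\<phi> ^^ n k) z)) \<longlonglongrightarrow> g z"
      using lim[of "{z}"] z by (auto intro: tendsto_uniform_limitI)
    then have "(\<lambda>k. inverse c * B ((\<phi> ^^ n k) z)) \<longlonglongrightarrow> h z" unfolding h_def by (intro tendsto_intros)
    moreover have "inverse c * B ((\<phi> ^^ n k) z) = blaschke_product UNIV a ((\<phi> ^^ n k) z)" for k
      using c0 bspec[OF B disc_automorphism_in_disc[OF aut z]] by simp
    ultimately show ?thesis by simp
  qed
  consider (const) "\<exists>\<gamma>\<in>unit_circle. \<forall>z\<in>unit_disc. h z = \<gamma>"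
    | (moeb) "\<exists>\<alpha>\<in>unit_disc. (\<forall>z\<in>unit_disc. cmod (h z) = pseudo_hyperbolic z \<alpha>) \<and>
      (\<exists>k m x. (\<forall>N. k N \<ge> N \<and> m N \<ge> N \<and> x N \<in> unit_disc \<and> (\<phi> ^^ n (k N)) (x N) = a (m N)) \<and> x \<longlonglongrightarrow> \<alpha>)"
    using thin_limit_classification[OF a aut w1 hhol hlim] by blast
  then show ?thesis
  proof cases
    case const
    then obtain \<gamma> where \<gamma>: "\<gamma> \<in> unit_circle" "\<And>z. z \<in> unit_disc \<Longrightarrow> h z = \<gamma>" by blast
    have "g z = disc_restrict (\<lambda>_. c * \<gamma>) z" for z
    proof (cases "z \<in> unit_disc")
      case True
      have "g z = c * h z" using c0 by (simp add: h_def)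
      then show ?thesis using \<gamma>(2)[OF True] True by (simp add: disc_restrict_def)
    next
      case False
      then show ?thesis using goff by (simp add: disc_restrict_def)
    qed
    then show ?thesis using \<gamma>(1) c1 by (intro disjI1 bexI[of _ "c * \<gamma>"]) (auto simp: norm_mult)
  next
    case moeb
    then obtain \<alpha> k m x where \<alpha>: "\<alpha> \<in> unit_disc" "\<And>z. z \<in> unit_disc \<Longrightarrow> cmod (h z) = pseudo_hyperbolic z \<alpha>"
      and x: "\<And>N. k N \<ge> N \<and> m N \<ge> N \<and> x N \<in> unit_disc \<and> (\<phi> ^^ n (k N)) (x N) = a (m N)" "x \<longlonglongrightarrow> \<alpha>"
      by blast
    have "\<exists>\<gamma>\<in>unit_circle. \<forall>z\<in>unit_disc. g z = \<gamma> * moebius \<alpha> z"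
    proof (rule holomorphic_eq_modulus_imp_multiple[OF ghol holomorphic_on_moebius])
      show "cmod \<alpha> < 1" using \<alpha> by simp
      show "cmod (g z) = cmod (moebius \<alpha> z)" if "z \<in> unit_disc" for z
        using \<alpha>(2)[OF that] c1 by (simp add: h_def norm_mult norm_inverse pseudo_hyperbolic_moebius)
    qed
    then obtain \<gamma> where \<gamma>: "\<gamma> \<in> unit_circle" "\<And>z. z \<in> unit_disc \<Longrightarrow> g z = \<gamma> * moebius \<alpha> z" by blast
    have "g = disc_restrict (\<lambda>z. \<gamma> * moebius \<alpha> z)"
      using \<gamma>(2) goff by (intro ext) (simp add: disc_restrict_def)
    moreover have "n (k N) \<ge> N" for N using order_trans[OF conjunct1[OF x(1)] seq_suble[OF n]] .
    then have "\<forall>N. (n \<circ> k) N \<ge> N \<and> m N \<ge> N \<and> x N \<in> unit_disc \<and> (\<phi> ^^ (n \<circ> k) N) (x N) = a (m N)"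
      using x(1) by (simp add: o_def)
    ultimately show ?thesis using \<alpha>(1) \<gamma>(1) x(2) by blast
  qed
qed

text \<open>A limit that vanishes at \<open>\<alpha>\<close> is not constant, so it is a multiple of the involution at \<open>\<alpha>\<close>. The
  approximating points \<open>x N\<close>, which suitable iterates carry to zeros of \<open>B\<close>, are what locates \<open>\<alpha>\<close> when
  the zeros of \<open>B\<close> are prescribed.\<close>

lemma limit_zeros_member:
  assumes "disc_automorphism \<phi>" "\<zeta> \<in> unit_circle" "(\<lambda>n. (\<phi> ^^ n) 0) \<longlonglongrightarrow> \<zeta>"
    and "thin_sequence a" "c \<in> unit_circle"
    and "\<forall>z\<in>unit_disc. B z = c * blaschke_product UNIV a z"
    and \<alpha>: "\<alpha> \<in> limit_zeros \<phi> B"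
  shows "\<exists>\<gamma>\<in>unit_circle. disc_restrict (\<lambda>z. \<gamma> * moebius \<alpha> z) \<in> L_set \<phi> B \<and>
    (\<exists>k n x. (\<forall>N. k N \<ge> N \<and> n N \<ge> N \<and> x N \<in> unit_disc \<and> (\<phi> ^^ k N) (x N) = a (n N)) \<and> x \<longlonglongrightarrow> \<alpha>)"
proof -
  obtain g where g: "\<alpha> \<in> unit_disc" "g \<in> L_set \<phi> B" "g \<alpha> = 0" using \<alpha> by (auto simp: limit_zeros_def)
  have "\<not> (\<exists>\<gamma>\<in>unit_circle. g = disc_restrict (\<lambda>_. \<gamma>))" using g(1,3) by (auto simp: disc_restrict_def)
  then obtain \<beta> \<gamma> where \<beta>: "\<beta> \<in> unit_disc" "\<gamma> \<in> unit_circle" "g = disc_restrict (\<lambda>z. \<gamma> * moebius \<beta> z)"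
    "\<exists>k n x. (\<forall>N. k N \<ge> N \<and> n N \<ge> N \<and> x N \<in> unit_disc \<and> (\<phi> ^^ k N) (x N) = a (n N)) \<and> x \<longlonglongrightarrow> \<beta>"
    using L_set_thin_cases[OF assms(1-6) g(2)] by blast
  have "\<gamma> * moebius \<beta> \<alpha> = 0" using g(1,3) \<beta>(3) by (simp add: disc_restrict_def)
  then have "\<beta> = \<alpha>" using \<beta>(1,2) g(1) moebius_eq_0_iff[of \<beta> \<alpha>] by auto
  then show ?thesis using \<beta> g(2) by blast
qed

text \<open>The constants lie in the closed span. If no limit is constant, then some limit vanishes at a point
  \<open>\<alpha>\<close>, hence other limits vanish at the points \<open>(\<phi> ^^ n) \<alpha>\<close>; these tend to the circle, where the
  disc involutions approach constants.\<close>

lemma H2_orth_L_set: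
  assumes \<phi>: "disc_automorphism \<phi>" and \<zeta>: "\<zeta> \<in> unit_circle" "(\<lambda>n. (\<phi> ^^ n) 0) \<longlonglongrightarrow> \<zeta>"
    and a: "thin_sequence a" and c: "c \<in> unit_circle"
    and B: "\<forall>z\<in>unit_disc. B z = c * blaschke_product UNIV a z"
  shows "L_set \<phi> B \<subseteq> H2"
    "H2_orth (L_set \<phi> B) = {\<lambda>z. z * h z | h. h \<in> H2 \<and> (\<forall>\<alpha>\<in>limit_zeros \<phi> B. h \<alpha> = 0)}"
proof -
  note cases = L_set_thin_cases[OF \<phi> \<zeta> a c B]
  note member = limit_zeros_member[OF \<phi> \<zeta> a c B]
  have bs: "blaschke_sequence UNIV a" using a by (simp add: thin_sequence_def)
  show LH: "L_set \<phi> B \<subseteq> H2"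
  proof
    fix g assume "g \<in> L_set \<phi> B"
    from cases[OF this] show "g \<in> H2"
      using H2_disc_restrict_const H2_disc_restrict_moebius by auto
  qed
  have Bhol: "B holomorphic_on unit_disc"
    by (rule holomorphic_transform[of "\<lambda>z. c * blaschke_product UNIV a z"])
      (auto intro!: holomorphic_intros holomorphic_on_blaschke_product[OF bs] simp: B)
  have Bbd: "cmod (B z) \<le> 1" if "z \<in> unit_disc" for z
    using cmod_blaschke_product_le_1[OF bs that] c bspec[OF B that] by (simp add: norm_mult)
  show "H2_orth (L_set \<phi> B) = {\<lambda>z. z * h z | h. h \<in> H2 \<and> (\<forall>\<alpha>\<in>limit_zeros \<phi> B. h \<alpha> = 0)}"
  proof (intro equalityI subsetI)
    fix f assume "f \<in> H2_orth (L_set \<phi> B)"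
    then have f: "f \<in> H2" "\<And>g. g \<in> L_set \<phi> B \<Longrightarrow> H2_inner f g = 0" by (auto simp: H2_orth_def)
    obtain h where h: "h \<in> H2" "f = (\<lambda>z. disc_restrict (\<lambda>_. f 0) z + z * h z)"
      using H2_split_constant[OF f(1)] by blast
    have rel: "f 0 * cnj \<alpha> = of_real (1 - (cmod \<alpha>)\<^sup>2) * h \<alpha>" if \<alpha>: "\<alpha> \<in> limit_zeros \<phi> B" for \<alpha>
    proof -
      obtain \<gamma> where \<gamma>: "\<gamma> \<in> unit_circle" "disc_restrict (\<lambda>z. \<gamma> * moebius \<alpha> z) \<in> L_set \<phi> B"
        using member[OF \<alpha>] by blast
      have "\<alpha> \<in> unit_disc" using \<alpha> by (simp add: limit_zeros_def)
      from H2_inner_moebius[OF this f(1) h, of \<gamma>] f(2)[OF \<gamma>(2)] \<gamma>(1)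
      show ?thesis by auto
    qed
    have f0: "f 0 = 0"
    proof -
      obtain g where g: "g \<in> L_set \<phi> B"
        using L_set_montel[OF \<phi> Bhol Bbd strict_mono_id] by blast
      from cases[OF g] show ?thesis
      proof (elim disjE bexE conjE)
        fix \<gamma> assume "\<gamma> \<in> unit_circle" "g = disc_restrict (\<lambda>_. \<gamma>)"
        then show ?thesis using f(2)[OF g] H2_inner_const[OF f(1), of \<gamma>] by auto
      next
        fix \<alpha> \<gamma> assume \<alpha>: "\<alpha> \<in> unit_disc" "\<gamma> \<in> unit_circle" "g = disc_restrict (\<lambda>z. \<gamma> * moebius \<alpha> z)"
        then have \<alpha>A: "\<alpha> \<in> limit_zeros \<phi> B"
          using g by (auto simp: limit_zeros_def disc_restrict_def moebius_def intro!: bexI[of _ g])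
        have orb: "(\<phi> ^^ n) \<alpha> \<in> limit_zeros \<phi> B" for n
        proof (induction n)
          case (Suc n)
          then show ?case using limit_zeros_image_subset(1)[OF \<phi>, of B] by auto
        qed (use \<alpha>A in simp)
        define t where "t n = cmod ((\<phi> ^^ n) \<alpha>)" for n
        have t1: "t \<longlonglongrightarrow> 1" unfolding t_def by (rule orbit_norm_tends_to_1[OF \<phi> \<zeta> \<alpha>(1)])
        have tle: "cmod (f 0) * t n \<le> H2_norm h * sqrt (1 - (t n)\<^sup>2)" for n
        proof -
          have w: "(\<phi> ^^ n) \<alpha> \<in> unit_disc" using orb[of n] by (simp add: limit_zeros_def)
          then have pos: "0 < 1 - (t n)\<^sup>2" by (simp add: t_def abs_square_less_1)
          have "cmod (f 0) * t n = cmod (of_real (1 - (t n)\<^sup>2) * h ((\<phi> ^^ n) \<alpha>))"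
            using arg_cong[OF rel[OF orb[of n]], of cmod] by (simp add: t_def norm_mult)
          also have "\<dots> = (1 - (t n)\<^sup>2) * cmod (h ((\<phi> ^^ n) \<alpha>))"
            using pos by (simp only: norm_mult norm_of_real abs_of_pos)
          also have "\<dots> \<le> (1 - (t n)\<^sup>2) * (H2_norm h / sqrt (1 - (t n)\<^sup>2))"
            using H2_evaluation_bound[OF h(1) w] pos by (intro mult_left_mono) (auto simp: t_def)
          also have "\<dots> = H2_norm h * sqrt (1 - (t n)\<^sup>2)"
            using pos by (simp add: real_div_sqrt field_simps)
          finally show ?thesis .
        qed
        have "(\<lambda>n. cmod (f 0) * t n) \<longlonglongrightarrow> cmod (f 0) * 1" by (intro tendsto_intros t1)
        moreover have "(\<lambda>n. H2_norm h * sqrt (1 - (t n)\<^sup>2)) \<longlonglongrightarrow> H2_norm h * sqrt (1 - 1\<^sup>2)"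
          by (intro tendsto_intros t1)
        ultimately have "cmod (f 0) * 1 \<le> H2_norm h * sqrt (1 - 1\<^sup>2)"
          by (rule LIMSEQ_le) (use tle in blast)
        then show ?thesis by simp
      qed
    qed
    have "f = (\<lambda>z. z * h z)"
    proof
      fix z
      have "disc_restrict (\<lambda>_. f 0) z = 0" using f0 by (simp add: disc_restrict_def)
      then show "f z = z * h z" using fun_cong[OF h(2), of z] by simp
    qed
    moreover have "h \<alpha> = 0" if \<alpha>: "\<alpha> \<in> limit_zeros \<phi> B" for \<alpha>
    proof -
      have "0 < 1 - (cmod \<alpha>)\<^sup>2" using \<alpha> by (simp add: limit_zeros_def abs_square_less_1)
      then show ?thesis using rel[OF \<alpha>] f0 by (simp del: of_real_diff)
    qed
    ultimately show "f \<in> {\<lambda>z. z * h z | h. h \<in> H2 \<and> (\<forall>\<alpha>\<in>limit_zeros \<phi> B. h \<alpha> = 0)}"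
      using h(1) by blast
  next
    fix f assume "f \<in> {\<lambda>z. z * h z | h. h \<in> H2 \<and> (\<forall>\<alpha>\<in>limit_zeros \<phi> B. h \<alpha> = 0)}"
    then obtain h where h: "h \<in> H2" "f = (\<lambda>z. z * h z)" "\<And>\<alpha>. \<alpha> \<in> limit_zeros \<phi> B \<Longrightarrow> h \<alpha> = 0" by blast
    have f: "f \<in> H2" unfolding h(2) by (rule H2_mult_z[OF h(1)])
    have f0: "f 0 = 0" by (simp add: h(2))
    have split: "f = (\<lambda>z. disc_restrict (\<lambda>_. f 0) z + z * h z)"
      by (simp add: f0 h(2) disc_restrict_def)
    have "H2_inner f g = 0" if g: "g \<in> L_set \<phi> B" for g
      using cases[OF g]
    proof (elim disjE bexE conjE)
      fix \<gamma> assume "\<gamma> \<in> unit_circle" "g = disc_restrict (\<lambda>_. \<gamma>)"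
      then show ?thesis using H2_inner_const[OF f, of \<gamma>] f0 by simp
    next
      fix \<alpha> \<gamma> assume \<alpha>: "\<alpha> \<in> unit_disc" "\<gamma> \<in> unit_circle" "g = disc_restrict (\<lambda>z. \<gamma> * moebius \<alpha> z)"
      then have "\<alpha> \<in> limit_zeros \<phi> B"
        using g by (auto simp: limit_zeros_def disc_restrict_def moebius_def intro!: bexI[of _ g])
      then show ?thesis using H2_inner_moebius[OF \<alpha>(1) f h(1) split, of \<gamma>] \<alpha>(3) f0 h(3) by simp
    qed
    then show "f \<in> H2_orth (L_set \<phi> B)" using f by (simp add: H2_orth_def)
  qed
qed

section \<open>Constructing thin sequences\<close>

text \<open>If \<open>d\<^sub>n = 1 - |a\<^sub>n|\<close> decreases this fast, then \<open>1 - \<rho>(a\<^sub>j, a\<^sub>k) \<le> 4 d\<^sub>k / d\<^sub>j \<le> 4 (1/2)\<^sup>j\<^sup>+\<^sup>k\<close> for \<open>j < k\<close>, and the sum over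
  all \<open>j \<noteq> k\<close> is at most \<open>8 (1/2)\<^sup>k\<close>.\<close>

lemma thin_sequenceI_ratio:
  assumes a1: "\<And>n. cmod (a n) < 1"
    and ratio: "\<And>n. 1 - cmod (a (Suc n)) \<le> (1/4) ^ Suc n * (1 - cmod (a n))"
  shows "thin_sequence a"
proof -
  define d where "d n = 1 - cmod (a n)" for n
  have d0: "0 < d n" "d n \<le> 1" for n using a1 by (auto simp: d_def)
  have dS: "d (Suc n) \<le> (1/4) ^ Suc n * d n" for n using ratio by (simp add: d_def)
  have q1: "(1/4::real) ^ Suc n \<le> 1/4" for n by (simp add: power_le_one)
  have dlt: "d (Suc n) < d n" for n
  proof -
    have "(1/4) ^ Suc n * d n \<le> 1/4 * d n" using q1 d0(1)[of n] by (intro mult_right_mono) auto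
    then show ?thesis using dS[of n] d0(1)[of n] by linarith
  qed
  have dec: "d k < d j" if "j < k" for j k
    using lift_Suc_mono_less[of "\<lambda>n. - d n" j k] dlt that by simp
  have dle: "d k \<le> d j" if "j \<le> k" for j k using dec[of j k] that by (cases "j = k") auto
  have dk: "d k \<le> (1/4) ^ k * d j" if jk: "j < k" for j k
  proof -
    obtain i where i: "k = Suc i" "j \<le> i" using jk by (cases k) auto
    have "d k \<le> (1/4) ^ k * d i" using dS[of i] i by simp
    also have "\<dots> \<le> (1/4) ^ k * d j" using dle[OF i(2)] by (intro mult_left_mono) auto
    finally show ?thesis .
  qed
  have dpow: "d k \<le> (1/4) ^ k" for k
  proof (cases k)
    case (Suc i)
    then have "d k \<le> (1/4) ^ k * d 0" by (intro dk) simp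
    also have "\<dots> \<le> (1/4) ^ k * 1" using d0 by (intro mult_left_mono) auto
    finally show ?thesis by simp
  qed (use d0 in simp)
  have "summable d"
  proof (rule summable_comparison_test'[of "\<lambda>k. (1/4::real) ^ k" 0])
    show "norm (d k) \<le> (1/4) ^ k" for k using d0(1)[of k] dpow[of k] by simp
  qed (simp add: summable_geometric)
  then have "d summable_on UNIV" using d0 by (subst summable_on_UNIV_nonneg_real_iff) (auto intro: less_imp_le)
  then have bs: "blaschke_sequence UNIV a" using a1 by (simp add: blaschke_sequence_def d_def[abs_def])
  have inj: "inj a"
  proof (rule injI, rule ccontr)
    fix j k assume "a j = a k" "j \<noteq> k"
    then have "d j = d k" by (simp add: d_def)
    then show False using dec[of j k] dec[of k j] \<open>j \<noteq> k\<close> by (metis less_irrefl linorder_neqE_nat)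
  qed
  have close: "1 - pseudo_hyperbolic (a j) (a k) \<le> 4 * (1/2) ^ (j + k)" if jk: "j < k" for j k
  proof -
    define p where "p = pseudo_hyperbolic (a j) (a k)"
    have p: "0 \<le> p" "p < 1" using a1 by (auto simp: p_def pseudo_hyperbolic_less_1)
    have "cmod (cnj (a k) * a j) \<le> cmod (a j)" using a1[of k] by (simp add: norm_mult mult_left_le_one_le)
    then have "d j \<le> cmod (1 - cnj (a k) * a j)"
      using norm_triangle_ineq2[of 1 "cnj (a k) * a j"] by (simp add: d_def)
    then have den: "(d j)\<^sup>2 \<le> (cmod (1 - cnj (a k) * a j))\<^sup>2" using d0(1)[of j] by (intro power_mono) auto
    have sq: "1 - (cmod (a n))\<^sup>2 \<le> 2 * d n" "0 \<le> 1 - (cmod (a n))\<^sup>2" for n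
    proof -
      have "1 - (cmod (a n))\<^sup>2 = (1 + cmod (a n)) * d n" by (simp add: d_def power2_eq_square algebra_simps)
      also have "\<dots> \<le> 2 * d n" using a1[of n] d0(1)[of n] by (intro mult_right_mono) auto
      finally show "1 - (cmod (a n))\<^sup>2 \<le> 2 * d n" .
      show "0 \<le> 1 - (cmod (a n))\<^sup>2" using a1[of n] by (simp add: abs_square_le_1)
    qed
    have "1 - p \<le> 1 - p\<^sup>2" using p by (simp add: power2_eq_square mult_left_le)
    also have "\<dots> = (1 - (cmod (a j))\<^sup>2) * (1 - (cmod (a k))\<^sup>2) / (cmod (1 - cnj (a k) * a j))\<^sup>2"
      unfolding p_def by (rule one_minus_pseudo_hyperbolic_sq[OF a1 a1])
    also have "\<dots> \<le> (2 * d j) * (2 * d k) / (d j)\<^sup>2"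
      using den d0(1)[of j] d0(1)[of k] sq by (intro frac_le mult_mono) auto
    also have "\<dots> = 4 * (d k / d j)" using d0(1)[of j] by (simp add: power2_eq_square)
    also have "\<dots> \<le> 4 * (1/4) ^ k" using dk[OF jk] d0(1)[of j] by (simp add: field_simps)
    also have "(1/4::real) ^ k = (1/2) ^ (k + k)" by (simp add: power_add power_mult_distrib[symmetric])
    also have "4 * (1/2::real) ^ (k + k) \<le> 4 * (1/2) ^ (j + k)"
      using jk by (intro mult_left_mono power_decreasing) auto
    finally show ?thesis by (simp add: p_def)
  qed
  have close': "1 - pseudo_hyperbolic (a k) (a j) \<le> 4 * (1/2) ^ k * (1/2) ^ j" if "j \<noteq> k" for j k
    using close[of j k] close[of k j] that
    by (cases j k rule: linorder_cases) (auto simp: power_add pseudo_hyperbolic_commute mult_ac)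
  have lower: "1 - 8 * (1/2) ^ k \<le> cmod (blaschke_product (- {k}) a (a k))" for k
  proof (rule LIMSEQ_le_const)
    show "(\<lambda>N. \<Prod>j\<in>- {k} \<inter> {..<N}. pseudo_hyperbolic (a k) (a j)) \<longlonglongrightarrow>
        cmod (blaschke_product (- {k}) a (a k))"
      using a1 by (intro cmod_blaschke_product_LIMSEQ blaschke_sequence_subset[OF bs]) auto
    show "\<exists>M. \<forall>N\<ge>M. 1 - 8 * (1/2) ^ k \<le> (\<Prod>j\<in>- {k} \<inter> {..<N}. pseudo_hyperbolic (a k) (a j))"
    proof (intro exI allI impI)
      fix N
      let ?F = "- {k} \<inter> {..<N}"
      have "(\<Sum>j\<in>?F. 1 - pseudo_hyperbolic (a k) (a j)) \<le> (\<Sum>j\<in>?F. 4 * (1/2) ^ k * (1/2) ^ j)"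
        by (intro sum_mono close') auto
      also have "\<dots> \<le> (\<Sum>j<N. 4 * (1/2) ^ k * (1/2) ^ j)" by (intro sum_mono2) auto
      also have "\<dots> = 4 * (1/2) ^ k * (\<Sum>j<N. (1/2) ^ j)" by (simp only: sum_distrib_left)
      also have "\<dots> \<le> 4 * (1/2) ^ k * 2"
      proof (rule mult_left_mono)
        have "(\<Sum>j<N. (1/2::real) ^ j) \<le> (\<Sum>j. (1/2) ^ j)" by (intro sum_le_suminf summable_geometric) auto
        also have "\<dots> = 2" by (subst suminf_geometric) auto
        finally show "(\<Sum>j<N. (1/2::real) ^ j) \<le> 2" .
      qed simp
      finally have "1 - 8 * (1/2) ^ k \<le> 1 - (\<Sum>j\<in>?F. 1 - pseudo_hyperbolic (a k) (a j))" by simp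
      also have "\<dots> \<le> (\<Prod>j\<in>?F. 1 - (1 - pseudo_hyperbolic (a k) (a j)))"
        using pseudo_hyperbolic_less_1[OF a1 a1] by (intro Weierstrass_prod_ineq) (auto intro: less_imp_le)
      finally show "1 - 8 * (1/2) ^ k \<le> (\<Prod>j\<in>?F. pseudo_hyperbolic (a k) (a j))" by simp
    qed
  qed
  have "(\<lambda>k. 1 - 8 * (1/2) ^ k) \<longlonglongrightarrow> 1 - 8 * (0::real)"
    by (intro tendsto_intros LIMSEQ_realpow_zero) auto
  then have lim: "(\<lambda>k. 1 - 8 * (1/2::real) ^ k) \<longlonglongrightarrow> 1" by simp
  have "(\<lambda>k. cmod (blaschke_product (- {k}) a (a k))) \<longlonglongrightarrow> 1"
  proof (rule tendsto_sandwich[OF _ _ lim tendsto_const])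
    show "\<forall>\<^sub>F k in sequentially. 1 - 8 * (1/2) ^ k \<le> cmod (blaschke_product (- {k}) a (a k))"
      by (intro always_eventually allI lower)
    show "\<forall>\<^sub>F k in sequentially. cmod (blaschke_product (- {k}) a (a k)) \<le> 1"
      using a1 by (intro always_eventually allI cmod_blaschke_product_le_1 blaschke_sequence_subset[OF bs]) auto
  qed
  then show ?thesis using bs inj by (simp add: thin_sequence_def)
qed

lemma thin_sequence_selection:
  fixes u :: "nat \<Rightarrow> nat \<Rightarrow> complex"
  assumes u1: "\<And>n m. cmod (u n m) < 1" and lim: "\<And>n. (\<lambda>m. cmod (u n m)) \<longlonglongrightarrow> 1"
  shows "\<exists>m. strict_mono m \<and> thin_sequence (\<lambda>n. u n (m n))"
proof -
  have "\<exists>y. True \<and> x < y \<and> 1 - cmod (u (Suc n) y) \<le> (1/4) ^ Suc n * (1 - cmod (u n x))" for n x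
  proof -
    define e where "e = (1/4) ^ Suc n * (1 - cmod (u n x))"
    have "e > 0" using u1[of n x] by (simp add: e_def)
    then have "\<forall>\<^sub>F y in sequentially. 1 - e < cmod (u (Suc n) y)"
      by (intro order_tendstoD(1)[OF lim]) simp
    then have "\<forall>\<^sub>F y in sequentially. x < y \<and> 1 - e < cmod (u (Suc n) y)"
      using eventually_gt_at_top[of x] by eventually_elim simp
    then obtain y where "x < y" "1 - e < cmod (u (Suc n) y)" unfolding eventually_sequentially by blast
    then have "x < y" "1 - cmod (u (Suc n) y) \<le> e" by linarith+
    then show ?thesis unfolding e_def by blast
  qed
  then obtain m where m: "\<And>n. m n < m (Suc n)"
    "\<And>n. 1 - cmod (u (Suc n) (m (Suc n))) \<le> (1/4) ^ Suc n * (1 - cmod (u n (m n)))"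
    using dependent_nat_choice[of "\<lambda>_ _. True" "\<lambda>n x y. x < y \<and>
      1 - cmod (u (Suc n) y) \<le> (1/4) ^ Suc n * (1 - cmod (u n x))"] by metis
  then show ?thesis
    using thin_sequenceI_ratio[of "\<lambda>n. u n (m n)"] u1 by (auto simp: strict_mono_Suc_iff)
qed

definition thin_product :: "(nat \<Rightarrow> complex) \<Rightarrow> complex \<Rightarrow> complex" where
  "thin_product a = disc_restrict (blaschke_product UNIV a)"

lemma thin_blaschke_product_thin_product: "thin_sequence a \<Longrightarrow> thin_blaschke_product (thin_product a)"
  unfolding thin_blaschke_product_altdef thin_product_def disc_restrict_def
  by (intro exI[of _ a] conjI bexI[of _ 1]) auto

lemma thin_product_disc: "\<forall>z\<in>unit_disc. thin_product a z = 1 * blaschke_product UNIV a z"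
  by (simp add: thin_product_def disc_restrict_def)

text \<open>Push the points of a countable set forward along the orbits of \<open>\<phi>\<close>, each of them infinitely often
  and far enough each time. Pulling back along the times used for one point produces a limit vanishing
  at that point.\<close>

lemma thin_product_with_prescribed_limit_zeros:
  assumes \<phi>: "disc_automorphism \<phi>" and \<zeta>: "\<zeta> \<in> unit_circle" "(\<lambda>n. (\<phi> ^^ n) 0) \<longlonglongrightarrow> \<zeta>"
    and A: "A \<subseteq> unit_disc" "A \<noteq> {}" "countable A"
  shows "\<exists>a. thin_sequence a \<and> (\<forall>k. \<exists>m. \<exists>\<beta>\<in>A. a k = (\<phi> ^^ m) \<beta>) \<and> A \<subseteq> limit_zeros \<phi> (thin_product a)"
proof -
  define \<beta> where "\<beta> k = from_nat_into A (fst (prod_decode k))" for k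
  have \<beta>A: "\<beta> k \<in> A" for k using from_nat_into[OF A(2)] by (simp add: \<beta>_def)
  have \<beta>D: "\<beta> k \<in> unit_disc" for k using \<beta>A A(1) by blast
  have aut: "disc_automorphism (\<phi> ^^ k)" for k by (rule disc_automorphism_funpow[OF \<phi>])
  have "\<exists>m. strict_mono m \<and> thin_sequence (\<lambda>n. (\<phi> ^^ m n) (\<beta> n))"
  proof (rule thin_sequence_selection[of "\<lambda>n m. (\<phi> ^^ m) (\<beta> n)"])
    show "cmod ((\<phi> ^^ m) (\<beta> n)) < 1" for n m using disc_automorphism_in_disc[OF aut \<beta>D] by simp
    show "(\<lambda>m. cmod ((\<phi> ^^ m) (\<beta> n))) \<longlonglongrightarrow> 1" for n by (rule orbit_norm_tends_to_1[OF \<phi> \<zeta> \<beta>D])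
  qed
  then obtain m where m: "strict_mono m" "thin_sequence (\<lambda>n. (\<phi> ^^ m n) (\<beta> n))" by blast
  define a where "a n = (\<phi> ^^ m n) (\<beta> n)" for n
  have thin: "thin_sequence a" using m(2) by (simp add: a_def[abs_def])
  have bs: "blaschke_sequence UNIV a" using thin by (simp add: thin_sequence_def)
  have "\<alpha> \<in> limit_zeros \<phi> (thin_product a)" if \<alpha>: "\<alpha> \<in> A" for \<alpha>
  proof -
    have \<alpha>D: "\<alpha> \<in> unit_disc" using \<alpha> A(1) by blast
    obtain i where i: "from_nat_into A i = \<alpha>" using from_nat_into_surj[OF A(3) \<alpha>] by blast
    define k where "k j = prod_encode (i, j)" for j
    have "strict_mono k" by (simp add: strict_mono_Suc_iff k_def prod_encode_def)
    then have mk: "strict_mono (m \<circ> k)" using m(1) by (simp add: strict_mono_o)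
    have \<beta>k: "\<beta> (k j) = \<alpha>" for j by (simp add: \<beta>_def k_def i)
    have "\<exists>g\<in>L_set \<phi> (thin_product a). \<exists>r. strict_mono (r :: nat \<Rightarrow> nat) \<and>
        (\<forall>z\<in>unit_disc. (\<lambda>j. thin_product a ((\<phi> ^^ (m \<circ> k) (r j)) z)) \<longlonglongrightarrow> g z)"
    proof (rule L_set_montel[OF \<phi> _ _ mk])
      show "thin_product a holomorphic_on unit_disc"
        unfolding thin_product_def by (intro holomorphic_on_disc_restrict holomorphic_on_blaschke_product bs)
      show "cmod (thin_product a z) \<le> 1" if "z \<in> unit_disc" for z
        using cmod_blaschke_product_le_1[OF bs that] that by (simp add: thin_product_def disc_restrict_def)
    qed
    then obtain g r where g: "g \<in> L_set \<phi> (thin_product a)"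
      "(\<lambda>j. thin_product a ((\<phi> ^^ (m \<circ> k) (r j)) \<alpha>)) \<longlonglongrightarrow> g \<alpha>" using \<alpha>D by blast
    have "thin_product a ((\<phi> ^^ (m \<circ> k) (r j)) \<alpha>) = 0" for j
    proof -
      have eq: "(\<phi> ^^ (m \<circ> k) (r j)) \<alpha> = a (k (r j))" by (simp add: a_def \<beta>k)
      have "a (k (r j)) \<in> unit_disc" using bs by (simp add: blaschke_sequence_def)
      then show ?thesis unfolding eq thin_product_def disc_restrict_def
        using blaschke_product_eq_0_iff[OF bs] by simp
    qed
    then have "g \<alpha> = 0" using g(2) by (simp add: LIMSEQ_const_iff)
    then show ?thesis using g(1) \<alpha>D by (auto simp: limit_zeros_def)
  qed
  moreover have "\<exists>m. \<exists>\<beta>\<in>A. a k = (\<phi> ^^ m) \<beta>" for k using \<beta>A by (auto simp: a_def)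
  ultimately show ?thesis using thin by blast
qed

text \<open>If the zeros tend to the boundary point opposite to the limit of the orbit of \<open>0\<close>, then their
  pseudo-hyperbolic distance to that orbit tends to 1, and no limit has a zero.\<close>

lemma thin_product_without_limit_zeros:
  assumes \<phi>: "disc_automorphism \<phi>" and \<zeta>: "\<zeta> \<in> unit_circle" "(\<lambda>n. (\<phi> ^^ n) 0) \<longlonglongrightarrow> \<zeta>"
  shows "\<exists>a. thin_sequence a \<and> limit_zeros \<phi> (thin_product a) = {}"
proof -
  define u where "u m = - \<zeta> * of_real (1 - 1 / real (Suc m))" for m
  have nu: "cmod (u m) = 1 - 1 / real (Suc m)" for m
    using \<zeta>(1) by (simp only: u_def norm_mult norm_minus_cancel norm_of_real) (simp add: field_simps)
  have lim1: "(\<lambda>m. 1 - 1 / real (Suc m)) \<longlonglongrightarrow> 1 - 0"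
    by (intro tendsto_intros lim_1_over_n[THEN LIMSEQ_Suc])
  have "\<exists>m. strict_mono m \<and> thin_sequence (\<lambda>n. u (m n))"
    by (rule thin_sequence_selection[of "\<lambda>n. u"]) (use lim1 in \<open>auto simp only: nu diff_0_right, auto\<close>)
  then obtain m where m: "strict_mono m" "thin_sequence (\<lambda>n. u (m n))" by blast
  define a where "a n = u (m n)" for n
  have thin: "thin_sequence a" using m(2) by (simp add: a_def[abs_def])
  have "u \<longlonglongrightarrow> - \<zeta> * of_real (1 - 0)" unfolding u_def by (intro tendsto_intros lim1)
  then have alim: "a \<longlonglongrightarrow> - \<zeta>"
    using LIMSEQ_subseq_LIMSEQ[OF _ m(1)] by (fastforce simp: a_def[abs_def] o_def)
  have a1: "cmod (a n) < 1" for n by (simp add: a_def nu)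
  have aut: "disc_automorphism (\<phi> ^^ k)" for k by (rule disc_automorphism_funpow[OF \<phi>])
  have False if \<alpha>: "\<alpha> \<in> limit_zeros \<phi> (thin_product a)" for \<alpha>
  proof -
    obtain k n x where x: "\<And>N. k N \<ge> N \<and> n N \<ge> N \<and> x N \<in> unit_disc \<and> (\<phi> ^^ k N) (x N) = a (n N)"
      "x \<longlonglongrightarrow> \<alpha>"
      using limit_zeros_member[OF \<phi> \<zeta> thin _ thin_product_disc \<alpha>] by auto
    define w where "w N = (\<phi> ^^ k N) 0" for N
    define v where "v N = a (n N)" for N
    have kinf: "filterlim k at_top sequentially"
      by (rule filterlim_at_top_mono[OF filterlim_ident]) (use x(1) in simp)
    have ninf: "filterlim n at_top sequentially"
      by (rule filterlim_at_top_mono[OF filterlim_ident]) (use x(1) in simp)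
    have wlim: "w \<longlonglongrightarrow> \<zeta>" using filterlim_compose[OF \<zeta>(2) kinf] by (simp add: w_def[abs_def])
    have vlim: "v \<longlonglongrightarrow> - \<zeta>" using filterlim_compose[OF alim ninf] by (simp add: v_def[abs_def])
    have w1: "cmod (w N) < 1" for N using disc_automorphism_in_disc[OF aut, of 0 "k N"] by (simp add: w_def)
    have eq: "1 - (cmod (x N))\<^sup>2 = (1 - (cmod (v N))\<^sup>2) * (1 - (cmod (w N))\<^sup>2) / (cmod (1 - cnj (w N) * v N))\<^sup>2" for N
    proof -
      have "x N \<in> unit_disc" using x(1) by blast
      then have "cmod (x N) = pseudo_hyperbolic (v N) (w N)"
        using disc_automorphism_isometry[OF aut, of "x N" 0 "k N"] x(1)[of N] by (simp add: v_def w_def)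
      then show ?thesis using one_minus_pseudo_hyperbolic_sq[of "v N" "w N"] a1 w1 by (simp add: v_def)
    qed
    have z2: "cnj \<zeta> * \<zeta> = 1" using \<zeta>(1)
      by (metis complex_norm_square mem_sphere_0 mult.commute of_real_1 one_power2)
    have "(\<lambda>N. (1 - (cmod (v N))\<^sup>2) * (1 - (cmod (w N))\<^sup>2) / (cmod (1 - cnj (w N) * v N))\<^sup>2)
        \<longlonglongrightarrow> (1 - (cmod (- \<zeta>))\<^sup>2) * (1 - (cmod \<zeta>)\<^sup>2) / (cmod (1 - cnj \<zeta> * (- \<zeta>)))\<^sup>2"
      by (intro tendsto_intros vlim wlim) (simp add: z2)
    then have "(\<lambda>N. 1 - (cmod (x N))\<^sup>2) \<longlonglongrightarrow> 0" using \<zeta>(1) by (simp add: eq)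
    moreover have "(\<lambda>N. 1 - (cmod (x N))\<^sup>2) \<longlonglongrightarrow> 1 - (cmod \<alpha>)\<^sup>2" by (intro tendsto_intros x(2))
    ultimately have "1 - (cmod \<alpha>)\<^sup>2 = 0" using LIMSEQ_unique by blast
    moreover have "0 < 1 - (cmod \<alpha>)\<^sup>2" using \<alpha> by (simp add: limit_zeros_def abs_square_less_1)
    ultimately show False by simp
  qed
  then show ?thesis using thin by blast
qed

section \<open>Closed spans of limit sets\<close>

text \<open>Riesz factorization, rephrased for a Blaschke product with an arbitrary unimodular factor.\<close>

lemma zbH2_eq_vanishing:
  assumes I: "blaschke_sequence I a" and inj: "inj_on a I" and c: "c \<in> unit_circle"
    and b: "b = (\<lambda>z. if z \<in> unit_disc then c * blaschke_product I a z else 0)"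
  shows "zbH2 b = {\<lambda>z. z * h z | h. h \<in> H2 \<and> (\<forall>\<alpha>\<in>a ` I. h \<alpha> = 0)}"
proof (intro equalityI subsetI)
  have c0: "c \<noteq> 0" using c by auto
  have bh: "b z * h z = c * (blaschke_product I a z * h z)" if "h \<in> H2" for z h
    using H2_zero_off[OF that] by (simp add: b)
  show "f \<in> {\<lambda>z. z * h z | h. h \<in> H2 \<and> (\<forall>\<alpha>\<in>a ` I. h \<alpha> = 0)}" if f: "f \<in> zbH2 b" for f
  proof -
    obtain h where h: "h \<in> H2" "f = (\<lambda>z. z * b z * h z)" using f by (auto simp: zbH2_def)
    define k where "k = (\<lambda>z. c * (blaschke_product I a z * h z))"
    have "k \<in> H2" unfolding k_def by (intro H2_cmult H2_mult_blaschke_product I h)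
    moreover have "k \<alpha> = 0" if "\<alpha> \<in> a ` I" for \<alpha>
    proof -
      have "\<alpha> \<in> unit_disc" using that I by (auto simp: blaschke_sequence_def)
      then show ?thesis using that blaschke_product_eq_0_iff[OF I] by (simp add: k_def)
    qed
    moreover have "f = (\<lambda>z. z * k z)" unfolding h(2) k_def by (simp add: mult.assoc bh[OF h(1)])
    ultimately show ?thesis by blast
  qed
  show "f \<in> zbH2 b" if f: "f \<in> {\<lambda>z. z * h z | h. h \<in> H2 \<and> (\<forall>\<alpha>\<in>a ` I. h \<alpha> = 0)}" for f
  proof -
    obtain h where h: "h \<in> H2" "f = (\<lambda>z. z * h z)" "\<forall>\<alpha>\<in>a ` I. h \<alpha> = 0" using f by blast
    then have "\<forall>n\<in>I. h (a n) = 0" by blast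
    then obtain k where k: "k \<in> H2" "h = (\<lambda>z. blaschke_product I a z * k z)"
      using H2_vanishing_iff_blaschke_multiple[OF I inj h(1)] by blast
    have ck: "(\<lambda>z. inverse c * k z) \<in> H2" by (rule H2_cmult[OF k(1)])
    have "f z = z * b z * (inverse c * k z)" for z
    proof -
      have "b z * (inverse c * k z) = h z" unfolding k(2) by (subst bh[OF ck]) (use c0 in simp)
      then show ?thesis by (simp add: h(2) mult.assoc)
    qed
    then show ?thesis
      using ck unfolding zbH2_def by (intro CollectI exI[of _ "\<lambda>z. inverse c * k z"] conjI ext)
  qed
qed

lemma closed_span_L_set:
  assumes "disc_automorphism \<phi>" "\<zeta> \<in> unit_circle" "(\<lambda>n. (\<phi> ^^ n) 0) \<longlonglongrightarrow> \<zeta>"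
    and "thin_sequence a" "c \<in> unit_circle"
    and "\<forall>z\<in>unit_disc. B z = c * blaschke_product UNIV a z"
  shows "H2_closure (complex_span (L_set \<phi> B)) =
    H2_orth {\<lambda>z. z * h z | h. h \<in> H2 \<and> (\<forall>\<alpha>\<in>limit_zeros \<phi> B. h \<alpha> = 0)}"
  unfolding H2_orth_L_set(2)[OF assms, symmetric]
  by (rule H2_orth_complex_span(3)[OF H2_orth_L_set(1)[OF assms]])

lemma H2_orth_of_uniqueness_set:
  assumes "\<And>h z. h \<in> H2 \<Longrightarrow> \<forall>\<alpha>\<in>A. h \<alpha> = 0 \<Longrightarrow> h z = 0"
  shows "H2_orth {\<lambda>z. z * h z | h. h \<in> H2 \<and> (\<forall>\<alpha>\<in>A. h \<alpha> = 0)} = H2"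
proof -
  have z: "H2_inner f (\<lambda>z. z * h z) = 0" if "h \<in> H2" "\<forall>\<alpha>\<in>A. h \<alpha> = 0" for f h
    using assms[OF that] taylor_coeff_const[of 0] by (simp add: H2_inner_def)
  show ?thesis using z by (auto simp: H2_orth_def)
qed

text \<open>Applied to \<open>\<phi>\<close> and to its inverse, \<open>cmod_blaschke_product_isometry_le\<close> gives equal moduli, and
  functions with equal moduli differ by a unimodular factor.\<close>

lemma blaschke_product_compose_automorphism:
  assumes \<phi>: "disc_automorphism \<phi>" and I: "blaschke_sequence I a" and inj: "inj_on a I"
    and fwd: "\<phi> ` a ` I \<subseteq> a ` I" and bwd: "\<And>\<alpha>. \<alpha> \<in> unit_disc \<Longrightarrow> \<phi> \<alpha> \<in> a ` I \<Longrightarrow> \<alpha> \<in> a ` I"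
  shows "\<exists>\<gamma>\<in>unit_circle. \<forall>z\<in>unit_disc. blaschke_product I a (\<phi> z) = \<gamma> * blaschke_product I a z"
proof (rule holomorphic_eq_modulus_imp_multiple)
  obtain \<psi> where \<psi>: "disc_automorphism \<psi>" "\<And>z. z \<in> unit_disc \<Longrightarrow> \<psi> (\<phi> z) = z"
    "\<And>z. z \<in> unit_disc \<Longrightarrow> \<phi> (\<psi> z) = z" using disc_automorphism_inverse[OF \<phi>] by auto
  have aD: "a n \<in> unit_disc" if "n \<in> I" for n using that I by (auto simp: blaschke_sequence_def)
  have iso: "\<tau> z \<in> unit_disc \<and> pseudo_hyperbolic (\<tau> z) (\<tau> w) = pseudo_hyperbolic z w"
    if "disc_automorphism \<tau>" "z \<in> unit_disc" "w \<in> unit_disc" for \<tau> z w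
    using disc_automorphism_in_disc[OF that(1,2)] disc_automorphism_isometry[OF that] by blast
  have \<psi>img: "\<psi> ` a ` I \<subseteq> a ` I"
  proof (intro subsetI, elim imageE)
    fix x w n assume "x = \<psi> w" "w = a n" "n \<in> I"
    then show "x \<in> a ` I"
      using bwd[of "\<psi> (a n)"] disc_automorphism_in_disc[OF \<psi>(1) aD] \<psi>(3)[OF aD] by simp
  qed
  show "blaschke_product I a holomorphic_on unit_disc" by (rule holomorphic_on_blaschke_product[OF I])
  then have "(blaschke_product I a \<circ> \<phi>) holomorphic_on unit_disc"
    using \<phi> by (intro holomorphic_on_compose_gen[of _ _ _ unit_disc]) (auto simp: disc_automorphism_def bij_betw_def)
  then show "(\<lambda>z. blaschke_product I a (\<phi> z)) holomorphic_on unit_disc" by (simp add: o_def)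
  show "cmod (blaschke_product I a (\<phi> z)) = cmod (blaschke_product I a z)" if z: "z \<in> unit_disc" for z
  proof (rule antisym)
    show "cmod (blaschke_product I a (\<phi> z)) \<le> cmod (blaschke_product I a z)"
      by (rule cmod_blaschke_product_isometry_le[OF I inj iso[OF \<phi>] fwd z])
    have "cmod (blaschke_product I a (\<psi> (\<phi> z))) \<le> cmod (blaschke_product I a (\<phi> z))"
      by (rule cmod_blaschke_product_isometry_le[OF I inj iso[OF \<psi>(1)] \<psi>img disc_automorphism_in_disc[OF \<phi> z]])
    then show "cmod (blaschke_product I a z) \<le> cmod (blaschke_product I a (\<phi> z))" by (simp add: \<psi>(2)[OF z])
  qed
qed

text \<open>The dichotomy is whether the common zeros of the limits form a uniqueness set for \<open>H\<^sup>2\<close>. If not,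
  they satisfy the Blaschke condition, and they are the zeros of \<open>b\<close>.\<close>

lemma closed_span_of_thin_product:
  assumes \<phi>: "disc_automorphism \<phi>" and \<zeta>: "\<zeta> \<in> unit_circle" "(\<lambda>n. (\<phi> ^^ n) 0) \<longlonglongrightarrow> \<zeta>"
    and B: "thin_blaschke_product B"
  shows "H2_closure (complex_span (L_set \<phi> B)) = H2 \<or>
    (\<exists>b. simple_blaschke_product b \<and>
      (\<exists>\<gamma>\<in>unit_circle. \<forall>z\<in>unit_disc. b (\<phi> z) = \<gamma> * b z) \<and>
      H2_closure (complex_span (L_set \<phi> B)) = H2_orth (zbH2 b))"
proof -
  obtain a c where a: "thin_sequence a" "c \<in> unit_circle"
    "B = (\<lambda>z. if z \<in> unit_disc then c * blaschke_product UNIV a z else 0)"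
    using B unfolding thin_blaschke_product_altdef by blast
  have BD: "\<forall>z\<in>unit_disc. B z = c * blaschke_product UNIV a z" by (simp add: a(3))
  define A where "A = limit_zeros \<phi> B"
  have AD: "A \<subseteq> unit_disc" by (auto simp: A_def limit_zeros_def)
  have clos: "H2_closure (complex_span (L_set \<phi> B)) = H2_orth {\<lambda>z. z * h z | h. h \<in> H2 \<and> (\<forall>\<alpha>\<in>A. h \<alpha> = 0)}"
    unfolding A_def by (rule closed_span_L_set[OF \<phi> \<zeta> a(1,2) BD])
  show ?thesis
  proof (cases "\<exists>h\<in>H2. (\<forall>\<alpha>\<in>A. h \<alpha> = 0) \<and> (\<exists>z. h z \<noteq> 0)")
    case False
    then have "H2_orth {\<lambda>z. z * h z | h. h \<in> H2 \<and> (\<forall>\<alpha>\<in>A. h \<alpha> = 0)} = H2"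
      by (intro H2_orth_of_uniqueness_set) blast
    then show ?thesis using clos by simp
  next
    case True
    then obtain h z0 where h: "h \<in> H2" "\<forall>\<alpha>\<in>A. h \<alpha> = 0" "h z0 \<noteq> 0" by blast
    have "(\<lambda>w. 1 - cmod w) summable_on A" by (rule H2_zeros_summable[OF h(1,3) AD]) (use h(2) in blast)
    then have "\<exists>I e. blaschke_sequence I e \<and> inj_on e I \<and> e ` I = A"
      using blaschke_enumeration[OF AD] by metis
    then obtain I e where e: "blaschke_sequence I e" "inj_on e I" "e ` I = A" by blast
    define b where "b = (\<lambda>z. if z \<in> unit_disc then 1 * blaschke_product I e z else 0)"
    have "simple_blaschke_product b"
      unfolding simple_blaschke_product_def blaschke_with_zeros_altdef
      using e(1,2) by (intro exI[of _ I] exI[of _ e] conjI bexI[of _ 1]) (auto simp: b_def)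
    moreover have "\<exists>\<gamma>\<in>unit_circle. \<forall>z\<in>unit_disc. b (\<phi> z) = \<gamma> * b z"
    proof -
      have "\<exists>\<gamma>\<in>unit_circle. \<forall>z\<in>unit_disc. blaschke_product I e (\<phi> z) = \<gamma> * blaschke_product I e z"
        using limit_zeros_image_subset[OF \<phi>, where B = B]
        by (intro blaschke_product_compose_automorphism \<phi> e) (simp_all add: e(3) A_def)
      then show ?thesis using disc_automorphism_in_disc[OF \<phi>] by (auto simp: b_def)
    qed
    moreover have "zbH2 b = {\<lambda>z. z * h z | h. h \<in> H2 \<and> (\<forall>\<alpha>\<in>A. h \<alpha> = 0)}"
      using zbH2_eq_vanishing[OF e(1,2) _ b_def] by (simp add: e(3))
    ultimately show ?thesis using clos by (intro disjI2 exI[of _ b]) simp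
  qed
qed

text \<open>Limits that vanish at points accumulating inside the disc already span a dense subspace, by the
  identity theorem; here the points are \<open>1 / (j + 2)\<close>.\<close>

lemma exists_thin_product_spanning_H2:
  assumes \<phi>: "disc_automorphism \<phi>" and \<zeta>: "\<zeta> \<in> unit_circle" "(\<lambda>n. (\<phi> ^^ n) 0) \<longlonglongrightarrow> \<zeta>"
  shows "\<exists>B. thin_blaschke_product B \<and> H2_closure (complex_span (L_set \<phi> B)) = H2"
proof -
  define A where "A = range (\<lambda>j. complex_of_real (1 / real (Suc (Suc j))))"
  have AD: "A \<subseteq> unit_disc" by (auto simp: A_def norm_divide simp del: of_real_divide of_nat_Suc)
  have ne: "A \<noteq> {}" "countable A" by (auto simp: A_def)
  obtain a where a: "thin_sequence a" "A \<subseteq> limit_zeros \<phi> (thin_product a)"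
    using thin_product_with_prescribed_limit_zeros[OF \<phi> \<zeta> AD ne] by blast
  have acc: "0 islimpt A"
    unfolding islimpt_sequential
  proof (intro exI conjI allI)
    show "complex_of_real (1 / real (Suc (Suc j))) \<in> A - {0}" for j
      by (simp add: A_def del: of_nat_Suc of_real_divide)
    have "(\<lambda>j. complex_of_real (1 / real (Suc (Suc j)))) \<longlonglongrightarrow> of_real 0"
      by (intro tendsto_of_real LIMSEQ_Suc lim_1_over_n)
    then show "(\<lambda>j. complex_of_real (1 / real (Suc (Suc j)))) \<longlonglongrightarrow> 0" by simp
  qed
  have "H2_orth {\<lambda>z. z * h z | h. h \<in> H2 \<and> (\<forall>\<alpha>\<in>limit_zeros \<phi> (thin_product a). h \<alpha> = 0)} = H2"
  proof (rule H2_orth_of_uniqueness_set)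
    fix h z assume h: "h \<in> H2" "\<forall>\<alpha>\<in>limit_zeros \<phi> (thin_product a). h \<alpha> = 0"
    show "h z = 0"
    proof (cases "z \<in> unit_disc")
      case True
      show ?thesis
        by (rule analytic_continuation[OF H2_holomorphic[OF h(1)] _ _ AD _ acc _ True]) (use h(2) a(2) in auto)
    qed (use H2_zero_off[OF h(1)] in simp)
  qed
  then have "H2_closure (complex_span (L_set \<phi> (thin_product a))) = H2"
    using closed_span_L_set[OF \<phi> \<zeta> a(1) _ thin_product_disc] by simp
  then show ?thesis using thin_blaschke_product_thin_product[OF a(1)] by blast
qed

text \<open>Let \<open>A\<close> be the zero set of \<open>b\<close>, and take zeros on the orbits of \<open>A\<close>. No limit vanishes outside \<open>A\<close>,
  because a zero of a limit is itself a limit of points whose orbits meet orbits of \<open>A\<close>; as \<open>|b|\<close> is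
  constant on orbits, \<open>b\<close> vanishes at these points, and then at their limit.\<close>

lemma exists_thin_product_spanning_model_space:
  assumes \<phi>: "disc_automorphism \<phi>" and \<zeta>: "\<zeta> \<in> unit_circle" "(\<lambda>n. (\<phi> ^^ n) 0) \<longlonglongrightarrow> \<zeta>"
    and b: "simple_blaschke_product b" and \<gamma>: "\<gamma> \<in> unit_circle" "\<forall>z\<in>unit_disc. b (\<phi> z) = \<gamma> * b z"
  shows "\<exists>B. thin_blaschke_product B \<and> H2_closure (complex_span (L_set \<phi> B)) = H2_orth (zbH2 b)"
proof -
  obtain I e c where e: "blaschke_sequence I e" "inj_on e I" and c: "c \<in> unit_circle"
    and b_eq: "b = (\<lambda>z. if z \<in> unit_disc then c * blaschke_product I e z else 0)"
    using b unfolding simple_blaschke_product_def blaschke_with_zeros_altdef by blast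
  define A where "A = e ` I"
  have AD: "A \<subseteq> unit_disc" using e(1) by (auto simp: A_def blaschke_sequence_def)
  have bz: "b z = 0 \<longleftrightarrow> z \<in> A" if "z \<in> unit_disc" for z
    using that c blaschke_product_eq_0_iff[OF e(1) that] by (auto simp: b_eq A_def)
  have aut: "disc_automorphism (\<phi> ^^ k)" for k by (rule disc_automorphism_funpow[OF \<phi>])
  have bpow: "b ((\<phi> ^^ k) z) = \<gamma> ^ k * b z" if "z \<in> unit_disc" for k z
  proof (induction k)
    case (Suc k)
    then show ?case using \<gamma>(2) disc_automorphism_in_disc[OF aut that, of k] by simp
  qed simp
  have "\<exists>a. thin_sequence a \<and> limit_zeros \<phi> (thin_product a) = A"
  proof (cases "A = {}")
    case True
    then show ?thesis using thin_product_without_limit_zeros[OF \<phi> \<zeta>] by simp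
  next
    case False
    have "countable A" by (simp add: A_def)
    then obtain a where a: "thin_sequence a" "\<forall>k. \<exists>m. \<exists>\<beta>\<in>A. a k = (\<phi> ^^ m) \<beta>"
      "A \<subseteq> limit_zeros \<phi> (thin_product a)"
      using thin_product_with_prescribed_limit_zeros[OF \<phi> \<zeta> AD False] by blast
    have "\<alpha> \<in> A" if \<alpha>: "\<alpha> \<in> limit_zeros \<phi> (thin_product a)" for \<alpha>
    proof -
      have \<alpha>D: "\<alpha> \<in> unit_disc" using \<alpha> by (simp add: limit_zeros_def)
      obtain k n x where x: "\<And>N. k N \<ge> N \<and> n N \<ge> N \<and> x N \<in> unit_disc \<and> (\<phi> ^^ k N) (x N) = a (n N)"
        "x \<longlonglongrightarrow> \<alpha>"
        using limit_zeros_member[OF \<phi> \<zeta> a(1) _ thin_product_disc \<alpha>] by auto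
      have "b (x N) = 0" for N
      proof -
        obtain m \<beta> where \<beta>: "\<beta> \<in> A" "a (n N) = (\<phi> ^^ m) \<beta>" using a(2) by blast
        have \<beta>D: "\<beta> \<in> unit_disc" using \<beta>(1) AD by blast
        have xN: "x N \<in> unit_disc" "(\<phi> ^^ k N) (x N) = (\<phi> ^^ m) \<beta>" using x(1)[of N] \<beta>(2) by auto
        have "\<gamma> ^ k N * b (x N) = \<gamma> ^ m * b \<beta>"
          using bpow[OF xN(1), of "k N"] bpow[OF \<beta>D, of m] xN(2) by simp
        then show ?thesis using bz[OF \<beta>D] \<beta>(1) \<gamma>(1) by auto
      qed
      moreover have "(\<lambda>N. b (x N)) \<longlonglongrightarrow> b \<alpha>"
      proof -
        have "b holomorphic_on unit_disc"
          unfolding b_eq by (rule holomorphic_transform[of "\<lambda>z. c * blaschke_product I e z"])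
            (auto intro!: holomorphic_intros holomorphic_on_blaschke_product e(1))
        then have "continuous_on unit_disc b" by (rule holomorphic_on_imp_continuous_on)
        then have "isCont b \<alpha>" using \<alpha>D continuous_on_eq_continuous_at[OF open_ball] by blast
        then show ?thesis using x(2) by (rule isCont_tendsto_compose)
      qed
      ultimately have "b \<alpha> = 0" by (simp add: LIMSEQ_const_iff)
      then show ?thesis using bz[OF \<alpha>D] by simp
    qed
    then show ?thesis using a by blast
  qed
  then obtain a where a: "thin_sequence a" "limit_zeros \<phi> (thin_product a) = A" by blast
  have "H2_closure (complex_span (L_set \<phi> (thin_product a))) = H2_orth (zbH2 b)"
    using closed_span_L_set[OF \<phi> \<zeta> a(1) _ thin_product_disc] zbH2_eq_vanishing[OF e c b_eq] a(2)
    by (simp add: A_def)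
  then show ?thesis using thin_blaschke_product_thin_product[OF a(1)] by blast
qed

theorem theorem2p4:
  fixes \<phi> :: "complex \<Rightarrow> complex"
  assumes "non_elliptic_automorphism \<phi>"
  shows "(\<forall>B. thin_blaschke_product B \<longrightarrow>
            H2_closure (complex_span (L_set \<phi> B)) = H2 \<or>
            (\<exists>b. simple_blaschke_product b \<and>
                 (\<exists>\<gamma>\<in>unit_circle. \<forall>z\<in>unit_disc. b (\<phi> z) = \<gamma> * b z) \<and>
                 H2_closure (complex_span (L_set \<phi> B)) = H2_orth (zbH2 b))) \<and>
         (\<forall>H. H = H2 \<or>
            (\<exists>b. simple_blaschke_product b \<and>
                 (\<exists>\<gamma>\<in>unit_circle. \<forall>z\<in>unit_disc. b (\<phi> z) = \<gamma> * b z) \<and>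
                 H = H2_orth (zbH2 b)) \<longrightarrow>
            (\<exists>B. thin_blaschke_product B \<and>
                 H2_closure (complex_span (L_set \<phi> B)) = H))"
proof -
  obtain \<zeta> where \<phi>: "disc_automorphism \<phi>" and \<zeta>: "\<zeta> \<in> unit_circle" "(\<lambda>n. (\<phi> ^^ n) 0) \<longlonglongrightarrow> \<zeta>"
    using non_elliptic_orbit[OF assms] by blast
  show ?thesis
  proof (intro conjI allI impI)
    fix B assume "thin_blaschke_product B"
    then show "H2_closure (complex_span (L_set \<phi> B)) = H2 \<or>
        (\<exists>b. simple_blaschke_product b \<and>
          (\<exists>\<gamma>\<in>unit_circle. \<forall>z\<in>unit_disc. b (\<phi> z) = \<gamma> * b z) \<and>
          H2_closure (complex_span (L_set \<phi> B)) = H2_orth (zbH2 b))"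
      by (rule closed_span_of_thin_product[OF \<phi> \<zeta>])
  next
    fix H assume "H = H2 \<or> (\<exists>b. simple_blaschke_product b \<and>
      (\<exists>\<gamma>\<in>unit_circle. \<forall>z\<in>unit_disc. b (\<phi> z) = \<gamma> * b z) \<and> H = H2_orth (zbH2 b))"
    then show "\<exists>B. thin_blaschke_product B \<and> H2_closure (complex_span (L_set \<phi> B)) = H"
    proof (elim disjE exE conjE bexE)
      assume "H = H2"
      then show ?thesis using exists_thin_product_spanning_H2[OF \<phi> \<zeta>] by simp
    next
      fix b \<gamma> assume "simple_blaschke_product b" "\<gamma> \<in> unit_circle"
        "\<forall>z\<in>unit_disc. b (\<phi> z) = \<gamma> * b z" "H = H2_orth (zbH2 b)"
      then show ?thesis using exists_thin_product_spanning_model_space[OF \<phi> \<zeta>, of b \<gamma>] by simp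
    qed
  qed
qed

end
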